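(* Let $(A(t))_{t\ge 1}$, $A(t)=I+C(t)-D(t)$, be a random matrix sequence satisfying all the standing assumptions of the model described in the context, with parameters $N$, $P$, $q,u,r\in[0,1]$, $\alpha,\beta\in\mathbb R$. Assume furthermore that $p_{ii}=0$ for all $i$, and that either there is a constant $c\in(0,1)$ such that $p_{ij}\in\{0,c\}$ for all $i,j$, or $\beta=0$. Let $1=\lambda_1\ge\lambda_2\ge\dots\ge\lambda_N$ be the (real) eigenvalues of $P$ and put, for each $j$, $$\Delta_j=1-2q\sqrt u\,(1-\lambda_j)+\alpha q^2(1-\lambda_j)^2,\qquad b_j=(1-\lambda_j)\Big((\beta-\alpha)(1-\lambda_j)-\beta c+2r^2\Big),$$ where the term $\beta c$ is read as $0$ when $\beta=0$. Let $\xi_1$ be the largest (real) root of the polynomial $$f(\xi)=\prod_{i>1}(\xi-\Delta_i)\Big(1-\frac{q^2}{N}\sum_{j>1}\frac{b_j}{\xi-\Delta_j}\Big).$$ Let $x(0)\in\mathbb R^N$, $w(0)=\mathbf 1$, and $x(t)=A(t)x(t-1)$, $w(t)=A(t)w(t-1)$ for $t\ge1$, and let $\bar x=N^{-1}\sum_j x_j(0)$. Then, almost surely, $$\limsup_{t\to\infty}\frac1t\max_i\log\left|\frac{x_i(t)}{w_i(t)}-\bar x\right|\le\frac12\log\xi_1 .$$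
   Context: Model. For each $t\ge1$, $C(t)=(c_{ij}(t))$ is a random $N\times N$ matrix with $c_{ij}(t)\ge0$, $c_{ii}(t)=0$ and $\sum_i c_{ij}(t)\le1$ for all $i,j$; $D(t)$ is the diagonal matrix with $D(t)_{jj}=\sum_i c_{ij}(t)$, so that $A(t)=I+C(t)-D(t)$ is non-negative and column-stochastic. $\mathbf 1$ is the all-ones vector, and $\log 0=-\infty$. Moment conditions. $P=(p_{ij})$ is a non-negative column-stochastic $N\times N$ matrix, $u,q,r\in[0,1]$, $\alpha,\beta$ are real constants, and with $C=C(1)$, $\mathbb E[C]=q\sqrt u\,P$ and, for all $i,j,k,l$, $$\mathbb E[c_{ji}c_{lk}]=\begin{cases}\alpha q^2p_{ji}p_{lk}& i\ne k,\\ \beta q^2p_{ji}p_{li}& i=k,\ j\ne l,\\ (qr)^2p_{ji}& i=k,\ j=l.\end{cases}$$ Standing assumptions on the communication: (1) $(C(t))_{t\ge1}$ is an i.i.d. sequence of non-negative matrices; (2) $C(1)$ satisfies the moment conditions above; (3) almost surely no row of $I+C(1)-D(1)$ is identically $0$; (4) with $m=\min\{C_{ij}(1): C_{ij}(1)>0\}$ one has $\mathbb E\log^- m>-\infty$, where $\log^- x=\min(\log x,0)$ (and $\log^-m=0$ if $C(1)=0$). Standing assumptions on the network: (1) $P=P^\top$; (2) the graph formed by the positive entries of $P$ is connected, and $q\sqrt u<1$; (3) $P$ is transitive: for all $i,j$ there is a permutation matrix $\Pi$ with $\Pi^{-1}P\Pi=P$ whose permutation maps $i$ to $j$. The expression for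 $f$ is understood as the polynomial $\prod_{i>1}(\xi-\Delta_i)-\frac{q^2}{N}\sum_{j>1}b_j\prod_{i>1,\,i\ne j}(\xi-\Delta_i)$. *)

theory Defs
  imports "HOL-Probability.Probability" "HOL-Computational_Algebra.Computational_Algebra"
begin

section \<open>The random matrices\<close>

text \<open>The entry \<open>c\<^sub>i\<^sub>j\<close> of \<open>C\<close> is \<open>C $ i $ j\<close>: row \<open>i\<close>, column \<open>j\<close>.\<close>

definition admissible :: "real^'n^'n \<Rightarrow> bool" where
  "admissible C \<longleftrightarrow>
     (\<forall>i j. 0 \<le> C $ i $ j) \<and> (\<forall>i. C $ i $ i = 0) \<and> (\<forall>j. (\<Sum>i\<in>UNIV. C $ i $ j) \<le> 1)"

definition col_sum_diag :: "real^'n^'n \<Rightarrow> real^'n^'n" where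
  "col_sum_diag C = (\<chi> i j. if i = j then (\<Sum>k\<in>UNIV. C $ k $ j) else 0)"

definition update_matrix :: "real^'n^'n \<Rightarrow> real^'n^'n" where
  "update_matrix C = mat 1 + C - col_sum_diag C"

primrec trajectory :: "(nat \<Rightarrow> real^'n^'n) \<Rightarrow> real^'n \<Rightarrow> nat \<Rightarrow> real^'n" where
  "trajectory A v 0 = v"
| "trajectory A v (Suc t) = A (Suc t) *v trajectory A v t"

text \<open>\<open>log\<^sup>- m = min (log m) 0\<close>, where \<open>m\<close> is the smallest positive entry of \<open>C\<close>;
  for \<open>C = 0\<close>, where there is no such entry, the value is \<open>0\<close>.\<close>

definition log_minus_min_pos_entry :: "real^'n^'n \<Rightarrow> real" where
  "log_minus_min_pos_entry C =
     (if C = 0 then 0 else min (ln (Min {C $ i $ j | i j. 0 < C $ i $ j})) 0)"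

definition moment_conditions ::
  "'w measure \<Rightarrow> ('w \<Rightarrow> real^'n^'n) \<Rightarrow> real^'n^'n \<Rightarrow> real \<Rightarrow> real \<Rightarrow> real \<Rightarrow> real \<Rightarrow> real \<Rightarrow> bool" where
  "moment_conditions M C P q u r \<alpha> \<beta> \<longleftrightarrow>
     (\<integral>\<omega>. C \<omega> \<partial>M) = (q * sqrt u) *\<^sub>R P \<and>
     (\<forall>i j k l. (\<integral>\<omega>. C \<omega> $ j $ i * C \<omega> $ l $ k \<partial>M) =
        (if i \<noteq> k then \<alpha> * q\<^sup>2 * P $ j $ i * P $ l $ k
         else if j \<noteq> l then \<beta> * q\<^sup>2 * P $ j $ i * P $ l $ i
         else (q * r)\<^sup>2 * P $ j $ i))"

text \<open>The defining constraints on the random matrices are required almost surely.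
  Since \<open>log\<^sup>- \<le> 0\<close>, the condition \<open>E log\<^sup>- m > -\<infinity>\<close> is integrability.\<close>

definition communication_assumptions ::
  "'w measure \<Rightarrow> (nat \<Rightarrow> 'w \<Rightarrow> real^'n^'n) \<Rightarrow> real^'n^'n \<Rightarrow> real \<Rightarrow> real \<Rightarrow> real \<Rightarrow> real \<Rightarrow> real \<Rightarrow> bool"
  where
  "communication_assumptions M C P q u r \<alpha> \<beta> \<longleftrightarrow>
     prob_space.indep_vars M (\<lambda>_. borel) C {1..} \<and>
     (\<forall>t\<ge>1. distr M borel (C t) = distr M borel (C 1)) \<and>
     (\<forall>t\<ge>1. AE \<omega> in M. admissible (C t \<omega>)) \<and>
     moment_conditions M (C 1) P q u r \<alpha> \<beta> \<and>
     (AE \<omega> in M. \<forall>i. row i (update_matrix (C 1 \<omega>)) \<noteq> 0) \<and>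
     integrable M (\<lambda>\<omega>. log_minus_min_pos_entry (C 1 \<omega>))"

section \<open>The network\<close>

definition column_stochastic :: "real^'n^'n \<Rightarrow> bool" where
  "column_stochastic P \<longleftrightarrow>
     (\<forall>i j. 0 \<le> P $ i $ j) \<and> (\<forall>j. (\<Sum>i\<in>UNIV. P $ i $ j) = 1)"

text \<open>The permutation matrix sending the basis vector \<open>e\<^sub>b\<close> to \<open>e\<close> with index \<open>\<pi> b\<close>.\<close>

definition perm_matrix :: "('n \<Rightarrow> 'n) \<Rightarrow> real^'n^'n" where
  "perm_matrix \<pi> = (\<chi> a b. if a = \<pi> b then 1 else 0)"

definition transitive_matrix :: "real^'n^'n \<Rightarrow> bool" where
  "transitive_matrix P \<longleftrightarrow>
     (\<forall>i j. \<exists>\<pi>. bij \<pi> \<and> \<pi> i = j \<and>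
        matrix_inv (perm_matrix \<pi>) ** P ** perm_matrix \<pi> = P)"

definition network_assumptions :: "real^'n^'n \<Rightarrow> real \<Rightarrow> real \<Rightarrow> bool" where
  "network_assumptions P q u \<longleftrightarrow>
     P = transpose P \<and>
     (\<forall>i j. (i, j) \<in> {(a, b). 0 < P $ a $ b}\<^sup>*) \<and>
     q * sqrt u < 1 \<and>
     transitive_matrix P"

section \<open>Spectral data\<close>

definition charpoly :: "real^'n^'n \<Rightarrow> real poly" where
  "charpoly A = det (mat [:0, 1:] - map_matrix (\<lambda>a. [:a:]) A)"

text \<open>\<open>lam 1 \<ge> lam 2 \<ge> \<dots> \<ge> lam N\<close> are the eigenvalues of \<open>A\<close>, all of them real and listed
  with multiplicity.\<close>

definition decreasing_eigenvalues :: "real^'n^'n \<Rightarrow> (nat \<Rightarrow> real) \<Rightarrow> bool" where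
  "decreasing_eigenvalues A lam \<longleftrightarrow>
     (\<forall>i j. 1 \<le> i \<and> i \<le> j \<and> j \<le> CARD('n) \<longrightarrow> lam j \<le> lam i) \<and>
     charpoly A = (\<Prod>j = 1..CARD('n). [:- lam j, 1:])"

definition Delta :: "real \<Rightarrow> real \<Rightarrow> real \<Rightarrow> (nat \<Rightarrow> real) \<Rightarrow> nat \<Rightarrow> real" where
  "Delta q u \<alpha> lam j = 1 - 2 * q * sqrt u * (1 - lam j) + \<alpha> * q\<^sup>2 * (1 - lam j)\<^sup>2"

definition b_coeff :: "real \<Rightarrow> real \<Rightarrow> real \<Rightarrow> real \<Rightarrow> (nat \<Rightarrow> real) \<Rightarrow> nat \<Rightarrow> real" where
  "b_coeff r \<alpha> \<beta> c lam j = (1 - lam j) * ((\<beta> - \<alpha>) * (1 - lam j) - \<beta> * c + 2 * r\<^sup>2)"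

definition f_poly :: "nat \<Rightarrow> real \<Rightarrow> (nat \<Rightarrow> real) \<Rightarrow> (nat \<Rightarrow> real) \<Rightarrow> real poly" where
  "f_poly N q \<Delta> b =
     (\<Prod>i = 2..N. [:- \<Delta> i, 1:]) -
     smult (q\<^sup>2 / real N) (\<Sum>j = 2..N. smult (b j) (\<Prod>i\<in>{2..N} - {j}. [:- \<Delta> i, 1:]))"

definition largest_root :: "real poly \<Rightarrow> real" where
  "largest_root p = Max {x. poly p x = 0}"

text \<open>The logarithm with \<open>log 0 = -\<infinity>\<close>, whereas \<open>ln 0 = 0\<close> in the library. It is meant for
  non-negative arguments only.\<close>

definition elog :: "real \<Rightarrow> ereal" where
  "elog x = (if x \<le> 0 then -\<infinity> else ereal (ln x))"

end

theory Submission
  imports Defs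
begin

text \<open>
  Put \<open>y(t) = x(t) - m w(t)\<close> with \<open>m\<close> the mean of \<open>x(0)\<close>; its entries sum to \<open>0\<close> and the relative error
  is \<open>y\<^sub>i(t) / w\<^sub>i(t)\<close>.

  Numerator. Let \<open>v\<^sub>k\<close> be an orthonormal eigenbasis of \<open>P\<close> and \<open>\<xi> > \<xi>\<^sub>1\<close>. For
  \<open>Q(y) = (\<Sum>k>1. (v\<^sub>k \<bullet> y)\<^sup>2 / (\<xi> - \<Delta>\<^sub>k))\<close> the moment conditions give
  \<open>E Q(A y) = (\<Sum>k>1. (\<Delta>\<^sub>k / (\<xi> - \<Delta>\<^sub>k) + g) (v\<^sub>k \<bullet> y)\<^sup>2)\<close>, where transitivity makes the diagonal
  correction \<open>g\<close> a scalar, and \<open>g \<le> 1\<close> is what \<open>f(\<xi>) > 0\<close> says. Hence \<open>E Q(A y) \<le> \<xi> Q(y)\<close>, and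
  \<open>\<bar>y(t)\<bar>\<^sup>2 = O(\<xi>\<^sup>t)\<close> almost surely for every \<open>\<xi> > \<xi>\<^sub>1\<close>, \<open>\<xi> > 0\<close>.

  Denominator. The weights may be tiny at some times, but \<open>max\<^sub>i \<bar>y\<^sub>i(t)\<bar> / w\<^sub>i(t)\<close> never increases, so a lower
  bound on \<open>w\<close> at times with gaps \<open>o(t)\<close> is enough. There is a finite product \<open>U\<close> of matrices from the
  support of the law of \<open>A(1)\<close> such that the entries of \<open>U W 1\<close> are bounded below uniformly in all further
  products \<open>W\<close>, and factors close to those of \<open>U\<close> recur often enough.
\<close>

(* The formal power series notation makes every vector component ambiguous. *)
no_notation fps_nth (infixl \<open>$\<close> 75)

section \<open>Spectral decomposition of symmetric matrices\<close>

text \<open>The weights of \<open>Q\<close> come from a dual eigenvector. If the diagonal correction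
  of each mode were already averaged over the nodes, the second moments e_k of the coefficients of
  y(t) would be dominated by the evolution that sends e_k to \<Delta>_k e_k + (q^2 b_k / N) times
  the sum of all e_m. That is a diagonal matrix plus one of rank one; its characteristic polynomial
  is \<open>f_poly\<close>, and its left eigenvector at a root \<xi> has the entries 1 / (\<xi> -
  \<Delta>_k). The actual correction of a single mode varies from node to node. Only its sum against
  weights that depend on the eigenvalue alone is constant, so the estimate runs through
  \<open>Q\<close> and not through the e_k one by one. For the weights, symmetry of \<open>P\<close>
  makes the mean of A(1) fix the vector 1, although A(1) itself does not; this is what makes a
  product \<open>U\<close> with a uniform bound possible.\<close>

lemma self_adjoint_eigenvector:
  fixes f :: "'a::euclidean_space \<Rightarrow> 'a"
  assumes f: "linear f" and sa: "\<And>x y. f x \<bullet> y = x \<bullet> f y"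
    and V: "subspace V" "f ` V \<subseteq> V" "V \<noteq> {0}"
  obtains u l where "u \<in> V" "norm u = 1" "f u = l *\<^sub>R u"
proof -
  define K where "K = sphere 0 1 \<inter> V"
  have "compact K" unfolding K_def using V(1) by (intro compact_Int_closed closed_subspace) auto
  obtain a where a: "a \<in> V" "a \<noteq> 0" using V(1,3) subspace_0 by blast
  then have "a /\<^sub>R norm a \<in> K" using V(1) by (auto simp: K_def subspace_scale)
  then have "K \<noteq> {}" by auto
  moreover have "continuous_on K (\<lambda>x. x \<bullet> f x)"
    using f by (intro continuous_intros linear_continuous_on) (simp add: linear_conv_bounded_linear)
  ultimately obtain u where u: "u \<in> K" and mx: "\<And>y. y \<in> K \<Longrightarrow> y \<bullet> f y \<le> u \<bullet> f u"
    using continuous_attains_sup[OF \<open>compact K\<close>] by blast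
  \<comment> \<open>The unit vector \<open>u\<close> maximises the Rayleigh quotient on
    \<open>V\<close>, so \<open>l\<close> times the squared norm minus the form of \<open>f\<close>
    is non-negative on \<open>V\<close> and vanishes at \<open>u\<close>. Its first variation in the
    direction \<open>w\<close> is twice \<open>w \<bullet> w\<close>, which forces
    \<open>w = 0\<close>.\<close>
  define l where "l = u \<bullet> f u"
  have nu: "u \<bullet> u = 1" and uV: "u \<in> V" using u by (auto simp: K_def norm_eq_1)
  have le: "y \<bullet> f y \<le> l * (y \<bullet> y)" if "y \<in> V" for y
  proof (cases "y = 0")
    case False
    have "(y /\<^sub>R norm y) \<bullet> f (y /\<^sub>R norm y) \<le> l"
      unfolding l_def using that False V(1) by (intro mx) (auto simp: K_def subspace_scale)
    also have "(y /\<^sub>R norm y) \<bullet> f (y /\<^sub>R norm y) = (y \<bullet> f y) / (norm y)\<^sup>2"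
      using f by (simp add: linear_cmul power2_eq_square divide_inverse algebra_simps)
    finally show ?thesis using False by (simp add: field_simps power2_norm_eq_inner)
  qed (use f in \<open>auto simp: linear_0\<close>)
  define w where "w = l *\<^sub>R u - f u"
  have wV: "w \<in> V" using uV V by (auto simp: w_def subspace_diff subspace_scale)
  define B where "B = l * (w \<bullet> w) - w \<bullet> f w"
  have "B \<ge> 0" using le[OF wV] by (simp add: B_def)
  have quad: "2 * t * (w \<bullet> w) + t\<^sup>2 * B \<ge> 0" for t
  proof -
    have 1: "u + t *\<^sub>R w \<in> V" using uV wV V(1) by (auto simp: subspace_add subspace_scale)
    have fe: "f (u + t *\<^sub>R w) = f u + t *\<^sub>R f w" using f by (simp add: linear_add linear_cmul)
    have 2: "(u + t *\<^sub>R w) \<bullet> f (u + t *\<^sub>R w) = l + 2 * t * (w \<bullet> f u) + t\<^sup>2 * (w \<bullet> f w)"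
      unfolding fe using sa[of u w]
      by (simp add: inner_simps l_def power2_eq_square inner_commute algebra_simps)
    have 3: "(u + t *\<^sub>R w) \<bullet> (u + t *\<^sub>R w) = 1 + 2 * t * (w \<bullet> u) + t\<^sup>2 * (w \<bullet> w)"
      using nu by (simp add: inner_simps power2_eq_square inner_commute algebra_simps)
    have 4: "w \<bullet> w = l * (w \<bullet> u) - w \<bullet> f u"
    proof -
      have "w \<bullet> w = w \<bullet> (l *\<^sub>R u - f u)" by (simp add: w_def)
      then show ?thesis by (simp add: inner_simps)
    qed
    show ?thesis using le[OF 1] unfolding 2 3 B_def 4 by (simp add: algebra_simps)
  qed
  have "w \<bullet> w = 0"
  proof (rule ccontr)
    assume "w \<bullet> w \<noteq> 0" then have p: "w \<bullet> w > 0" by (metis inner_gt_zero_iff inner_eq_zero_iff)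
    \<comment> \<open>The denominator \<open>B + 1\<close> covers \<open>B = 0\<close>; at
      \<open>t = -s\<close> the linear term outweighs the quadratic one.\<close>
    define s where "s = (w \<bullet> w) / (B + 1)"
    have s: "s > 0" "s * (B + 1) = w \<bullet> w" using p \<open>B \<ge> 0\<close> by (auto simp: s_def)
    have "0 \<le> s * (s * B - 2 * (w \<bullet> w))" using quad[of "-s"] by (simp add: power2_eq_square algebra_simps)
    then have "2 * (w \<bullet> w) \<le> s * B" using s by (simp add: zero_le_mult_iff)
    then show False using s p by (simp add: algebra_simps)
  qed
  then have "f u = l *\<^sub>R u" by (simp add: w_def)
  then show thesis using that uV nu by (simp add: norm_eq_1)
qed

text \<open>Induction on the dimension: by self-adjointness the orthogonal complement of an
  eigenvector inside an invariant subspace is again invariant. Working in subspaces allows a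
  prescribed eigenvector to be completed to a basis.\<close>

lemma self_adjoint_eigenbasis:
  fixes f :: "'a::euclidean_space \<Rightarrow> 'a"
  assumes f: "linear f" and sa: "\<And>x y. f x \<bullet> y = x \<bullet> f y"
    and V: "subspace V" "f ` V \<subseteq> V"
  shows "\<exists>B. finite B \<and> B \<subseteq> V \<and> pairwise orthogonal B \<and> card B = dim V \<and>
    (\<forall>v\<in>B. norm v = 1 \<and> (\<exists>l. f v = l *\<^sub>R v))"
  using V
proof (induction "dim V" arbitrary: V)
  case 0
  then show ?case by (intro exI[of _ "{}"]) auto
next
  case (Suc n)
  then have "V \<noteq> {0}" by auto
  then obtain u l where u: "u \<in> V" "norm u = 1" "f u = l *\<^sub>R u"
    using self_adjoint_eigenvector[OF f sa] Suc.prems by blast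
  define W where "W = {x \<in> V. orthogonal u x}"
  have W: "subspace W"
    unfolding W_def using Suc.prems(1)
    by (auto simp: subspace_def orthogonal_def inner_simps)
  have fW: "f ` W \<subseteq> W"
  proof -
    have "u \<bullet> f x = 0" if "u \<bullet> x = 0" for x
      using sa[of u x] that by (simp add: u(3))
    then show ?thesis using Suc.prems(2) by (auto simp: W_def orthogonal_def)
  qed
  have sV: "span V = V" using Suc.prems by simp
  have ou: "W = {y \<in> V. \<forall>x\<in>span {u}. orthogonal x y}"
    by (auto simp: W_def span_singleton orthogonal_def)
  have "dim {y \<in> span V. \<forall>x\<in>span {u}. orthogonal x y} + dim (span {u}) = dim (span V)"
    by (rule dim_subspace_orthogonal_to_vectors)
      (use u sV in \<open>simp_all add: span_base span_mono\<close>)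
  moreover have "dim (span {u}) = 1" using u by (auto simp: dim_span)
  ultimately have "n = dim W" using Suc.hyps(2) by (simp add: ou sV)
  from Suc.hyps(1)[OF this W fW] obtain B where B: "finite B" "B \<subseteq> W" "pairwise orthogonal B" "card B = dim W"
    "\<forall>v\<in>B. norm v = 1 \<and> (\<exists>l. f v = l *\<^sub>R v)" by blast
  have uB: "u \<notin> B" using B(2) u(2) by (auto simp: W_def orthogonal_def norm_eq_1)
  show ?case
    by (rule exI[of _ "insert u B"])
      (use B u uB Suc.hyps(2) \<open>n = dim W\<close> in \<open>auto simp: W_def pairwise_insert orthogonal_commute\<close>)
qed

text \<open>Diagonalising on the orthogonal complement of the constant vector puts that vector into
  the basis even when the eigenvalue 1 is multiple. Indexing by \<open>'n\<close>, with
  \<open>k0\<close> for the constant direction, replaces the numbering of the eigenvalues until they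
  are matched with \<open>lam\<close>.\<close>

lemma symmetric_eigenbasis:
  fixes P :: "real^'n^'n"
  assumes sym: "transpose P = P" and P1: "P *v 1 = 1"
  obtains v :: "'n \<Rightarrow> real^'n" and l :: "'n \<Rightarrow> real" and k0 :: 'n
  where "\<And>i j. v i \<bullet> v j = (if i = j then 1 else 0)" "\<And>i. P *v v i = l i *\<^sub>R v i"
    "v k0 = (1 / sqrt CARD('n)) *\<^sub>R 1" "l k0 = 1"
proof -
  define f where "f = (*v) P"
  have lin: "linear f" unfolding f_def by simp
  have sa: "f x \<bullet> y = x \<bullet> f y" for x y
    unfolding f_def using dot_lmul_matrix[of x P y] sym
    by (metis transpose_matrix_vector inner_commute)
  define N where "N = real CARD('n)"
  have N: "N > 0" unfolding N_def by simp
  define u :: "real^'n" where "u = (1 / sqrt N) *\<^sub>R 1"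
  have one: "(1::real^'n) \<bullet> 1 = N" by (simp add: inner_vec_def N_def)
  have u1: "u \<bullet> u = 1" unfolding u_def using N by (simp add: one)
  have fu: "f u = u" unfolding f_def u_def using P1 by (simp add: matrix_vector_mult_scaleR)
  define W where "W = {x. orthogonal u x}"
  have W: "subspace W" unfolding W_def by (auto simp: subspace_def orthogonal_def inner_simps)
  have fW: "f ` W \<subseteq> W" using sa[of u] fu by (auto simp: W_def orthogonal_def)
  obtain B where B: "finite B" "B \<subseteq> W" "pairwise orthogonal B" "card B = dim W"
    "\<forall>v\<in>B. norm v = 1 \<and> (\<exists>l. f v = l *\<^sub>R v)"
    using self_adjoint_eigenbasis[OF lin sa W fW] by blast
  have ou: "W = {y \<in> UNIV. \<forall>x\<in>span {u}. orthogonal x y}"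
    by (auto simp: W_def span_singleton orthogonal_def)
  have "dim {y \<in> span UNIV. \<forall>x\<in>span {u}. orthogonal x y} + dim (span {u}) = dim (span (UNIV::(real^'n) set))"
    by (rule dim_subspace_orthogonal_to_vectors) auto
  moreover have "dim (span {u}) = 1" using u1 by (auto simp: dim_span)
  ultimately have dW: "Suc (dim W) = CARD('n)" by (simp add: ou)
  have uB: "u \<notin> B" using B(2) u1 by (auto simp: W_def orthogonal_def)
  have cB: "card (insert u B) = CARD('n)" using B uB dW by simp
  obtain v where v: "bij_betw v (UNIV::'n set) (insert u B)"
    using finite_same_card_bij[of "UNIV::'n set" "insert u B"] B(1) cB by auto
  have "\<forall>i. \<exists>l. f (v i) = l *\<^sub>R v i"
  proof
    fix i have "v i \<in> insert u B" using v by (auto simp: bij_betw_def)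
    then show "\<exists>l. f (v i) = l *\<^sub>R v i" using B(5) fu by (auto intro: exI[of _ 1])
  qed
  then obtain l where l: "\<And>i. f (v i) = l i *\<^sub>R v i" by metis
  obtain k0 where k0: "v k0 = u" using v by (metis bij_betw_def imageE insertI1)
  have po: "pairwise orthogonal (insert u B)"
    using B(2,3) by (auto simp: W_def pairwise_insert orthogonal_commute)
  have nrm: "norm x = 1" if "x \<in> insert u B" for x using that B(5) u1 by (auto simp: norm_eq_1)
  show thesis
  proof (rule that[of v l k0])
    show "v i \<bullet> v j = (if i = j then 1 else 0)" for i j
      using po nrm v unfolding bij_betw_def pairwise_def orthogonal_def norm_eq_1 inj_def
      by (smt (verit) UNIV_I imageI)
    show "P *v v i = l i *\<^sub>R v i" for i using l by (simp add: f_def)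
    show "v k0 = (1 / sqrt CARD('n)) *\<^sub>R 1" using k0 by (simp add: u_def N_def)
    have "l k0 *\<^sub>R u = u" using l[of k0] k0 fu by simp
    then show "l k0 = 1" using u1 by (metis inner_scaleR_left mult.right_neutral)
  qed
qed

text \<open>Parseval's identity in polarised form: a square matrix with orthonormal rows also has
  orthonormal columns.\<close>

lemma orthonormal_expansion:
  fixes v :: "'n \<Rightarrow> real^'n"
  assumes on: "\<And>i j. v i \<bullet> v j = (if i = j then 1 else 0)"
  shows "(\<Sum>k\<in>UNIV. (v k \<bullet> x) * (v k \<bullet> y)) = x \<bullet> y"
proof -
  define Q :: "real^'n^'n" where "Q = (\<chi> k. v k)"
  have "Q ** transpose Q = mat 1"
    using on by (auto simp: Q_def vec_eq_iff matrix_matrix_mult_def transpose_def mat_def inner_vec_def)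
  then have T: "transpose Q ** Q = mat 1" by (simp add: matrix_left_right_inverse)
  have c: "(Q *v x) $ k = v k \<bullet> x" for k x by (simp add: Q_def matrix_vector_mult_def inner_vec_def)
  have "(\<Sum>k\<in>UNIV. (v k \<bullet> x) * (v k \<bullet> y)) = (Q *v x) \<bullet> (Q *v y)" by (simp add: inner_vec_def c)
  also have "\<dots> = x \<bullet> (transpose Q *v (Q *v y))"
    by (metis dot_lmul_matrix inner_commute transpose_matrix_vector transpose_transpose)
  also have "\<dots> = x \<bullet> y" by (simp add: matrix_vector_mul_assoc T)
  finally show ?thesis .
qed

lemma poly_det:
  fixes A :: "real poly^'n^'n"
  shows "poly (det A) x = det (map_matrix (\<lambda>p. poly p x) A)"
  by (simp add: det_def poly_sum poly_prod map_matrix_def)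

text \<open>Conjugation by the orthogonal matrix of eigenvectors makes x I - P diagonal for each
  real x, and a real polynomial is determined by its values.\<close>

lemma charpoly_eigenbasis:
  fixes P :: "real^'n^'n" and v :: "'n \<Rightarrow> real^'n"
  assumes on: "\<And>i j. v i \<bullet> v j = (if i = j then 1 else 0)" and ev: "\<And>i. P *v v i = l i *\<^sub>R v i"
  shows "charpoly P = (\<Prod>k\<in>UNIV. [:- l k, 1:])"
proof (rule poly_eq_poly_eq_iff[THEN iffD1], rule ext)
  define Q :: "real^'n^'n" where "Q = (\<chi> k. v k)"
  have Q: "Q ** transpose Q = mat 1"
    using on by (auto simp: Q_def vec_eq_iff matrix_matrix_mult_def transpose_def mat_def inner_vec_def)
  fix x :: real
  have e: "map_matrix (\<lambda>p. poly p x) (mat [:0, 1:] - map_matrix (\<lambda>a. [:a:]) P) = mat x - P"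
    by (simp add: vec_eq_iff map_matrix_def mat_def)
  have "(P ** transpose Q) $ i $ j = l j * v j $ i" for i j
    using ev[of j] by (simp add: vec_eq_iff matrix_matrix_mult_def matrix_vector_mult_def Q_def transpose_def)
  moreover have "(mat x ** transpose Q) $ i $ j = x * v j $ i" for i j
    by (simp add: matrix_matrix_mult_def Q_def transpose_def mat_def if_distrib if_distribR cong: if_cong)
  ultimately have e2: "((mat x - P) ** transpose Q) $ i $ j = (x - l j) * v j $ i" for i j
    by (simp add: matrix_matrix_mult_def left_diff_distrib sum_subtractf)
  have "(Q ** ((mat x - P) ** transpose Q)) $ i $ j = (x - l j) * (v i \<bullet> v j)" for i j
    by (simp add: matrix_matrix_mult_def[of Q] e2 inner_vec_def sum_distrib_left) (simp add: Q_def mult_ac)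
  then have d: "Q ** ((mat x - P) ** transpose Q) = (\<chi> i j. if i = j then x - l i else 0)"
    using on by (auto simp: vec_eq_iff)
  have "det Q * det (transpose Q) = 1" using Q by (metis det_I det_mul)
  then have "det (mat x - P) = det (Q ** ((mat x - P) ** transpose Q))" by (simp add: det_mul)
  also have "\<dots> = (\<Prod>k\<in>UNIV. x - l k)" unfolding d by (subst det_diagonal) auto
  finally show "poly (charpoly P) x = poly (\<Prod>k\<in>UNIV. [:- l k, 1:]) x"
    by (simp add: charpoly_def poly_det e poly_prod)
qed

section \<open>Characteristic roots\<close>

lemma proots_prod_linear:
  fixes f :: "'b \<Rightarrow> real"
  assumes "finite A"
  shows "proots (\<Prod>x\<in>A. [:- f x, 1:]) = image_mset f (mset_set A)"
  using assms
proof induction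
  case (insert x F)
  have "(\<Prod>x\<in>F. [:- f x, 1:]) \<noteq> 0" using insert.hyps by (simp add: prod_zero_iff)
  then show ?case unfolding prod.insert[OF insert.hyps]
    by (subst proots_mult) (use insert in \<open>auto simp del: mult_pCons_left\<close>)
qed simp

text \<open>Both factorisations of the characteristic polynomial have the same multiset of roots.
  One copy of the root 1 is removed on either side: at \<open>k0\<close>, and at index 1, where
  \<open>lam 1 = 1\<close> as the largest root. Sums over the modes other than \<open>k0\<close>
  thereby become sums over 2..N.\<close>

lemma remaining_eigenvalues:
  fixes P :: "real^'n^'n" and l :: "'n \<Rightarrow> real"
  assumes cp: "charpoly P = (\<Prod>k\<in>UNIV. [:- l k, 1:])" and le: "\<And>k. l k \<le> 1" and k0: "l k0 = 1"
    and dec: "decreasing_eigenvalues P lam"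
  shows "image_mset l (mset_set (- {k0})) = image_mset lam (mset_set {2..CARD('n)})"
proof -
  define N where "N = CARD('n)"
  have N: "N \<ge> 1" by (simp add: N_def)
  have eq: "image_mset l (mset_set UNIV) = image_mset lam (mset_set {1..N})"
    using proots_prod_linear[of "UNIV::'n set" l] proots_prod_linear[of "{1..N}" lam] cp dec
    by (simp add: decreasing_eigenvalues_def N_def)
  have lam1: "lam 1 = 1"
  proof (rule antisym)
    have "lam 1 \<in># image_mset l (mset_set UNIV)" unfolding eq using N by auto
    then show "lam 1 \<le> 1" using le by auto
    have "1 \<in># image_mset lam (mset_set {1..N})" unfolding eq[symmetric] using k0 by (auto intro: rev_image_eqI)
    then obtain j where "j \<in> {1..N}" "lam j = 1" by auto
    then show "1 \<le> lam 1"
      using dec[unfolded decreasing_eigenvalues_def, THEN conjunct1, rule_format, of 1 j] by (simp add: N_def)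
  qed
  have "mset_set (UNIV::'n set) = add_mset k0 (mset_set (-{k0}))"
    using mset_set.insert_remove[of UNIV k0] by (simp add: Compl_eq_Diff_UNIV)
  moreover have "mset_set {1..N} = add_mset 1 (mset_set {2..N})"
  proof -
    have "{1..N} = insert 1 {2..N}" using N by auto
    then show ?thesis by simp
  qed
  ultimately show ?thesis using eq lam1 k0 by (simp add: N_def)
qed

lemma poly_f_poly:
  "poly (f_poly N q \<Delta> b) x = (\<Prod>i=2..N. x - \<Delta> i) -
     q\<^sup>2 / N * (\<Sum>j=2..N. b j * (\<Prod>i\<in>{2..N} - {j}. x - \<Delta> i))"
  by (simp add: f_poly_def poly_prod poly_sum)

text \<open>To the right of all \<open>\<Delta> j\<close> the polynomial is the product of the
  \<open>x - \<Delta> j\<close> times \<open>1 - g x\<close>. It is positive far out, so by the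
  intermediate value theorem every point where it is not positive lies at or below a root, hence
  below \<open>\<xi>\<close>. The greatest \<open>\<Delta> j\<close> is such a point, and
  \<open>\<xi>\<close> itself is not.\<close>

lemma above_largest_root:
  assumes N: "N \<ge> 2" and b: "\<And>j. j \<in> {2..N} \<Longrightarrow> 0 \<le> q\<^sup>2 * b j"
    and \<xi>: "\<xi> > largest_root (f_poly N q \<Delta> b)"
  shows "\<And>j. j \<in> {2..N} \<Longrightarrow> \<Delta> j < \<xi>" "q\<^sup>2 / N * (\<Sum>j=2..N. b j / (\<xi> - \<Delta> j)) < 1"
proof -
  define f where "f = poly (f_poly N q \<Delta> b)"
  define g where "g x = q\<^sup>2 / N * (\<Sum>j=2..N. b j / (x - \<Delta> j))" for x
  have fg: "f x = (\<Prod>i=2..N. x - \<Delta> i) * (1 - g x)" if "\<And>j. j \<in> {2..N} \<Longrightarrow> \<Delta> j < x" for x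
  proof -
    have "(\<Prod>i\<in>{2..N} - {j}. x - \<Delta> i) = (\<Prod>i=2..N. x - \<Delta> i) / (x - \<Delta> j)" if "j \<in> {2..N}" for j
      using \<open>\<And>j. j \<in> {2..N} \<Longrightarrow> \<Delta> j < x\<close>[OF that] that prod.remove[of "{2..N}" j "\<lambda>i. x - \<Delta> i"] by simp
    then show ?thesis
      unfolding f_def poly_f_poly g_def by (simp add: right_diff_distrib sum_distrib_left mult_ac)
  qed
  define D where "D = Max (\<Delta> ` {2..N})"
  have D: "\<Delta> j \<le> D" if "j \<in> {2..N}" for j using that by (simp add: D_def)
  have "D \<in> \<Delta> ` {2..N}" unfolding D_def using N by (intro Max_in) auto
  then obtain m where m: "m \<in> {2..N}" "D = \<Delta> m" by auto
  define B where "B = (\<Sum>j=2..N. q\<^sup>2 / N * b j)"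
  have bN: "0 \<le> q\<^sup>2 / N * b j" if "j \<in> {2..N}" for j using b[OF that] by simp
  have B0: "B \<ge> 0" unfolding B_def using bN by (intro sum_nonneg) auto
  \<comment> \<open>At distance at least \<open>1 + B\<close> from every \<open>\<Delta> j\<close>
    the sum \<open>g x\<close> is at most \<open>B / (1 + B)\<close>.\<close>
  have large: "f x > 0" if x: "x \<ge> D + 1 + B" for x
  proof -
    have xj: "x - \<Delta> j \<ge> 1 + B" if "j \<in> {2..N}" for j using D[OF that] x by simp
    have "g x = (\<Sum>j=2..N. (q\<^sup>2 / N * b j) / (x - \<Delta> j))" by (simp add: g_def sum_distrib_left)
    also have "\<dots> \<le> (\<Sum>j=2..N. (q\<^sup>2 / N * b j) / (1 + B))"
      using xj bN B0 by (intro sum_mono divide_left_mono) (auto intro!: mult_pos_pos, fastforce)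
    also have "\<dots> = B / (1 + B)" by (simp add: B_def sum_divide_distrib)
    also have "\<dots> < 1" using B0 by simp
    finally have "g x < 1" .
    moreover have "(\<Prod>i=2..N. x - \<Delta> i) > 0" using xj B0 by (intro prod_pos) fastforce
    ultimately show ?thesis using fg[of x] xj B0 by fastforce
  qed
  have fD: "f D \<le> 0"
  proof -
    \<comment> \<open>The full product vanishes at a maximal \<open>\<Delta> j\<close>, and what is
      subtracted is a sum of non-negative terms.\<close>
    have z: "(\<Prod>i=2..N. D - \<Delta> i) = 0" using m by (auto simp: prod_zero_iff)
    moreover have "0 \<le> (\<Sum>j=2..N. (q\<^sup>2 / N * b j) * (\<Prod>i\<in>{2..N} - {j}. D - \<Delta> i))"
      using D by (intro sum_nonneg mult_nonneg_nonneg[OF bN] prod_nonneg) auto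
    ultimately show ?thesis unfolding f_def poly_f_poly z by (simp add: sum_distrib_left mult_ac)
  qed
  \<comment> \<open>\<open>largest_root\<close> is a \<open>Max\<close>, so the set of roots has to
    be finite before it bounds any root.\<close>
  have "f_poly N q \<Delta> b \<noteq> 0" using large[of "D + 1 + B"] by (auto simp: f_def)
  then have fin: "finite {x. f x = 0}" unfolding f_def by (rule poly_roots_finite)
  have cont: "continuous_on S f" for S unfolding f_def by (intro continuous_intros)
  have root: "a < \<xi>" if "f a \<le> 0" for a
  proof -
    define e where "e = max a (D + 1 + B)"
    have "\<exists>x\<ge>a. x \<le> e \<and> f x = 0"
      using that large[of e] by (intro IVT' cont) (auto simp: e_def)
    then obtain x where "x \<ge> a" "f x = 0" by blast
    moreover from this have "x \<le> largest_root (f_poly N q \<Delta> b)"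
      unfolding largest_root_def using fin by (intro Max_ge) (auto simp: f_def)
    ultimately show ?thesis using \<xi> by simp
  qed
  show 1: "\<Delta> j < \<xi>" if "j \<in> {2..N}" for j using D[OF that] root[OF fD] by simp
  have "f \<xi> > 0" using root[of \<xi>] by fastforce
  moreover have "(\<Prod>i=2..N. \<xi> - \<Delta> i) > 0" using 1 by (intro prod_pos) auto
  ultimately have "1 - g \<xi> > 0" using fg[OF 1] by (simp add: zero_less_mult_iff)
  then show "q\<^sup>2 / N * (\<Sum>j=2..N. b j / (\<xi> - \<Delta> j)) < 1" by (simp add: g_def)
qed

section \<open>Products of column-stochastic matrices\<close>

text \<open>Written with \<open>1 v* A = 1\<close> in place of column sums, so that closure under
  products is associativity; \<open>col_stochD\<close> recovers the sums.\<close>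

definition col_stoch :: "real^'n^'n \<Rightarrow> bool" where
  "col_stoch A \<longleftrightarrow> (\<forall>i j. 0 \<le> A $ i $ j) \<and> 1 v* A = 1"

lemma col_stochD:
  assumes "col_stoch A"
  shows "0 \<le> A $ i $ j" "(\<Sum>i\<in>UNIV. A $ i $ j) = 1" "A $ i $ j \<le> 1"
proof -
  show a: "0 \<le> A $ i $ j" using assms by (simp add: col_stoch_def)
  show b: "(\<Sum>i\<in>UNIV. A $ i $ j) = 1"
    using assms by (simp add: col_stoch_def vec_eq_iff vector_matrix_mult_def)
  have "A $ i $ j \<le> (\<Sum>i\<in>UNIV. A $ i $ j)"
    using assms by (intro member_le_sum) (auto simp: col_stoch_def)
  then show "A $ i $ j \<le> 1" using b by simp
qed

lemma col_stoch_mat_1: "col_stoch (mat 1)"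
proof -
  have "0 \<le> (mat 1 :: real^'a^'a) $ i $ j" for i j by (simp add: mat_def)
  then show ?thesis by (simp add: col_stoch_def)
qed

lemma col_stoch_mult: "col_stoch A \<Longrightarrow> col_stoch B \<Longrightarrow> col_stoch (A ** B)"
  by (simp add: col_stoch_def matrix_matrix_mult_def sum_nonneg flip: vector_matrix_mul_assoc)
    (simp add: matrix_matrix_mult_def[symmetric] flip: vector_matrix_mul_assoc)

text \<open>New factors enter on the left, the order in which the update matrices act in
  time.\<close>

inductive_set monoid_gen :: "(real^'n^'n) set \<Rightarrow> (real^'n^'n) set" for G where
  one: "mat 1 \<in> monoid_gen G"
| step: "a \<in> G \<Longrightarrow> s \<in> monoid_gen G \<Longrightarrow> a ** s \<in> monoid_gen G"

lemma monoid_gen_base: "a \<in> G \<Longrightarrow> a \<in> monoid_gen G"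
  using monoid_gen.step[OF _ monoid_gen.one] by fastforce

lemma monoid_gen_mult: "s \<in> monoid_gen G \<Longrightarrow> t \<in> monoid_gen G \<Longrightarrow> s ** t \<in> monoid_gen G"
  by (induction rule: monoid_gen.induct) (auto simp: matrix_mul_assoc[symmetric] intro: monoid_gen.step)

lemma monoid_gen_col_stoch:
  assumes "\<And>a. a \<in> G \<Longrightarrow> col_stoch a" "s \<in> monoid_gen G"
  shows "col_stoch s"
  using assms(2) by induction (auto intro: col_stoch_mat_1 col_stoch_mult assms(1))

lemma monoid_gen_row:
  assumes "\<And>a. a \<in> G \<Longrightarrow> col_stoch a" "\<And>a i. a \<in> G \<Longrightarrow> row i a \<noteq> 0" "s \<in> monoid_gen G"
  shows "\<exists>j. s $ i $ j > 0"
  using assms(3)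
proof (induction arbitrary: i)
  case one
  then show ?case by (intro exI[of _ i]) (simp add: mat_def)
next
  case (step a s)
  note cs = col_stochD[OF assms(1)[OF step(1)]] col_stochD[OF monoid_gen_col_stoch[OF assms(1) step(2)]]
  obtain k where "a $ i $ k \<noteq> 0" using assms(2)[OF step(1), of i] by (auto simp: row_def vec_eq_iff)
  then have k: "a $ i $ k > 0" using cs(1)[of i k] by simp
  obtain j where j: "s $ k $ j > 0" using step.IH by blast
  have "a $ i $ k * s $ k $ j \<le> (a ** s) $ i $ j"
    unfolding matrix_matrix_mult_def using cs by (auto intro!: member_le_sum)
  then show ?case using k j by (intro exI[of _ j]) (smt (verit) mult_pos_pos)
qed

lemma entry_mult_ge:
  fixes s :: "real^'n^'m"
  assumes "\<And>i j. 0 \<le> s $ i $ j" "\<And>i. 0 \<le> x $ i"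
  shows "s $ l $ k * x $ k \<le> (s *v x) $ l"
  using member_le_sum[of k UNIV "\<lambda>k. s $ l $ k * x $ k"] assms by (simp add: matrix_vector_mult_def)

text \<open>A limit \<open>x\<close> of rows of products with maximal entry sum \<open>m\<close> satisfies \<open>x \<bullet> (s *v 1) = m\<close> for
  every product \<open>s\<close>: since the mean of the generators fixes \<open>1\<close>, no product can lower that value
  without another one raising it. A row of a product close to \<open>x\<close> is therefore uniformly good.\<close>

lemma uniform_row_bound:
  fixes G :: "(real^'n^'n) set"
  assumes cs: "\<And>a. a \<in> G \<Longrightarrow> col_stoch a"
    and mean: "\<And>x m a. \<lbrakk>\<And>a. a \<in> G \<Longrightarrow> x \<bullet> (a *v 1) \<le> m; x \<bullet> 1 = m; a \<in> G\<rbrakk> \<Longrightarrow> x \<bullet> (a *v 1) = m"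
  obtains s k where "s \<in> monoid_gen G" "\<And>W. W \<in> monoid_gen G \<Longrightarrow> (s *v (W *v 1)) $ k \<ge> 1 / 2"
proof -
  define R where "R = {row k s | k s. s \<in> monoid_gen G}"
  define X where "X = closure R"
  have css: "col_stoch s" if "s \<in> monoid_gen G" for s
    using monoid_gen_col_stoch[OF cs that] by simp
  have "norm x \<le> CARD('n)" if "x \<in> R" for x
  proof -
    obtain k s where s: "x = row k s" "s \<in> monoid_gen G" using \<open>x \<in> R\<close> by (auto simp: R_def)
    have "norm x \<le> (\<Sum>i\<in>UNIV. \<bar>x $ i\<bar>)" by (rule norm_le_l1_cart)
    also have "\<dots> \<le> (\<Sum>i\<in>(UNIV::'n set). 1)"
      using col_stochD[OF css[OF s(2)]] by (intro sum_mono) (auto simp: s(1) row_def abs_le_iff intro: order_trans[of _ 0])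
    finally show ?thesis by simp
  qed
  then have "bounded R" by (auto simp: bounded_iff)
  then have cX: "compact X" unfolding X_def by (simp add: compact_closure)
  have r1: "row k (mat 1) \<in> X" for k
    unfolding X_def R_def by (intro subsetD[OF closure_subset]) (auto intro: monoid_gen.one)
  then have "X \<noteq> {}" by auto
  moreover have "continuous_on X (\<lambda>x. x \<bullet> (1::real^'n))" by (intro continuous_intros)
  ultimately obtain x where x: "x \<in> X" and mx: "\<And>y. y \<in> X \<Longrightarrow> y \<bullet> 1 \<le> x \<bullet> 1"
    using continuous_attains_sup[OF cX] by blast
  define m where "m = x \<bullet> 1"
  have rowmat: "row k (mat 1 :: real^'n^'n) \<bullet> 1 = 1" for k :: 'n
    by (simp add: row_def inner_vec_def mat_def)
  have m1: "1 \<le> m" using mx[OF r1] rowmat by (simp add: m_def)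
  have Xa: "y v* a \<in> X" if "y \<in> X" "a \<in> G" for y a
  proof -
    have "(\<lambda>y. y v* a) ` R \<subseteq> R"
    proof clarify
      fix y assume "y \<in> R"
      then obtain k s where s: "y = row k s" "s \<in> monoid_gen G" by (auto simp: R_def)
      have "y v* a = row k (s ** a)" by (simp add: s(1) row_def vec_eq_iff vector_matrix_mult_def matrix_matrix_mult_def mult.commute)
      then show "y v* a \<in> R" using monoid_gen_mult[OF s(2) monoid_gen_base[OF that(2)]] by (auto simp: R_def)
    qed
    then have "(\<lambda>y. y v* a) ` closure R \<subseteq> closure R"
      using closure_subset[of R]
      by (intro image_closure_subset) (auto simp flip: transpose_matrix_vector intro!: matrix_vector_mult_linear_continuous_on)
    then show ?thesis using that(1) unfolding X_def by blast
  qed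
  have adj: "y \<bullet> (a *v z) = (y v* a) \<bullet> z" for y z and a :: "real^'n^'n"
    by (simp add: dot_lmul_matrix)
  \<comment> \<open>Every \<open>y v* a\<close> stays in \<open>X\<close>, so its entry sum is at
    most \<open>m\<close>; \<open>mean\<close> turns these inequalities into equalities.\<close>
  have step: "(y v* a) \<bullet> 1 = m" if "y \<in> X" "y \<bullet> 1 = m" "a \<in> G" for y a
    unfolding adj[symmetric]
  proof (rule mean)
    fix a assume "a \<in> G"
    then show "y \<bullet> (a *v 1) \<le> m" using mx[OF Xa[OF that(1)]] by (simp add: adj m_def)
  qed (use that in auto)
  have const: "y \<bullet> (s *v 1) = m" if "s \<in> monoid_gen G" "y \<in> X" "y \<bullet> 1 = m" for s y
    using that
  proof (induction arbitrary: y)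
    case (step a s)
    have "(y v* a) \<bullet> (s *v 1) = m"
      by (rule step.IH) (use Xa step.hyps step.prems \<open>\<And>y a. y \<in> X \<Longrightarrow> y \<bullet> 1 = m \<Longrightarrow> a \<in> G \<Longrightarrow> (y v* a) \<bullet> 1 = m\<close> in auto)
    then show ?case by (simp add: adj matrix_vector_mul_assoc[symmetric])
  qed simp
  define N where "N = real CARD('n)"
  have N: "N > 0" by (simp add: N_def)
  \<comment> \<open>A product applied to 1 has non-negative entries with sum \<open>N\<close>, hence
    norm at most \<open>N\<close>. Replacing \<open>x\<close> by a row this close therefore changes
    the value \<open>m\<close> by at most 1/2, and \<open>m\<close> is at least 1 because of the
    empty product.\<close>
  obtain y where "y \<in> R" and y: "dist y x < 1 / (2 * N)"
    using x N unfolding X_def closure_approachable by (meson divide_pos_pos mult_pos_pos zero_less_numeral zero_less_one)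
  then obtain k s where s: "y = row k s" "s \<in> monoid_gen G" by (auto simp: R_def)
  show thesis
  proof (rule that[OF s(2)])
    fix W assume W: "W \<in> monoid_gen G"
    define w where "w = W *v 1"
    note cW = col_stochD[OF css[OF W]]
    have w0: "0 \<le> w $ i" for i by (simp add: w_def matrix_vector_mult_def cW sum_nonneg)
    have "norm w \<le> (\<Sum>i\<in>UNIV. \<bar>w $ i\<bar>)" by (rule norm_le_l1_cart)
    also have "\<dots> = (\<Sum>i\<in>UNIV. \<Sum>j\<in>UNIV. W $ i $ j)" using w0 by (simp add: w_def matrix_vector_mult_def)
    also have "\<dots> = N" by (subst sum.swap) (simp add: cW N_def)
    finally have nw: "norm w \<le> N" .
    have "\<bar>(y - x) \<bullet> w\<bar> \<le> norm (y - x) * norm w" by (rule Cauchy_Schwarz_ineq2)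
    also have "\<dots> \<le> 1 / (2 * N) * N" using y nw N by (intro mult_mono) (auto simp: dist_norm)
    finally have "\<bar>y \<bullet> w - x \<bullet> w\<bar> \<le> 1 / 2" using N by (simp add: inner_diff_left)
    moreover have "x \<bullet> w = m" using const[OF W x] by (simp add: w_def m_def)
    moreover have "(s *v w) $ k = y \<bullet> w" by (simp add: s(1) row_def matrix_vector_mult_def inner_vec_def)
    ultimately show "(s *v (W *v 1)) $ k \<ge> 1 / 2" using m1 unfolding w_def[symmetric] by linarith
  qed
qed

text \<open>A \<open>V\<close> in the monoid with \<open>V $ l $ k > 0\<close> turns the good row
  \<open>k\<close> into a good row \<open>l\<close>. For one product with all rows good, rows are
  added one at a time: if \<open>U $ l $ j > 0\<close>, multiplying \<open>U\<close> on the right by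
  a product with good row \<open>j\<close> makes row \<open>l\<close> good, and rows already good
  stay so because their bound holds for every further product \<open>W\<close>.\<close>

lemma uniform_product_bound:
  fixes G :: "(real^'n^'n) set"
  assumes cs: "\<And>a. a \<in> G \<Longrightarrow> col_stoch a" and row: "\<And>a i. a \<in> G \<Longrightarrow> row i a \<noteq> 0"
    and mean: "\<And>x m a. \<lbrakk>\<And>a. a \<in> G \<Longrightarrow> x \<bullet> (a *v 1) \<le> m; x \<bullet> 1 = m; a \<in> G\<rbrakk> \<Longrightarrow> x \<bullet> (a *v 1) = m"
    and irr: "\<And>i j. \<exists>V\<in>monoid_gen G. V $ i $ j > 0"
  obtains U c where "U \<in> monoid_gen G" "c > 0" "\<And>i W. W \<in> monoid_gen G \<Longrightarrow> (U *v (W *v 1)) $ i \<ge> c"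
proof -
  have css: "col_stoch s" if "s \<in> monoid_gen G" for s
    using monoid_gen_col_stoch[OF cs that] by simp
  obtain s k where s: "s \<in> monoid_gen G" "\<And>W. W \<in> monoid_gen G \<Longrightarrow> (s *v (W *v 1)) $ k \<ge> 1 / 2"
    using uniform_row_bound[OF cs mean] by blast
  have nn: "0 \<le> (s *v (W *v 1)) $ i" if "s \<in> monoid_gen G" "W \<in> monoid_gen G" for s W i
    by (simp add: matrix_vector_mult_def sum_nonneg col_stochD[OF css[OF that(1)]] col_stochD[OF css[OF that(2)]])
  have each: "\<exists>t\<in>monoid_gen G. \<exists>c>0. \<forall>W\<in>monoid_gen G. (t *v (W *v 1)) $ l \<ge> c" for l
  proof -
    obtain V where V: "V \<in> monoid_gen G" "V $ l $ k > 0" using irr by blast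
    have "V $ l $ k / 2 \<le> ((V ** s) *v (W *v 1)) $ l" if W: "W \<in> monoid_gen G" for W
    proof -
      have "V $ l $ k * (1/2) \<le> V $ l $ k * (s *v (W *v 1)) $ k"
        using s(2)[OF W] V(2) by (intro mult_left_mono) auto
      also have "\<dots> \<le> (V *v (s *v (W *v 1))) $ l"
        by (rule entry_mult_ge) (use col_stochD[OF css[OF V(1)]] nn[OF s(1) W] in auto)
      finally show ?thesis by (simp add: matrix_vector_mul_assoc matrix_mul_assoc)
    qed
    then show ?thesis using V s(1) by (intro bexI[of _ "V ** s"] exI[of _ "V $ l $ k / 2"]) (auto intro: monoid_gen_mult)
  qed
  have "\<exists>U\<in>monoid_gen G. \<exists>c>0. \<forall>l\<in>F. \<forall>W\<in>monoid_gen G. (U *v (W *v 1)) $ l \<ge> c" if "finite F" for F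
    using that
  proof induction
    case empty
    then show ?case by (auto intro: monoid_gen.one exI[of _ "1::real"])
  next
    case (insert l F)
    then obtain U c where U: "U \<in> monoid_gen G" "c > 0" "\<And>l W. l \<in> F \<Longrightarrow> W \<in> monoid_gen G \<Longrightarrow> (U *v (W *v 1)) $ l \<ge> c"
      by blast
    obtain j where j: "U $ l $ j > 0" using monoid_gen_row[OF cs row U(1)] by blast
    obtain t d where t: "t \<in> monoid_gen G" "d > 0" "\<And>W. W \<in> monoid_gen G \<Longrightarrow> (t *v (W *v 1)) $ j \<ge> d"
      using each by blast
    have "min c (U $ l $ j * d) \<le> ((U ** t) *v (W *v 1)) $ i" if "i \<in> insert l F" "W \<in> monoid_gen G" for i W
    proof (cases "i \<in> F")
      case True
      have "c \<le> (U *v ((t ** W) *v 1)) $ i" by (rule U(3)[OF True]) (use t that monoid_gen_mult in auto)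
      then show ?thesis by (simp add: matrix_vector_mul_assoc matrix_mul_assoc)
    next
      case False
      then have i: "i = l" using that by simp
      have "U $ l $ j * d \<le> U $ l $ j * (t *v (W *v 1)) $ j"
        using t(3)[OF that(2)] j by (intro mult_left_mono) auto
      also have "\<dots> \<le> (U *v (t *v (W *v 1))) $ l"
        by (rule entry_mult_ge) (use col_stochD[OF css[OF U(1)]] nn[OF t(1) that(2)] in auto)
      finally show ?thesis by (simp add: matrix_vector_mul_assoc matrix_mul_assoc i)
    qed
    then show ?case using U t j
      by (intro bexI[of _ "U ** t"] exI[of _ "min c (U $ l $ j * d)"]) (auto intro: monoid_gen_mult)
  qed
  from this[OF finite] obtain U c where "U \<in> monoid_gen G" "c > 0"
    "\<forall>l\<in>UNIV. \<forall>W\<in>monoid_gen G. (U *v (W *v 1)) $ l \<ge> c" by blast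
  then show thesis using that by blast
qed

section \<open>Time-ordered products and neighbourhoods of a fixed product\<close>

primrec mat_prod :: "(nat \<Rightarrow> real^'n^'n) \<Rightarrow> nat \<Rightarrow> real^'n^'n" where
  "mat_prod a 0 = mat 1"
| "mat_prod a (Suc n) = a (Suc n) ** mat_prod a n"

lemma trajectory_mat_prod: "trajectory a x n = mat_prod a n *v x"
  by (induction n) (auto simp: matrix_vector_mul_assoc)

lemma trajectory_add: "trajectory a x (s + t) = trajectory (\<lambda>n. a (s + n)) (trajectory a x s) t"
  by (induction t) auto

text \<open>The random matrices come close to points of the support without having to hit them.
  Continuity of multiplication reduces closeness to \<open>U\<close> to an open condition on each
  single factor.\<close>

lemma monoid_gen_neighborhood:
  fixes U :: "real^'n^'n"
  assumes "U \<in> monoid_gen G" "e > 0"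
  shows "\<exists>n B. (\<forall>i. open (B i) \<and> (i \<in> {1..n} \<longrightarrow> B i \<inter> G \<noteq> {})) \<and>
    (\<forall>a. (\<forall>i\<in>{1..n}. a i \<in> B i) \<longrightarrow> dist (mat_prod a n) U < e)"
  using assms
proof (induction arbitrary: e)
  case one
  then show ?case by (intro exI[of _ 0] exI[of _ "\<lambda>_. UNIV"]) auto
next
  case (step a s)
  have "continuous (at (a, s)) (\<lambda>p. fst p ** snd p)"
    unfolding isCont_def matrix_matrix_mult_def by (intro tendsto_vec_lambda tendsto_intros)
  then obtain d where d: "d > 0" "\<And>p. dist p (a, s) < d \<Longrightarrow> dist (fst p ** snd p) (a ** s) < e"
    using \<open>e > 0\<close> unfolding continuous_at_eps_delta by (metis fst_conv snd_conv)
  obtain n B where B: "\<And>i. open (B i)" "\<And>i. i \<in> {1..n} \<Longrightarrow> B i \<inter> G \<noteq> {}"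
    "\<And>a. (\<forall>i\<in>{1..n}. a i \<in> B i) \<Longrightarrow> dist (mat_prod a n) s < d / 2"
    using step.IH[of "d / 2"] d(1) by auto
  define B' where "B' = B(Suc n := ball a (d / 2))"
  have "dist (mat_prod b (Suc n)) (a ** s) < e" if b: "\<forall>i\<in>{1..Suc n}. b i \<in> B' i" for b
  proof -
    have "b i \<in> B i" if "i \<in> {1..n}" for i using b[rule_format, of i] that by (auto simp: B'_def)
    then have "\<forall>i\<in>{1..n}. b i \<in> B i" by blast
    then have 1: "dist (mat_prod b n) s < d / 2" by (rule B(3))
    have 2: "dist (b (Suc n)) a < d / 2" using b[rule_format, of "Suc n"] by (auto simp: B'_def dist_commute)
    have "dist (b (Suc n), mat_prod b n) (a, s) \<le> dist (b (Suc n)) a + dist (mat_prod b n) s"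
      unfolding dist_prod_def by (simp add: sqrt_sum_squares_le_sum)
    then show ?thesis using 1 2 d(2)[of "(b (Suc n), mat_prod b n)"] by simp
  qed
  moreover have "open (B' i) \<and> (i \<in> {1..Suc n} \<longrightarrow> B' i \<inter> G \<noteq> {})" for i
  proof (cases "i = Suc n")
    case True
    have "a \<in> ball a (d / 2) \<inter> G" using d(1) step(1) by simp
    then have "B' i \<inter> G \<noteq> {}" unfolding B'_def True by (metis empty_iff fun_upd_same)
    then show ?thesis using True by (simp add: B'_def)
  qed (use B(1,2)[of i] in \<open>auto simp: B'_def\<close>)
  ultimately show ?case by blast
qed

lemma uniform_trajectory_bound:
  fixes G :: "(real^'n^'n) set"
  assumes U: "U \<in> monoid_gen G" "c > 0" "\<And>i W. W \<in> monoid_gen G \<Longrightarrow> (U *v (W *v 1)) $ i \<ge> c"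
    and cs: "\<And>a. a \<in> G \<Longrightarrow> col_stoch a" and "G \<noteq> {}"
  obtains n B where "n > 0" "\<And>i. open (B i)" "\<And>i. i \<in> {1..n} \<Longrightarrow> B i \<inter> G \<noteq> {}"
    "\<And>a s i. (\<And>k. k > 0 \<Longrightarrow> a k \<in> G) \<Longrightarrow> (\<And>k. k \<in> {1..n} \<Longrightarrow> a (s + k) \<in> B k) \<Longrightarrow>
       trajectory a 1 (s + n) $ i \<ge> c / 2"
proof -
  have css: "col_stoch s" if "s \<in> monoid_gen G" for s
    using monoid_gen_col_stoch[OF cs that] by simp
  define N where "N = real CARD('n)"
  have N: "N > 0" by (simp add: N_def)
  \<comment> \<open>The entries of the weight vector sum to \<open>N\<close>, so an error
    \<open>c / (2 * N)\<close> in the entries of \<open>U\<close> costs at most half of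
    \<open>c\<close>.\<close>
  obtain n B where B: "\<And>i. open (B i)" "\<And>i. i \<in> {1..n} \<Longrightarrow> B i \<inter> G \<noteq> {}"
    "\<And>a. (\<forall>i\<in>{1..n}. a i \<in> B i) \<Longrightarrow> dist (mat_prod a n) U < c / (2 * N)"
    using monoid_gen_neighborhood[OF U(1), of "c / (2 * N)"] U(2) N by auto
  \<comment> \<open>\<open>U\<close> may be the empty product, which would give blocks of length 0.
    The block is lengthened by one unconstrained factor at its start; that factor is counted to the
    past \<open>W\<close>, in which the bound is uniform.\<close>
  define B' where "B' k = (if k \<le> 1 then UNIV else B (k - 1))" for k
  show thesis
  proof (rule that[of "Suc n" B'])
    show "open (B' i)" for i using B(1) by (simp add: B'_def)
    show "B' i \<inter> G \<noteq> {}" if "i \<in> {1..Suc n}" for i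
    proof (cases "i \<le> 1")
      case False
      then have "i - 1 \<in> {1..n}" using that by auto
      then show ?thesis using B(2)[of "i - 1"] False by (simp add: B'_def)
    qed (use \<open>G \<noteq> {}\<close> in \<open>simp add: B'_def\<close>)
    fix a s i
    assume aG: "\<And>k. k > 0 \<Longrightarrow> a k \<in> G" and aB: "\<And>k. k \<in> {1..Suc n} \<Longrightarrow> a (s + k) \<in> B' k"
    define W where "W = mat_prod a (Suc s)"
    have "mat_prod a k \<in> monoid_gen G" for k
      by (induction k) (auto intro: monoid_gen.intros aG)
    then have W: "W \<in> monoid_gen G" unfolding W_def by blast
    note cW = col_stochD[OF css[OF W]]
    define w where "w = W *v 1"
    have w0: "0 \<le> w $ i" for i by (simp add: w_def matrix_vector_mult_def cW sum_nonneg)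
    have "(\<Sum>i\<in>UNIV. w $ i) = (\<Sum>i\<in>UNIV. \<Sum>j\<in>UNIV. W $ i $ j)" by (simp add: w_def matrix_vector_mult_def)
    also have "\<dots> = N" by (subst sum.swap) (simp add: cW N_def)
    finally have nw: "(\<Sum>i\<in>UNIV. w $ i) = N" .
    define V where "V = mat_prod (\<lambda>k. a (Suc s + k)) n"
    have "a (Suc s + k) \<in> B k" if "k \<in> {1..n}" for k
      using aB[of "Suc k"] that by (auto simp: B'_def)
    then have dV: "dist V U < c / (2 * N)" unfolding V_def by (intro B(3)) auto
    have "\<bar>(U *v w) $ i - (V *v w) $ i\<bar> = \<bar>\<Sum>j\<in>UNIV. (U $ i $ j - V $ i $ j) * w $ j\<bar>"
      by (simp add: matrix_vector_mult_def sum_subtractf left_diff_distrib)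
    also have "\<dots> \<le> (\<Sum>j\<in>UNIV. \<bar>(U $ i $ j - V $ i $ j) * w $ j\<bar>)" by (rule sum_abs)
    also have "\<dots> \<le> (\<Sum>j\<in>UNIV. c / (2 * N) * w $ j)"
    proof (rule sum_mono)
      fix j
      have "\<bar>U $ i $ j - V $ i $ j\<bar> \<le> dist V U"
        using component_le_norm_cart[of "U $ i - V $ i" j] Finite_Cartesian_Product.norm_nth_le[of "U - V" i]
        by (simp add: dist_norm norm_minus_commute)
      then show "\<bar>(U $ i $ j - V $ i $ j) * w $ j\<bar> \<le> c / (2 * N) * w $ j"
        unfolding abs_mult abs_of_nonneg[OF w0] using dV w0[of j] by (intro mult_right_mono) auto
    qed
    also have "\<dots> = c / 2" using N unfolding sum_distrib_left[symmetric] nw by simp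
    finally have "(V *v w) $ i \<ge> c / 2" using U(3)[OF W, of i] unfolding w_def by linarith
    moreover have "trajectory a 1 (s + Suc n) = V *v w"
      using trajectory_add[of a 1 "Suc s" n] by (simp add: trajectory_mat_prod V_def w_def W_def)
    ultimately show "trajectory a 1 (s + Suc n) $ i \<ge> c / 2" by simp
  qed simp
qed

section \<open>Second moments of one step\<close>

text \<open>Excess of the second moment of the \<open>i\<close>-th coefficient of \<open>v \<bullet> (A y)\<close> over the product pattern
  \<open>delta (v $ i)\<^sup>2\<close>, which is exact off the diagonal.\<close>

definition kappa ::
  "real^'n^'n \<Rightarrow> real \<Rightarrow> real \<Rightarrow> real \<Rightarrow> real \<Rightarrow> real \<Rightarrow> real \<Rightarrow> real^'n \<Rightarrow> 'n \<Rightarrow> real" where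
  "kappa P q r \<alpha> \<beta> c l v i = q\<^sup>2 * ((\<beta> - \<alpha>) * (1 - l)\<^sup>2 * (v $ i)\<^sup>2 +
     (r\<^sup>2 - \<beta> * c) * (\<Sum>j\<in>UNIV. P $ j $ i * (v $ j - v $ i)\<^sup>2))"

text \<open>Together with \<open>bcoef\<close>: the quantities \<open>Delta\<close> and
  \<open>b_coeff\<close> as functions of the eigenvalue, for a basis indexed by
  \<open>'n\<close>.\<close>

definition delta :: "real \<Rightarrow> real \<Rightarrow> real \<Rightarrow> real \<Rightarrow> real" where
  "delta q u \<alpha> l = 1 - 2 * q * sqrt u * (1 - l) + \<alpha> * q\<^sup>2 * (1 - l)\<^sup>2"

definition bcoef :: "real \<Rightarrow> real \<Rightarrow> real \<Rightarrow> real \<Rightarrow> real \<Rightarrow> real" where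
  "bcoef r \<alpha> \<beta> c l = (1 - l) * ((\<beta> - \<alpha>) * (1 - l) - \<beta> * c + 2 * r\<^sup>2)"

text \<open>Entry \<open>i\<close> of (A^T - I) v for the update matrix A of \<open>X\<close>. It
  involves column \<open>i\<close> of \<open>X\<close> only, and the moment conditions distinguish
  equal from different columns.\<close>

definition incr :: "real^'n^'n \<Rightarrow> real^'n \<Rightarrow> 'n \<Rightarrow> real" where
  "incr X v i = (\<Sum>j\<in>UNIV. X $ j $ i * (v $ j - v $ i))"

lemma borel_measurable_nth [measurable]: "(\<lambda>x. x $ i) \<in> borel \<rightarrow>\<^sub>M borel"
  by (intro borel_measurable_continuous_onI continuous_intros)

lemma update_matrix_vec:
  fixes X :: "real^'n^'n"
  shows "(update_matrix X *v y) $ k = y $ k + (\<Sum>i\<in>UNIV. X $ k $ i * y $ i) - (\<Sum>i\<in>UNIV. X $ i $ k) * y $ k"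
proof -
  have "(col_sum_diag X *v y) $ k = (\<Sum>i\<in>UNIV. X $ i $ k) * y $ k"
    by (simp add: col_sum_diag_def matrix_vector_mult_def if_distribR if_distrib cong: if_cong)
  moreover have "(X *v y) $ k = (\<Sum>i\<in>UNIV. X $ k $ i * y $ i)" by (simp add: matrix_vector_mult_def)
  ultimately show ?thesis
    by (simp add: update_matrix_def matrix_vector_mult_diff_rdistrib matrix_vector_mult_add_rdistrib)
qed

lemma inner_update_matrix:
  fixes X :: "real^'n^'n"
  shows "v \<bullet> (update_matrix X *v y) = (\<Sum>i\<in>UNIV. y $ i * (v $ i + incr X v i))"
proof -
  have "v \<bullet> (update_matrix X *v y) = (\<Sum>k\<in>UNIV. v $ k * y $ k) +
      (\<Sum>k\<in>UNIV. \<Sum>i\<in>UNIV. v $ k * X $ k $ i * y $ i) - (\<Sum>k\<in>UNIV. \<Sum>i\<in>UNIV. v $ k * X $ i $ k * y $ k)"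
    by (simp add: inner_vec_def update_matrix_vec algebra_simps sum.distrib sum_subtractf sum_distrib_left)
  also have "(\<Sum>k\<in>UNIV. \<Sum>i\<in>UNIV. v $ k * X $ k $ i * y $ i) = (\<Sum>i\<in>UNIV. \<Sum>k\<in>UNIV. v $ k * X $ k $ i * y $ i)"
    by (rule sum.swap)
  finally show ?thesis
    by (simp add: incr_def algebra_simps sum.distrib sum_subtractf sum_distrib_left)
qed

context prob_space
begin

lemma admissible_integrable:
  fixes X :: "'a \<Rightarrow> real^'n^'n"
  assumes X[measurable]: "X \<in> borel_measurable M" and adm: "AE \<omega> in M. admissible (X \<omega>)"
  shows "integrable M X" "integrable M (\<lambda>\<omega>. X \<omega> $ i $ j)" "integrable M (\<lambda>\<omega>. X \<omega> $ i $ j * X \<omega> $ k $ l)"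
proof -
  have b: "0 \<le> Y $ i $ j \<and> Y $ i $ j \<le> 1" if "admissible Y" for Y :: "real^'n^'n" and i j
  proof -
    have "Y $ i $ j \<le> (\<Sum>i\<in>UNIV. Y $ i $ j)" using that by (intro member_le_sum) (auto simp: admissible_def)
    then show ?thesis using that unfolding admissible_def by (meson order_trans)
  qed
  have nb: "norm Y \<le> real CARD('n) * real CARD('n)" if "admissible Y" for Y :: "real^'n^'n"
  proof -
    have "norm Y \<le> (\<Sum>i\<in>UNIV. norm (Y $ i))" unfolding norm_vec_def by (rule L2_set_le_sum) simp
    also have "\<dots> \<le> (\<Sum>i\<in>(UNIV::'n set). real CARD('n))"
    proof (rule sum_mono)
      fix i
      have "norm (Y $ i) \<le> (\<Sum>j\<in>UNIV. \<bar>Y $ i $ j\<bar>)" by (rule norm_le_l1_cart)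
      also have "\<dots> \<le> (\<Sum>j\<in>(UNIV::'n set). 1)" using b[OF that] by (intro sum_mono) auto
      finally show "norm (Y $ i) \<le> real CARD('n)" by simp
    qed
    finally show ?thesis by simp
  qed
  show "integrable M X"
    using adm by (intro integrable_const_bound[where B="real CARD('n) * real CARD('n)"]) (auto elim!: eventually_mono dest: nb)
  have m: "(\<lambda>\<omega>. X \<omega> $ i $ j) \<in> borel_measurable M" for i j by measurable
  show "integrable M (\<lambda>\<omega>. X \<omega> $ i $ j)"
    using adm m by (intro integrable_const_bound[where B=1]) (auto elim!: eventually_mono simp: b)
  show "integrable M (\<lambda>\<omega>. X \<omega> $ i $ j * X \<omega> $ k $ l)"
    using adm m by (intro integrable_const_bound[where B=1])
      (auto elim!: eventually_mono simp: b abs_mult intro!: mult_le_one)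
qed

lemma expected_entry:
  fixes X :: "'a \<Rightarrow> real^'n^'n"
  assumes X: "X \<in> borel_measurable M" and adm: "AE \<omega> in M. admissible (X \<omega>)"
    and mom: "moment_conditions M X P q u r \<alpha> \<beta>"
  shows "(\<integral>\<omega>. X \<omega> $ i $ j \<partial>M) = q * sqrt u * P $ i $ j"
proof -
  have "(\<integral>\<omega>. X \<omega> $ i $ j \<partial>M) = (\<integral>\<omega>. X \<omega> \<partial>M) $ i $ j"
    using admissible_integrable(1)[OF X adm]
    by (simp add: integral_bounded_linear[OF bounded_linear_vec_nth] integrable_bounded_linear[OF bounded_linear_vec_nth])
  then show ?thesis using mom by (simp add: moment_conditions_def)
qed

text \<open>Entries from different columns have the moment \<open>\<alpha> * q\<^sup>2\<close> times
  a product of entries of \<open>P\<close>, so the double sum factors, each factor being -(1 - l)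
  times an entry of \<open>v\<close>. Within one column \<open>\<beta>\<close> replaces
  \<open>\<alpha>\<close>, apart from squares of single entries; there \<open>pc\<close>, which
  covers both alternatives of the theorem, makes the excess linear in \<open>P\<close>.\<close>

lemma incr_moments:
  fixes X :: "'a \<Rightarrow> real^'n^'n" and P :: "real^'n^'n"
  assumes X[measurable]: "X \<in> borel_measurable M" and adm: "AE \<omega> in M. admissible (X \<omega>)"
    and mom: "moment_conditions M X P q u r \<alpha> \<beta>"
    and P: "column_stochastic P" and sym: "transpose P = P"
    and pc: "\<And>i j. \<beta> * (P $ i $ j)\<^sup>2 = \<beta> * c * P $ i $ j"
    and ev: "P *v v = l *\<^sub>R v"
  shows "integrable M (\<lambda>\<omega>. (v $ i + incr (X \<omega>) v i) * (v $ k + incr (X \<omega>) v k))"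
    and "(\<integral>\<omega>. (v $ i + incr (X \<omega>) v i) * (v $ k + incr (X \<omega>) v k) \<partial>M) =
      delta q u \<alpha> l * v $ i * v $ k + (if i = k then kappa P q r \<alpha> \<beta> c l v i else 0)"
proof -
  note int = admissible_integrable[OF X adm]
  note EX = expected_entry[OF X adm mom]
  have EXX: "(\<integral>\<omega>. X \<omega> $ j $ i * X \<omega> $ l $ k \<partial>M) =
        (if i \<noteq> k then \<alpha> * q\<^sup>2 * P $ j $ i * P $ l $ k
         else if j \<noteq> l then \<beta> * q\<^sup>2 * P $ j $ i * P $ l $ i
         else (q * r)\<^sup>2 * P $ j $ i)" for i j k l
    using mom by (simp add: moment_conditions_def)
  have P1: "(\<Sum>j\<in>UNIV. P $ j $ i) = 1" for i using P by (simp add: column_stochastic_def)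
  have Pv: "(\<Sum>j\<in>UNIV. P $ j $ i * v $ j) = l * v $ i" for i
  proof -
    have "P $ j $ i = P $ i $ j" for j using sym by (metis transpose_def vec_lambda_beta)
    then show ?thesis using arg_cong[OF ev, of "\<lambda>x. x $ i"] by (simp add: matrix_vector_mult_def)
  qed
  have Pd: "(\<Sum>j\<in>UNIV. P $ j $ i * (v $ j - v $ i)) = - (1 - l) * v $ i" for i
    by (simp add: right_diff_distrib sum_subtractf Pv P1 flip: sum_distrib_right) (simp add: algebra_simps)
  have iS: "integrable M (\<lambda>\<omega>. incr (X \<omega>) v i)" for i
    unfolding incr_def using int(2) by (intro Bochner_Integration.integrable_sum integrable_mult_left) 
  have SS: "incr Y v i * incr Y v k = (\<Sum>j\<in>UNIV. \<Sum>m\<in>UNIV. (Y $ j $ i * Y $ m $ k) * ((v $ j - v $ i) * (v $ m - v $ k)))" for Y i k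
    by (simp add: incr_def sum_product mult_ac)
  have iSS: "integrable M (\<lambda>\<omega>. incr (X \<omega>) v i * incr (X \<omega>) v k)" for i k
    unfolding SS using int(3) by (intro Bochner_Integration.integrable_sum integrable_mult_left)
  have ES: "(\<integral>\<omega>. incr (X \<omega>) v i \<partial>M) = - q * sqrt u * (1 - l) * v $ i" for i
  proof -
    have "(\<integral>\<omega>. incr (X \<omega>) v i \<partial>M) = (\<Sum>j\<in>UNIV. q * sqrt u * P $ j $ i * (v $ j - v $ i))"
      unfolding incr_def using int(2) by (simp add: EX)
    also have "\<dots> = q * sqrt u * (\<Sum>j\<in>UNIV. P $ j $ i * (v $ j - v $ i))" by (simp add: sum_distrib_left mult_ac)
    finally show ?thesis unfolding Pd by (simp add: algebra_simps)
  qed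
  have ESS: "(\<integral>\<omega>. incr (X \<omega>) v i * incr (X \<omega>) v k \<partial>M) =
      \<alpha> * q\<^sup>2 * (1 - l)\<^sup>2 * v $ i * v $ k + (if i = k then kappa P q r \<alpha> \<beta> c l v i else 0)"
  proof -
    have dd: "(\<Sum>j\<in>UNIV. \<Sum>m\<in>UNIV. (P $ j $ i * P $ m $ k) * ((v $ j - v $ i) * (v $ m - v $ k))) = (1 - l)\<^sup>2 * v $ i * v $ k" for i k
    proof -
      have "(\<Sum>j\<in>UNIV. \<Sum>m\<in>UNIV. (P $ j $ i * P $ m $ k) * ((v $ j - v $ i) * (v $ m - v $ k))) =
         (\<Sum>j\<in>UNIV. P $ j $ i * (v $ j - v $ i)) * (\<Sum>m\<in>UNIV. P $ m $ k * (v $ m - v $ k))"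
        by (simp add: sum_product mult_ac)
      then show ?thesis unfolding Pd by (simp add: power2_eq_square algebra_simps)
    qed
    have E: "(\<integral>\<omega>. incr (X \<omega>) v i * incr (X \<omega>) v k \<partial>M) =
      (\<Sum>j\<in>UNIV. \<Sum>m\<in>UNIV. (\<integral>\<omega>. X \<omega> $ j $ i * X \<omega> $ m $ k \<partial>M) * ((v $ j - v $ i) * (v $ m - v $ k)))"
      unfolding SS using int(3) by (simp add: Bochner_Integration.integrable_sum)
    show ?thesis
    proof (cases "i = k")
      case False
      have "(\<integral>\<omega>. incr (X \<omega>) v i * incr (X \<omega>) v k \<partial>M) =
        \<alpha> * q\<^sup>2 * (\<Sum>j\<in>UNIV. \<Sum>m\<in>UNIV. (P $ j $ i * P $ m $ k) * ((v $ j - v $ i) * (v $ m - v $ k)))"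
        unfolding E EXX using False by (simp add: sum_distrib_left mult_ac)
      then show ?thesis using False by (simp add: dd)
    next
      case True
      define d where "d j = v $ j - v $ i" for j
      \<comment> \<open>The \<open>\<beta>\<close> pattern is extended to the diagonal
        \<open>m = j\<close>; the remainder there is (q r)^2 p - \<beta> q^2 p^2 = q^2 (r^2 -
        \<beta> c) p by \<open>pc\<close>.\<close>
      have "(\<integral>\<omega>. X \<omega> $ j $ i * X \<omega> $ m $ i \<partial>M) * (d j * d m) =
         \<beta> * q\<^sup>2 * ((P $ j $ i * P $ m $ i) * (d j * d m)) +
         (if m = j then (q\<^sup>2 * (r\<^sup>2 - \<beta> * c)) * (P $ j $ i * (d j)\<^sup>2) else 0)" for j m
      proof (cases "m = j")
        case True
        then show ?thesis using pc[of j i] unfolding EXX by (auto simp: power2_eq_square algebra_simps)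
      qed (simp add: EXX)
      then have "(\<integral>\<omega>. incr (X \<omega>) v i * incr (X \<omega>) v i \<partial>M) =
        \<beta> * q\<^sup>2 * (\<Sum>j\<in>UNIV. \<Sum>m\<in>UNIV. (P $ j $ i * P $ m $ i) * (d j * d m)) +
          q\<^sup>2 * (r\<^sup>2 - \<beta> * c) * (\<Sum>j\<in>UNIV. P $ j $ i * (d j)\<^sup>2)"
        unfolding E[folded True] d_def[symmetric] by (simp add: sum.distrib sum_distrib_left)
      then show ?thesis unfolding True[symmetric] d_def dd
        by (simp add: kappa_def power2_eq_square algebra_simps)
    qed
  qed
  have prod: "(v $ i + incr Y v i) * (v $ k + incr Y v k) =
    v $ i * v $ k + v $ i * incr Y v k + v $ k * incr Y v i + incr Y v i * incr Y v k" for Y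
    by (simp add: algebra_simps)
  show "integrable M (\<lambda>\<omega>. (v $ i + incr (X \<omega>) v i) * (v $ k + incr (X \<omega>) v k))"
    unfolding prod using iS iSS by simp
  show "(\<integral>\<omega>. (v $ i + incr (X \<omega>) v i) * (v $ k + incr (X \<omega>) v k) \<partial>M) =
      delta q u \<alpha> l * v $ i * v $ k + (if i = k then kappa P q r \<alpha> \<beta> c l v i else 0)"
    unfolding prod using iS iSS
    by (simp add: ES ESS prob_space delta_def power2_eq_square algebra_simps)
qed

text \<open>Independence factors the expectation of each term of the expanded square. The
  \<open>delta\<close> pattern reassembles to the second moment of \<open>v \<bullet> y\<close>, so
  \<open>kappa\<close> meets only the diagonal moments of \<open>y\<close>. Independence is assumed
  for real functions of both variables because \<open>indep_var\<close> relates variables with a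
  common value type.\<close>

lemma second_moment_step:
  fixes X :: "'a \<Rightarrow> real^'n^'n" and P :: "real^'n^'n" and y :: "'a \<Rightarrow> real^'n"
  assumes X[measurable]: "X \<in> borel_measurable M" and adm: "AE \<omega> in M. admissible (X \<omega>)"
    and mom: "moment_conditions M X P q u r \<alpha> \<beta>"
    and P: "column_stochastic P" and sym: "transpose P = P"
    and pc: "\<And>i j. \<beta> * (P $ i $ j)\<^sup>2 = \<beta> * c * P $ i $ j"
    and ev: "P *v v = l *\<^sub>R v"
    and y[measurable]: "y \<in> borel_measurable M" and bd: "AE \<omega> in M. norm (y \<omega>) \<le> K"
    and ind: "\<And>f g :: _ \<Rightarrow> real. \<lbrakk>f \<in> borel_measurable borel; g \<in> borel_measurable borel\<rbrakk> \<Longrightarrow>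
      indep_var borel (\<lambda>\<omega>. f (y \<omega>)) borel (\<lambda>\<omega>. g (X \<omega>))"
  shows "integrable M (\<lambda>\<omega>. (v \<bullet> (update_matrix (X \<omega>) *v y \<omega>))\<^sup>2)" (is ?int)
    and "(\<integral>\<omega>. (v \<bullet> (update_matrix (X \<omega>) *v y \<omega>))\<^sup>2 \<partial>M) =
      delta q u \<alpha> l * (\<integral>\<omega>. (v \<bullet> y \<omega>)\<^sup>2 \<partial>M) +
      (\<Sum>i\<in>UNIV. kappa P q r \<alpha> \<beta> c l v i * (\<integral>\<omega>. (y \<omega> $ i)\<^sup>2 \<partial>M))" (is ?eq)
proof -
  define a where "a Y i = v $ i + incr Y v i" for Y :: "real^'n^'n" and i
  note am = incr_moments[OF X adm mom P sym pc ev, folded a_def]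
  have iy: "integrable M (\<lambda>\<omega>. y \<omega> $ i * y \<omega> $ k)" for i k
  proof (rule integrable_const_bound[where B="K * K"])
    show "AE \<omega> in M. norm (y \<omega> $ i * y \<omega> $ k) \<le> K * K"
      using bd
    proof eventually_elim
      case (elim \<omega>)
      have "\<bar>y \<omega> $ j\<bar> \<le> K" for j using component_le_norm_cart[of "y \<omega>" j] elim by linarith
      then show ?case by (simp add: abs_mult mult_mono')
    qed
  qed measurable
  have [measurable]: "(\<lambda>Y. a Y i * a Y k) \<in> borel_measurable borel" for i k
    unfolding a_def incr_def by measurable
  have ik: "indep_var borel (\<lambda>\<omega>. y \<omega> $ i * y \<omega> $ k) borel (\<lambda>\<omega>. a (X \<omega>) i * a (X \<omega>) k)" for i k
    by (rule ind) measurable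
  note ip = indep_var_integrable[OF ik iy am(1)] indep_var_lebesgue_integral[OF ik iy am(1)]
  have sq: "(v \<bullet> (update_matrix Y *v z))\<^sup>2 = (\<Sum>i\<in>UNIV. \<Sum>k\<in>UNIV. (z $ i * z $ k) * (a Y i * a Y k))" for Y z
    unfolding inner_update_matrix a_def[symmetric] power2_eq_square sum_product by (simp add: mult_ac)
  show ?int unfolding sq using ip(1) by (intro Bochner_Integration.integrable_sum)
  have vy: "(\<integral>\<omega>. (v \<bullet> y \<omega>)\<^sup>2 \<partial>M) = (\<Sum>i\<in>UNIV. \<Sum>k\<in>UNIV. v $ i * v $ k * (\<integral>\<omega>. y \<omega> $ i * y \<omega> $ k \<partial>M))"
  proof -
    have "(v \<bullet> z)\<^sup>2 = (\<Sum>i\<in>UNIV. \<Sum>k\<in>UNIV. v $ i * v $ k * (z $ i * z $ k))" for z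
      unfolding inner_vec_def power2_eq_square sum_product by (simp add: mult_ac)
    then show ?thesis using iy by (simp add: Bochner_Integration.integrable_sum)
  qed
  have "(\<integral>\<omega>. (v \<bullet> (update_matrix (X \<omega>) *v y \<omega>))\<^sup>2 \<partial>M) =
      (\<Sum>i\<in>UNIV. \<Sum>k\<in>UNIV. (\<integral>\<omega>. y \<omega> $ i * y \<omega> $ k \<partial>M) *
        (delta q u \<alpha> l * v $ i * v $ k + (if i = k then kappa P q r \<alpha> \<beta> c l v i else 0)))"
    unfolding sq using ip(1) by (simp add: Bochner_Integration.integrable_sum ip(2) am(2))
  also have "\<dots> = delta q u \<alpha> l * (\<integral>\<omega>. (v \<bullet> y \<omega>)\<^sup>2 \<partial>M) +
      (\<Sum>i\<in>UNIV. kappa P q r \<alpha> \<beta> c l v i * (\<integral>\<omega>. (y \<omega> $ i)\<^sup>2 \<partial>M))"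
  proof -
    have "(\<integral>\<omega>. y \<omega> $ i * y \<omega> $ k \<partial>M) *
        (delta q u \<alpha> l * v $ i * v $ k + (if i = k then kappa P q r \<alpha> \<beta> c l v i else 0)) =
      delta q u \<alpha> l * (v $ i * v $ k * (\<integral>\<omega>. y \<omega> $ i * y \<omega> $ k \<partial>M)) +
      (if i = k then kappa P q r \<alpha> \<beta> c l v i * (\<integral>\<omega>. (y \<omega> $ i)\<^sup>2 \<partial>M) else 0)" for i k
      by (auto simp: power2_eq_square algebra_simps)
    then show ?thesis unfolding vy by (simp add: sum.distrib sum_distrib_left)
  qed
  finally show ?eq .
qed

end

section \<open>The Lyapunov function\<close>

text \<open>The diagonal of a function of \<open>P\<close> does not depend on the eigenbasis, hence is invariant under
  automorphisms of \<open>P\<close>.\<close>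

lemma eigenbasis_diagonal_invariant:
  fixes P :: "real^'n^'n" and v :: "'n \<Rightarrow> real^'n"
  assumes sym: "transpose P = P"
    and on: "\<And>i j. v i \<bullet> v j = (if i = j then 1 else 0)" and ev: "\<And>i. P *v v i = l i *\<^sub>R v i"
    and pi: "bij \<pi>" "\<And>a b. P $ \<pi> a $ \<pi> b = P $ a $ b"
  shows "(\<Sum>k\<in>UNIV. \<phi> (l k) * (v k $ \<pi> a)\<^sup>2) = (\<Sum>k\<in>UNIV. \<phi> (l k) * (v k $ a)\<^sup>2)"
proof -
  define w where "w k = (\<chi> a. v k $ \<pi> a)" for k
  have won: "w i \<bullet> w j = (if i = j then 1 else 0)" for i j
  proof -
    have "w i \<bullet> w j = (\<Sum>a\<in>UNIV. v i $ \<pi> a * v j $ \<pi> a)" by (simp add: w_def inner_vec_def)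
    also have "\<dots> = v i \<bullet> v j"
      unfolding inner_vec_def using sum.reindex_bij_betw[OF pi(1), of "\<lambda>a. v i $ a * v j $ a"] by simp
    finally show ?thesis using on by simp
  qed
  have wev: "P *v w i = l i *\<^sub>R w i" for i
  proof -
    have "(P *v w i) $ a = (\<Sum>b\<in>UNIV. P $ \<pi> a $ \<pi> b * v i $ \<pi> b)" for a
      by (simp add: matrix_vector_mult_def w_def pi)
    also have "\<dots> a = (P *v v i) $ \<pi> a" for a
      unfolding matrix_vector_mult_def
      using sum.reindex_bij_betw[OF pi(1), of "\<lambda>b. P $ \<pi> a $ b * v i $ b"] by simp
    finally show ?thesis by (simp add: vec_eq_iff ev w_def)
  qed
  have adj: "(P *v x) \<bullet> y = x \<bullet> (P *v y)" for x y
    by (metis dot_lmul_matrix inner_commute sym transpose_matrix_vector)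
  \<comment> \<open>Eigenvectors to different eigenvalues are orthogonal, so
    \<open>\<phi> (l k)\<close> and \<open>\<phi> (l m)\<close> agree in every non-zero term when
    one basis is expanded in the other.\<close>
  have orth: "l i = l j" if "w i \<bullet> v j \<noteq> 0" for i j
    using adj[of "w i" "v j"] that by (simp add: wev ev)
  let ?e = "axis a (1::real)"
  have "(\<Sum>k\<in>UNIV. \<phi> (l k) * (v k $ \<pi> a)\<^sup>2) = (\<Sum>k\<in>UNIV. \<phi> (l k) * ((w k \<bullet> ?e) * (w k \<bullet> ?e)))"
    by (simp add: w_def inner_axis power2_eq_square)
  also have "\<dots> = (\<Sum>k\<in>UNIV. \<phi> (l k) * ((w k \<bullet> ?e) * (\<Sum>m\<in>UNIV. (v m \<bullet> w k) * (v m \<bullet> ?e))))"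
    by (simp add: orthonormal_expansion[OF on])
  also have "\<dots> = (\<Sum>k\<in>UNIV. \<Sum>m\<in>UNIV. \<phi> (l m) * ((v m \<bullet> ?e) * ((w k \<bullet> v m) * (w k \<bullet> ?e))))"
    unfolding sum_distrib_left
  proof (intro sum.cong refl)
    fix k m
    show "\<phi> (l k) * ((w k \<bullet> ?e) * ((v m \<bullet> w k) * (v m \<bullet> ?e))) = \<phi> (l m) * ((v m \<bullet> ?e) * ((w k \<bullet> v m) * (w k \<bullet> ?e)))"
      using orth[of k m] by (cases "w k \<bullet> v m = 0") (auto simp: inner_commute)
  qed
  also have "\<dots> = (\<Sum>m\<in>UNIV. \<phi> (l m) * ((v m \<bullet> ?e) * (\<Sum>k\<in>UNIV. (w k \<bullet> v m) * (w k \<bullet> ?e))))"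
    by (subst sum.swap) (simp add: sum_distrib_left)
  also have "\<dots> = (\<Sum>m\<in>UNIV. \<phi> (l m) * (v m $ a)\<^sup>2)"
    unfolding orthonormal_expansion[OF won] by (simp add: inner_axis power2_eq_square)
  finally show ?thesis .
qed

text \<open>\<open>matrix_inv\<close> selects some inverse, so invertibility of the permutation
  matrix comes first, from orthogonality. The conjugation then says that it commutes with
  \<open>P\<close>, which is read off entry by entry.\<close>

lemma transitive_matrix_automorphism:
  fixes P :: "real^'n^'n"
  assumes "transitive_matrix P"
  obtains \<pi> where "bij \<pi>" "\<pi> i = j" "\<And>a b. P $ \<pi> a $ \<pi> b = P $ a $ b"
proof -
  obtain \<pi> where pi: "bij \<pi>" "\<pi> i = j" "matrix_inv (perm_matrix \<pi>) ** P ** perm_matrix \<pi> = P"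
    using assms by (auto simp: transitive_matrix_def)
  let ?Q = "perm_matrix \<pi> :: real^'n^'n"
  have "transpose ?Q ** ?Q = mat 1"
  proof -
    have "(\<Sum>k\<in>UNIV. (if k = \<pi> a then 1 else 0) * (if k = \<pi> b then 1 else 0)) = (if a = b then 1 else (0::real))" for a b
    proof -
      have "(\<Sum>k\<in>UNIV. (if k = \<pi> a then 1 else 0) * (if k = \<pi> b then 1 else (0::real))) =
        (\<Sum>k\<in>UNIV. if k = \<pi> a then (if \<pi> a = \<pi> b then 1 else 0) else 0)"
        by (intro sum.cong) auto
      then show ?thesis using pi(1) by (simp add: bij_is_inj inj_eq)
    qed
    then show ?thesis
      by (simp add: vec_eq_iff matrix_matrix_mult_def transpose_def perm_matrix_def mat_def)
  qed
  then have "invertible ?Q" using invertible_left_inverse by blast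
  then have "?Q ** matrix_inv ?Q = mat 1"
    unfolding matrix_inv_def invertible_def by (rule someI2_ex) simp
  then have "P ** ?Q = (?Q ** matrix_inv ?Q) ** (P ** ?Q)" by simp
  also have "\<dots> = ?Q ** (matrix_inv ?Q ** P ** ?Q)" by (simp only: matrix_mul_assoc)
  finally have e: "P ** ?Q = ?Q ** P" using pi(3) by simp
  have "P $ \<pi> a $ \<pi> b = P $ a $ b" for a b
  proof -
    have "(P ** ?Q) $ \<pi> a $ b = (\<Sum>k\<in>UNIV. if k = \<pi> b then P $ \<pi> a $ k else 0)"
      unfolding matrix_matrix_mult_def perm_matrix_def vec_lambda_beta by (rule sum.cong) auto
    moreover have "(?Q ** P) $ \<pi> a $ b = (\<Sum>k\<in>UNIV. if k = a then P $ k $ b else 0)"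
      unfolding matrix_matrix_mult_def perm_matrix_def vec_lambda_beta
      using pi(1) by (intro sum.cong) (auto simp: bij_is_inj inj_eq)
    ultimately show ?thesis using e by simp
  qed
  then show thesis using that pi by blast
qed

text \<open>The sum is twice v . (I - P) v: each square term gives 1 because rows and columns of
  \<open>P\<close> sum to 1, and the mixed term gives \<open>-2 * l\<close>.\<close>

lemma dirichlet_form:
  fixes P :: "real^'n^'n"
  assumes P: "column_stochastic P" and sym: "transpose P = P" and ev: "P *v v = l *\<^sub>R v" and nv: "v \<bullet> v = 1"
  shows "(\<Sum>i\<in>UNIV. \<Sum>j\<in>UNIV. P $ j $ i * (v $ j - v $ i)\<^sup>2) = 2 * (1 - l)"
proof -
  have s: "P $ j $ i = P $ i $ j" for i j using arg_cong[OF sym, of "\<lambda>A. A $ i $ j"] by (simp add: transpose_def)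
  have P1: "(\<Sum>j\<in>UNIV. P $ j $ i) = 1" for i using P by (simp add: column_stochastic_def)
  have P1': "(\<Sum>j\<in>UNIV. P $ i $ j) = 1" for i using P1[of i] s by simp
  have Pv: "(\<Sum>j\<in>UNIV. P $ j $ i * v $ j) = l * v $ i" for i
    using arg_cong[OF ev, of "\<lambda>x. x $ i"] by (simp add: matrix_vector_mult_def s[of _ i])
  have v2: "(\<Sum>i\<in>UNIV. (v $ i)\<^sup>2) = 1" using nv by (simp add: inner_vec_def power2_eq_square)
  have "(\<Sum>i\<in>UNIV. \<Sum>j\<in>UNIV. P $ j $ i * (v $ j - v $ i)\<^sup>2) =
     (\<Sum>i\<in>UNIV. \<Sum>j\<in>UNIV. P $ j $ i * (v $ j)\<^sup>2) + (\<Sum>i\<in>UNIV. (\<Sum>j\<in>UNIV. P $ j $ i) * (v $ i)\<^sup>2) -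
     2 * (\<Sum>i\<in>UNIV. v $ i * (\<Sum>j\<in>UNIV. P $ j $ i * v $ j))"
    by (simp add: power2_diff algebra_simps sum.distrib sum_subtractf sum_distrib_left)
  also have "(\<Sum>i\<in>UNIV. \<Sum>j\<in>UNIV. P $ j $ i * (v $ j)\<^sup>2) = 1"
    by (subst sum.swap) (simp add: P1' v2 flip: sum_distrib_right)
  also have "(\<Sum>i\<in>UNIV. v $ i * (\<Sum>j\<in>UNIV. P $ j $ i * v $ j)) = l * (\<Sum>i\<in>UNIV. (v $ i)\<^sup>2)"
    unfolding Pv by (simp add: sum_distrib_left power2_eq_square mult_ac)
  finally show ?thesis by (simp add: P1 v2)
qed

lemma eigenvalue_le_1:
  fixes P :: "real^'n^'n"
  assumes P: "column_stochastic P" and sym: "transpose P = P" and ev: "P *v v = l *\<^sub>R v" and nv: "v \<bullet> v = 1"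
  shows "l \<le> 1"
proof -
  have "0 \<le> (\<Sum>i\<in>UNIV. \<Sum>j\<in>UNIV. P $ j $ i * (v $ j - v $ i)\<^sup>2)"
    using P by (intro sum_nonneg mult_nonneg_nonneg) (auto simp: column_stochastic_def)
  then show ?thesis unfolding dirichlet_form[OF assms] by simp
qed

lemma sum_kappa:
  fixes P :: "real^'n^'n"
  assumes P: "column_stochastic P" and sym: "transpose P = P" and ev: "P *v v = l *\<^sub>R v" and nv: "v \<bullet> v = 1"
  shows "(\<Sum>i\<in>UNIV. kappa P q r \<alpha> \<beta> c l v i) = q\<^sup>2 * (bcoef r \<alpha> \<beta> c l - \<beta> * c * (1 - l))"
proof -
  have v2: "(\<Sum>i\<in>UNIV. (v $ i)\<^sup>2) = 1" using nv by (simp add: inner_vec_def power2_eq_square)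
  have "(\<Sum>i\<in>UNIV. kappa P q r \<alpha> \<beta> c l v i) =
    q\<^sup>2 * ((\<beta> - \<alpha>) * (1 - l)\<^sup>2 * (\<Sum>i\<in>UNIV. (v $ i)\<^sup>2) +
      (r\<^sup>2 - \<beta> * c) * (\<Sum>i\<in>UNIV. \<Sum>j\<in>UNIV. P $ j $ i * (v $ j - v $ i)\<^sup>2))"
    unfolding kappa_def sum_distrib_left[symmetric] sum.distrib ..
  then show ?thesis unfolding dirichlet_form[OF assms] v2 by (simp add: bcoef_def power2_eq_square algebra_simps)
qed

text \<open>For a single eigenvector \<open>kappa\<close> varies with \<open>i\<close>. Summed with
  weights that depend on the eigenvalue alone it becomes a combination of diagonal entries of
  functions of \<open>P\<close>, less the share of the constant vector \<open>v k0\<close>, and of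
  their averages over \<open>P\<close>; transitivity makes all of these constant.\<close>

lemma sum_kappa_constant:
  fixes P :: "real^'n^'n" and v :: "'n \<Rightarrow> real^'n"
  assumes P: "column_stochastic P" and sym: "transpose P = P" and tr: "transitive_matrix P"
    and on: "\<And>i j. v i \<bullet> v j = (if i = j then 1 else 0)" and ev: "\<And>i. P *v v i = l i *\<^sub>R v i"
    and k0: "\<And>i j. v k0 $ i = v k0 $ j"
  shows "(\<Sum>k\<in>-{k0}. \<phi> (l k) * kappa P q r \<alpha> \<beta> c (l k) (v k) i) =
    (\<Sum>k\<in>-{k0}. \<phi> (l k) * kappa P q r \<alpha> \<beta> c (l k) (v k) j)"
proof -
  have s: "P $ j $ i = P $ i $ j" for i j using arg_cong[OF sym, of "\<lambda>A. A $ i $ j"] by (simp add: transpose_def)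
  have P1: "(\<Sum>j\<in>UNIV. P $ j $ i) = 1" for i using P by (simp add: column_stochastic_def)
  have Pv: "(\<Sum>j\<in>UNIV. P $ j $ i * v k $ j) = l k * v k $ i" for i k
    using arg_cong[OF ev[of k], of "\<lambda>x. x $ i"] by (simp add: matrix_vector_mult_def s[of _ i])
  define d where "d \<psi> i = (\<Sum>k\<in>-{k0}. \<psi> (l k) * (v k $ i)\<^sup>2)" for \<psi> i
  have dc: "d \<psi> i = d \<psi> j" for \<psi> i j
  proof -
    obtain \<pi> where pi: "bij \<pi>" "\<pi> i = j" "\<And>a b. P $ \<pi> a $ \<pi> b = P $ a $ b"
      using transitive_matrix_automorphism[OF tr] by metis
    have "d \<psi> i = (\<Sum>k\<in>UNIV. \<psi> (l k) * (v k $ i)\<^sup>2) - \<psi> (l k0) * (v k0 $ i)\<^sup>2" for i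
      unfolding d_def using sum.remove[of UNIV k0 "\<lambda>k. \<psi> (l k) * (v k $ i)\<^sup>2"] by (simp add: Compl_eq_Diff_UNIV)
    then show ?thesis
      using eigenbasis_diagonal_invariant[OF sym on ev pi(1,3), of \<psi> i] pi(2) k0[of i j] by simp
  qed
  have A: "(\<Sum>k\<in>-{k0}. \<phi> (l k) * kappa P q r \<alpha> \<beta> c (l k) (v k) i) =
     q\<^sup>2 * (d (\<lambda>l. \<phi> l * ((\<beta> - \<alpha>) * (1 - l)\<^sup>2 + (r\<^sup>2 - \<beta> * c) * (1 - 2 * l))) i +
      (r\<^sup>2 - \<beta> * c) * (\<Sum>j\<in>UNIV. P $ j $ i * d \<phi> j))" for i
  proof -
    have sq: "(\<Sum>j\<in>UNIV. P $ j $ i * (v k $ j - v k $ i)\<^sup>2) =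
      (\<Sum>j\<in>UNIV. P $ j $ i * (v k $ j)\<^sup>2) + (1 - 2 * l k) * (v k $ i)\<^sup>2" for k
    proof -
      have "(\<Sum>j\<in>UNIV. P $ j $ i * (v k $ j - v k $ i)\<^sup>2) =
        (\<Sum>j\<in>UNIV. P $ j $ i * (v k $ j)\<^sup>2) + (\<Sum>j\<in>UNIV. P $ j $ i) * (v k $ i)\<^sup>2 -
        2 * v k $ i * (\<Sum>j\<in>UNIV. P $ j $ i * v k $ j)"
        by (simp add: power2_diff algebra_simps sum.distrib sum_subtractf sum_distrib_left sum_distrib_right)
      then show ?thesis unfolding P1 Pv by (simp add: power2_eq_square algebra_simps)
    qed
    have "\<phi> (l k) * kappa P q r \<alpha> \<beta> c (l k) (v k) i =
      q\<^sup>2 * (\<phi> (l k) * ((\<beta> - \<alpha>) * (1 - l k)\<^sup>2 + (r\<^sup>2 - \<beta> * c) * (1 - 2 * l k)) * (v k $ i)\<^sup>2 +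
      (r\<^sup>2 - \<beta> * c) * (\<phi> (l k) * (\<Sum>j\<in>UNIV. P $ j $ i * (v k $ j)\<^sup>2)))" for k
      unfolding kappa_def sq by (simp add: algebra_simps)
    then have "(\<Sum>k\<in>-{k0}. \<phi> (l k) * kappa P q r \<alpha> \<beta> c (l k) (v k) i) =
      q\<^sup>2 * (d (\<lambda>l. \<phi> l * ((\<beta> - \<alpha>) * (1 - l)\<^sup>2 + (r\<^sup>2 - \<beta> * c) * (1 - 2 * l))) i +
      (r\<^sup>2 - \<beta> * c) * (\<Sum>k\<in>-{k0}. \<Sum>j\<in>UNIV. \<phi> (l k) * (P $ j $ i * (v k $ j)\<^sup>2)))"
      by (simp only: d_def sum.distrib sum_distrib_left[symmetric])
    also have "(\<Sum>k\<in>-{k0}. \<Sum>j\<in>UNIV. \<phi> (l k) * (P $ j $ i * (v k $ j)\<^sup>2)) = (\<Sum>j\<in>UNIV. P $ j $ i * d \<phi> j)"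
      by (subst sum.swap) (simp add: d_def sum_distrib_left mult_ac)
    finally show ?thesis .
  qed
  have B: "(\<Sum>j\<in>UNIV. P $ j $ i * d \<phi> j) = d \<phi> k0" for i
  proof -
    have "(\<Sum>j\<in>UNIV. P $ j $ i * d \<phi> j) = (\<Sum>j\<in>UNIV. P $ j $ i * d \<phi> k0)"
      by (intro sum.cong refl arg_cong2[where f="(*)"] dc)
    then show ?thesis by (simp add: P1 flip: sum_distrib_right)
  qed
  show ?thesis
    unfolding A B using dc[of "\<lambda>l. \<phi> l * ((\<beta> - \<alpha>) * (1 - l)\<^sup>2 + (r\<^sup>2 - \<beta> * c) * (1 - 2 * l))" i j] by simp
qed

text \<open>The weights satisfy h \<Delta> + 1 = \<xi> h. The correction \<open>T\<close> is the
  same at every node, so it multiplies the whole second moment of \<open>y\<close>, which is the sum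
  of all mode energies, and a bound of 1 on \<open>T\<close> closes the estimate.\<close>

lemma (in prob_space) lyapunov_step:
  fixes X :: "'a \<Rightarrow> real^'n^'n" and P :: "real^'n^'n" and y :: "'a \<Rightarrow> real^'n" and v :: "'n \<Rightarrow> real^'n"
  assumes X[measurable]: "X \<in> borel_measurable M" and adm: "AE \<omega> in M. admissible (X \<omega>)"
    and mom: "moment_conditions M X P q u r \<alpha> \<beta>"
    and P: "column_stochastic P" and sym: "transpose P = P" and tr: "transitive_matrix P"
    and pc: "\<And>i j. \<beta> * (P $ i $ j)\<^sup>2 = \<beta> * c * P $ i $ j"
    and on: "\<And>i j. v i \<bullet> v j = (if i = j then 1 else 0)" and ev: "\<And>i. P *v v i = l i *\<^sub>R v i"
    and k0: "v k0 = (1 / sqrt CARD('n)) *\<^sub>R 1"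
    and y[measurable]: "y \<in> borel_measurable M" and bd: "AE \<omega> in M. norm (y \<omega>) \<le> K"
    and y1: "AE \<omega> in M. y \<omega> \<bullet> 1 = 0"
    and ind: "\<And>f g :: _ \<Rightarrow> real. \<lbrakk>f \<in> borel_measurable borel; g \<in> borel_measurable borel\<rbrakk> \<Longrightarrow>
      indep_var borel (\<lambda>\<omega>. f (y \<omega>)) borel (\<lambda>\<omega>. g (X \<omega>))"
    and xi: "\<And>k. k \<noteq> k0 \<Longrightarrow> delta q u \<alpha> (l k) < \<xi>"
    and g: "q\<^sup>2 / CARD('n) * (\<Sum>k\<in>-{k0}. (bcoef r \<alpha> \<beta> c (l k) - \<beta> * c * (1 - l k)) / (\<xi> - delta q u \<alpha> (l k))) \<le> 1"
    and Q_def: "\<And>y. Q y = (\<Sum>k\<in>-{k0}. (v k \<bullet> y)\<^sup>2 / (\<xi> - delta q u \<alpha> (l k)))"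
  shows "integrable M (\<lambda>\<omega>. Q (update_matrix (X \<omega>) *v y \<omega>))"
    and "(\<integral>\<omega>. Q (update_matrix (X \<omega>) *v y \<omega>) \<partial>M) \<le> \<xi> * (\<integral>\<omega>. Q (y \<omega>) \<partial>M)"
proof -
  define h where "h l = 1 / (\<xi> - delta q u \<alpha> l)" for l
  have Qh: "Q y = (\<Sum>k\<in>-{k0}. h (l k) * (v k \<bullet> y)\<^sup>2)" for y by (simp add: Q_def h_def)
  have sm1: "integrable M (\<lambda>\<omega>. (v k \<bullet> (update_matrix (X \<omega>) *v y \<omega>))\<^sup>2)" for k
    by (rule second_moment_step(1)[OF X adm mom P sym pc ev y bd ind])
  have sm2: "(\<integral>\<omega>. (v k \<bullet> (update_matrix (X \<omega>) *v y \<omega>))\<^sup>2 \<partial>M) =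
      delta q u \<alpha> (l k) * (\<integral>\<omega>. (v k \<bullet> y \<omega>)\<^sup>2 \<partial>M) +
      (\<Sum>i\<in>UNIV. kappa P q r \<alpha> \<beta> c (l k) (v k) i * (\<integral>\<omega>. (y \<omega> $ i)\<^sup>2 \<partial>M))" for k
    by (rule second_moment_step(2)[OF X adm mom P sym pc ev y bd ind])
  show int: "integrable M (\<lambda>\<omega>. Q (update_matrix (X \<omega>) *v y \<omega>))"
    unfolding Qh using sm1 by (intro Bochner_Integration.integrable_sum integrable_mult_right)
  have iy: "integrable M (\<lambda>\<omega>. (z \<bullet> y \<omega>)\<^sup>2)" for z
  proof (rule integrable_const_bound[where B="(norm z * K)\<^sup>2"])
    show "AE \<omega> in M. norm ((z \<bullet> y \<omega>)\<^sup>2) \<le> (norm z * K)\<^sup>2"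
      using bd
    proof eventually_elim
      case (elim \<omega>)
      have "\<bar>z \<bullet> y \<omega>\<bar> \<le> norm z * norm (y \<omega>)" by (rule Cauchy_Schwarz_ineq2)
      also have "\<dots> \<le> norm z * K" using elim by (intro mult_left_mono) auto
      finally show ?case by (simp add: abs_le_square_iff[symmetric] power2_le_iff_abs_le)
    qed
  qed measurable
  define E where "E k = (\<integral>\<omega>. (v k \<bullet> y \<omega>)\<^sup>2 \<partial>M)" for k
  define S where "S = (\<Sum>k\<in>-{k0}. E k)"
  have E0: "E k \<ge> 0" for k by (simp add: E_def)
  have S0: "S \<ge> 0" unfolding S_def using E0 by (intro sum_nonneg) auto
  have iyi: "integrable M (\<lambda>\<omega>. (y \<omega> $ i)\<^sup>2)" for i
    using iy[of "axis i 1"] by (simp add: inner_axis')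
  \<comment> \<open>Entry sum 0 removes the \<open>k0\<close> mode, so the energies of the other
    modes exhaust the squared norm of \<open>y\<close>.\<close>
  have Ek0: "E k0 = 0"
  proof -
    have "AE \<omega> in M. (v k0 \<bullet> y \<omega>)\<^sup>2 = 0"
      using y1 by eventually_elim (simp add: k0 inner_commute)
    then have "E k0 = (\<integral>\<omega>. 0 \<partial>M)" unfolding E_def by (intro integral_cong_AE) auto
    then show ?thesis by simp
  qed
  have Ei: "(\<Sum>i\<in>UNIV. (\<integral>\<omega>. (y \<omega> $ i)\<^sup>2 \<partial>M)) = S"
  proof -
    have "(\<Sum>i\<in>UNIV. (\<integral>\<omega>. (y \<omega> $ i)\<^sup>2 \<partial>M)) = (\<integral>\<omega>. y \<omega> \<bullet> y \<omega> \<partial>M)"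
      using iyi by (simp add: inner_vec_def power2_eq_square)
    also have "\<dots> = (\<integral>\<omega>. (\<Sum>k\<in>UNIV. (v k \<bullet> y \<omega>)\<^sup>2) \<partial>M)"
      using orthonormal_expansion[OF on] by (simp add: power2_eq_square)
    also have "\<dots> = (\<Sum>k\<in>UNIV. E k)" using iy by (simp add: E_def)
    also have "\<dots> = S" using Ek0 sum.remove[of UNIV k0 E] by (simp add: S_def Compl_eq_Diff_UNIV)
    finally show ?thesis .
  qed
  define T where "T i = (\<Sum>k\<in>-{k0}. h (l k) * kappa P q r \<alpha> \<beta> c (l k) (v k) i)" for i
  have k0c: "v k0 $ i = v k0 $ j" for i j by (simp add: k0)
  have Tc: "T i = T k0" for i
    unfolding T_def by (rule sum_kappa_constant[where \<phi>=h, OF P sym tr on ev k0c])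
  \<comment> \<open>Being constant, \<open>T\<close> equals its average over the nodes, and
    \<open>sum_kappa\<close> identifies that average with the left side of \<open>g\<close>. Here
    \<open>k0\<close> only serves as some node.\<close>
  have "(\<Sum>i\<in>UNIV. T i) = (\<Sum>i\<in>(UNIV::'n set). T k0)" by (intro sum.cong refl Tc)
  then have "CARD('n) * T k0 = (\<Sum>i\<in>UNIV. T i)" by simp
  also have "\<dots> = (\<Sum>k\<in>-{k0}. h (l k) * (\<Sum>i\<in>UNIV. kappa P q r \<alpha> \<beta> c (l k) (v k) i))"
    unfolding T_def by (subst sum.swap) (simp add: sum_distrib_left)
  also have "\<dots> = (\<Sum>k\<in>-{k0}. h (l k) * (q\<^sup>2 * (bcoef r \<alpha> \<beta> c (l k) - \<beta> * c * (1 - l k))))"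
    using on by (intro sum.cong refl) (simp add: sum_kappa[OF P sym ev])
  also have "\<dots> = q\<^sup>2 * (\<Sum>k\<in>-{k0}. (bcoef r \<alpha> \<beta> c (l k) - \<beta> * c * (1 - l k)) / (\<xi> - delta q u \<alpha> (l k)))"
    by (simp add: h_def sum_distrib_left mult_ac)
  finally have "T k0 = q\<^sup>2 / CARD('n) * (\<Sum>k\<in>-{k0}. (bcoef r \<alpha> \<beta> c (l k) - \<beta> * c * (1 - l k)) / (\<xi> - delta q u \<alpha> (l k)))"
    by (simp add: field_simps)
  then have T1: "T k0 \<le> 1" using g by simp
  have "(\<integral>\<omega>. Q (update_matrix (X \<omega>) *v y \<omega>) \<partial>M) =
     (\<Sum>k\<in>-{k0}. h (l k) * (delta q u \<alpha> (l k) * E k + (\<Sum>i\<in>UNIV. kappa P q r \<alpha> \<beta> c (l k) (v k) i * (\<integral>\<omega>. (y \<omega> $ i)\<^sup>2 \<partial>M))))"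
    unfolding Qh using sm1 by (simp add: Bochner_Integration.integrable_sum E_def sm2)
  also have "\<dots> = (\<Sum>k\<in>-{k0}. h (l k) * delta q u \<alpha> (l k) * E k) +
     (\<Sum>k\<in>-{k0}. \<Sum>i\<in>UNIV. h (l k) * kappa P q r \<alpha> \<beta> c (l k) (v k) i * (\<integral>\<omega>. (y \<omega> $ i)\<^sup>2 \<partial>M))"
    by (simp add: distrib_left sum.distrib sum_distrib_left mult_ac)
  also have "(\<Sum>k\<in>-{k0}. \<Sum>i\<in>UNIV. h (l k) * kappa P q r \<alpha> \<beta> c (l k) (v k) i * (\<integral>\<omega>. (y \<omega> $ i)\<^sup>2 \<partial>M)) =
     (\<Sum>i\<in>UNIV. T i * (\<integral>\<omega>. (y \<omega> $ i)\<^sup>2 \<partial>M))"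
    by (subst sum.swap) (simp add: T_def sum_distrib_right)
  also have "\<dots> = T k0 * S" unfolding Ei[symmetric] sum_distrib_left by (intro sum.cong refl) (metis Tc)
  also have "\<dots> \<le> S" using mult_right_mono[OF T1 S0] by simp
  also have "(\<Sum>k\<in>-{k0}. h (l k) * delta q u \<alpha> (l k) * E k) + S = (\<Sum>k\<in>-{k0}. \<xi> * (h (l k) * E k))"
    unfolding S_def sum.distrib[symmetric]
  proof (intro sum.cong refl)
    fix k assume "k \<in> -{k0}"
    then have "\<xi> - delta q u \<alpha> (l k) \<noteq> 0" using xi[of k] by simp
    then have "h (l k) * delta q u \<alpha> (l k) + 1 = \<xi> * h (l k)" by (simp add: h_def field_simps)
    then have "(h (l k) * delta q u \<alpha> (l k) + 1) * E k = \<xi> * h (l k) * E k" by simp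
    then show "h (l k) * delta q u \<alpha> (l k) * E k + E k = \<xi> * (h (l k) * E k)" by (simp add: distrib_right mult.assoc)
  qed
  also have "\<dots> = \<xi> * (\<integral>\<omega>. Q (y \<omega>) \<partial>M)"
    unfolding Qh using iy by (simp add: E_def sum_distrib_left)
  finally show "(\<integral>\<omega>. Q (update_matrix (X \<omega>) *v y \<omega>) \<partial>M) \<le> \<xi> * (\<integral>\<omega>. Q (y \<omega>) \<partial>M)" by simp
qed

section \<open>Trajectories\<close>

lemma col_stoch_mult_inner_1: "col_stoch A \<Longrightarrow> (A *v y) \<bullet> 1 = y \<bullet> 1"
  by (metis col_stoch_def dot_lmul_matrix inner_commute)

lemma col_stoch_l1_mono:
  assumes "col_stoch A"
  shows "(\<Sum>i\<in>UNIV. \<bar>(A *v y) $ i\<bar>) \<le> (\<Sum>i\<in>UNIV. \<bar>y $ i\<bar>)"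
proof -
  note A = col_stochD[OF assms]
  have "(\<Sum>i\<in>UNIV. \<bar>(A *v y) $ i\<bar>) \<le> (\<Sum>i\<in>UNIV. \<Sum>j\<in>UNIV. A $ i $ j * \<bar>y $ j\<bar>)"
    unfolding matrix_vector_mult_def using A
    by (intro sum_mono) (auto simp: abs_mult intro!: order_trans[OF sum_abs])
  also have "\<dots> = (\<Sum>j\<in>UNIV. (\<Sum>i\<in>UNIV. A $ i $ j) * \<bar>y $ j\<bar>)"
    by (subst sum.swap) (simp add: sum_distrib_right)
  finally show ?thesis by (simp add: A)
qed

lemma trajectory_diff_scaleR:
  fixes x y :: "real^'n"
  shows "trajectory a (x - m *\<^sub>R y) t = trajectory a x t - m *\<^sub>R trajectory a y t"
  by (induction t) (auto simp: matrix_vector_mult_diff_distrib matrix_vector_mult_scaleR)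

lemma trajectory_positive:
  assumes "\<And>t. t \<ge> 1 \<Longrightarrow> col_stoch (a t)" "\<And>t i. t \<ge> 1 \<Longrightarrow> row i (a t) \<noteq> 0"
  shows "0 < trajectory a 1 t $ i"
proof (induction t arbitrary: i)
  case (Suc t)
  note A = col_stochD[OF assms(1)[of "Suc t"], simplified]
  obtain j where "a (Suc t) $ i $ j \<noteq> 0" using assms(2)[of "Suc t" i] by (auto simp: row_def vec_eq_iff)
  then have "0 < a (Suc t) $ i $ j" using A(1)[of i j] by simp
  then have "0 < a (Suc t) $ i $ j * trajectory a 1 t $ j" using Suc by simp
  also have "\<dots> \<le> trajectory a 1 (Suc t) $ i"
    by simp (rule entry_mult_ge, use A Suc in \<open>auto intro: less_imp_le\<close>)
  finally show ?case .
qed simp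

text \<open>Both vectors are updated with the same non-negative coefficients. The factor
  \<open>E\<close> is fixed at time \<open>s\<close> and carried to all later times, so a lower
  bound on the weights is used at time \<open>s\<close> only.\<close>

lemma trajectory_dominated:
  assumes "\<And>t. t \<ge> 1 \<Longrightarrow> col_stoch (a t)" "\<And>i. \<bar>trajectory a y s $ i\<bar> \<le> E * trajectory a w s $ i" "s \<le> t"
  shows "\<bar>trajectory a y t $ i\<bar> \<le> E * trajectory a w t $ i"
  using assms(3)
proof (induction t arbitrary: i rule: dec_induct)
  case (step t)
  note A = col_stochD[OF assms(1)[of "Suc t"], simplified]
  have "\<bar>trajectory a y (Suc t) $ i\<bar> \<le> (\<Sum>j\<in>UNIV. \<bar>a (Suc t) $ i $ j * trajectory a y t $ j\<bar>)"
    by (simp add: matrix_vector_mult_def)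
  also have "\<dots> \<le> (\<Sum>j\<in>UNIV. a (Suc t) $ i $ j * (E * trajectory a w t $ j))"
    using A step.IH by (intro sum_mono) (auto simp: abs_mult intro!: mult_left_mono)
  also have "\<dots> = E * trajectory a w (Suc t) $ i"
    by (simp add: matrix_vector_mult_def sum_distrib_left mult_ac)
  finally show ?case .
qed (use assms(2) in auto)

lemma elog_le: "x \<le> y \<Longrightarrow> 0 < y \<Longrightarrow> elog x \<le> ereal (ln y)"
  by (auto simp: elog_def)

text \<open>The maximal relative error does not increase, so it suffices to bound it along times whose
  distance to \<open>t\<close> is \<open>O(sqrt t)\<close>.\<close>

lemma limsup_relative_error:
  fixes a :: "nat \<Rightarrow> real^'n^'n"
  assumes cs: "\<And>t. t \<ge> 1 \<Longrightarrow> col_stoch (a t)" and rows: "\<And>t i. t \<ge> 1 \<Longrightarrow> row i (a t) \<noteq> 0"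
    and n: "n > 0" and \<delta>: "\<delta> > 0"
    and good: "\<forall>\<^sub>F k in sequentially. \<exists>b\<in>{k\<^sup>2..<(Suc k)\<^sup>2}. \<forall>i. \<delta> \<le> trajectory a 1 (b * n + n) $ i"
    and \<xi>: "\<xi> > 0" and decay: "\<forall>\<^sub>F t in sequentially. (norm (trajectory a (x0 - m *\<^sub>R 1) t))\<^sup>2 \<le> K * \<xi> ^ t"
  shows "limsup (\<lambda>t. ereal (1 / real t) *
      (MAX i. elog \<bar>trajectory a x0 t $ i / trajectory a 1 t $ i - m\<bar>)) \<le> ereal (ln \<xi> / 2)"
proof -
  define K' where "K' = \<bar>K\<bar> + 1"
  have K': "K' > 0" "K \<le> K'" by (auto simp: K'_def)
  let ?y = "trajectory a (x0 - m *\<^sub>R 1)" and ?w = "trajectory a 1"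
  have wpos: "0 < ?w t $ i" for t i by (rule trajectory_positive[OF cs rows])
  have ratio: "\<bar>trajectory a x0 t $ i / ?w t $ i - m\<bar> = \<bar>?y t $ i\<bar> / ?w t $ i" for t i
  proof -
    have "trajectory a x0 t $ i / ?w t $ i - m = ?y t $ i / ?w t $ i"
      using wpos[of t i] by (simp add: trajectory_diff_scaleR field_simps)
    then show ?thesis using wpos[of t i] by (simp add: abs_divide)
  qed
  obtain k1 where k1: "\<And>k. k \<ge> k1 \<Longrightarrow> \<exists>b\<in>{k\<^sup>2..<(Suc k)\<^sup>2}. \<forall>i. \<delta> \<le> ?w (b * n + n) $ i"
    using good by (auto simp: eventually_sequentially)
  obtain T where T: "\<And>t. t \<ge> T \<Longrightarrow> (norm (?y t))\<^sup>2 \<le> K * \<xi> ^ t"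
    using decay by (auto simp: eventually_sequentially)
  \<comment> \<open>\<open>c1\<close> is half the gap bound 4 n sqrt t, per sqrt t, times the
    absolute value of ln \<xi>; \<open>c2\<close> collects the constants of
    \<open>ln E\<close>.\<close>
  define c1 c2 where "c1 = 2 * n * \<bar>ln \<xi>\<bar>" and "c2 = ln K' / 2 - ln \<delta>"
  define H where "H t = ln \<xi> / 2 + c1 * sqrt (1 / real t) + c2 * (1 / real t)" for t
  have main: "ereal (1 / real t) * (MAX i. elog \<bar>trajectory a x0 t $ i / ?w t $ i - m\<bar>) \<le> ereal (H t)"
    if t: "t \<ge> n * (k1 + T + 2)\<^sup>2" for t
  proof -
    \<comment> \<open>Chosen with \<open>n * s\<^sup>2 \<le> t < n * (s + 1)\<^sup>2\<close>, so
      window \<open>k = s - 1\<close> is the last one all of whose blocks have ended by time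
      \<open>t\<close>.\<close>
    define s where "s = nat \<lfloor>sqrt (real t / n)\<rfloor>"
    have s1: "real s \<le> sqrt (real t / n)" "sqrt (real t / n) < real s + 1"
    proof -
      have "real s = of_int \<lfloor>sqrt (real t / n)\<rfloor>" by (simp add: s_def)
      then show "real s \<le> sqrt (real t / n)" "sqrt (real t / n) < real s + 1" by linarith+
    qed
    have "real (k1 + T + 2) \<le> sqrt (real t / n)"
    proof (rule real_le_rsqrt)
      have "real (n * (k1 + T + 2)\<^sup>2) \<le> real t" using t by (simp only: of_nat_le_iff)
      then show "(real (k1 + T + 2))\<^sup>2 \<le> real t / n" using n by (simp add: field_simps)
    qed
    then have s2: "s \<ge> k1 + T + 2" using s1(2) by linarith
    have "(real s)\<^sup>2 \<le> real t / n" using s1(1) real_sqrt_le_iff by (metis of_nat_0_le_iff real_sqrt_ge_zero real_le_rsqrt sqrt_ge_absD abs_of_nat)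
    then have "real (n * s\<^sup>2) \<le> real t" using n by (simp add: field_simps)
    then have s3: "n * s\<^sup>2 \<le> t" by linarith
    have "real t / n < (real s + 1)\<^sup>2"
      using s1(2) by (metis real_sqrt_less_iff real_sqrt_abs abs_of_nonneg add_nonneg_nonneg of_nat_0_le_iff zero_le_one)
    then have "real t < real (n * (s + 1)\<^sup>2)" using n by (simp add: field_simps)
    then have s4: "t < n * (s + 1)\<^sup>2" by linarith
    define k where "k = s - 1"
    have sk: "s = Suc k" and kk: "k \<ge> k1" "k \<ge> T + 1" using s2 by (auto simp: k_def)
    obtain b where b: "b \<in> {k\<^sup>2..<(Suc k)\<^sup>2}" "\<And>i. \<delta> \<le> ?w (b * n + n) $ i" using k1[OF kk(1)] by blast
    define \<tau> where "\<tau> = b * n + n"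
    have "Suc b * n \<le> s\<^sup>2 * n" using b(1) sk by (intro mult_right_mono) auto
    then have \<tau>t: "\<tau> \<le> t" using s3 by (simp add: \<tau>_def mult_ac)
    have "k \<le> b"
      using b(1) le_square[of k] unfolding power2_eq_square atLeastLessThan_iff by linarith
    also have "b \<le> b * n" using n by simp
    finally have \<tau>T: "\<tau> \<ge> T" using kk by (simp add: \<tau>_def)
    have gap: "real t - real \<tau> \<le> 4 * n * sqrt (real t)"
    proof -
      have "k\<^sup>2 * n \<le> b * n" using b(1) by (intro mult_right_mono) auto
      then have "real (k\<^sup>2 * n) \<le> real (b * n)" by (simp only: of_nat_le_iff)
      moreover have "real t \<le> real (n * (s + 1)\<^sup>2)" using s4 by (simp only: of_nat_le_iff less_imp_le)
      ultimately have "real t - real \<tau> \<le> 4 * n * real s"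
        by (simp add: \<tau>_def sk power2_eq_square algebra_simps)
      also have "real s \<le> sqrt (real t)"
      proof -
        have "real t / n \<le> real t" using n by (simp add: divide_le_eq mult_le_cancel_left1)
        then show ?thesis using s1(1) by (meson order_trans real_sqrt_le_iff)
      qed
      then have "4 * n * real s \<le> 4 * n * sqrt (real t)" by (intro mult_left_mono) auto
      finally show ?thesis .
    qed
    define E where "E = sqrt (K' * \<xi> ^ \<tau>) / \<delta>"
    have Epos: "E > 0" using K' \<xi> \<delta> by (simp add: E_def)
    have dom: "\<bar>?y \<tau> $ i\<bar> \<le> E * ?w \<tau> $ i" for i
    proof -
      have "(norm (?y \<tau>))\<^sup>2 \<le> K' * \<xi> ^ \<tau>"
        using T[OF \<tau>T] mult_right_mono[OF K'(2), of "\<xi> ^ \<tau>"] \<xi> by (meson order_trans less_imp_le zero_less_power)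
      then have "norm (?y \<tau>) \<le> sqrt (K' * \<xi> ^ \<tau>)" by (rule real_le_rsqrt)
      then have "\<bar>?y \<tau> $ i\<bar> \<le> E * \<delta>" using component_le_norm_cart[of "?y \<tau>" i] \<delta> by (simp add: E_def)
      also have "\<dots> \<le> E * ?w \<tau> $ i" using b(2) Epos by (intro mult_left_mono) (auto simp: \<tau>_def)
      finally show ?thesis .
    qed
    have "\<bar>?y t $ i\<bar> \<le> E * ?w t $ i" for i by (rule trajectory_dominated[OF cs dom \<tau>t])
    then have "\<bar>trajectory a x0 t $ i / ?w t $ i - m\<bar> \<le> E" for i
      unfolding ratio using wpos[of t i] by (simp add: divide_le_eq)
    then have "elog \<bar>trajectory a x0 t $ i / ?w t $ i - m\<bar> \<le> ereal (ln E)" for i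
      using Epos by (rule elog_le)
    then have mx: "(MAX i. elog \<bar>trajectory a x0 t $ i / ?w t $ i - m\<bar>) \<le> ereal (ln E)"
      by (intro Max.boundedI) auto
    have t0: "t > 0"
    proof (rule ccontr)
      assume "\<not> t > 0" then show False using t n by simp
    qed
    have "ln E = ln K' / 2 + real \<tau> * ln \<xi> / 2 - ln \<delta>"
      using K' \<xi> \<delta> by (simp add: E_def ln_div ln_sqrt ln_mult ln_realpow add_divide_distrib)
    \<comment> \<open>Replacing \<open>\<tau>\<close> by \<open>t\<close> may help or hurt according
      to the sign of \<open>ln \<xi>\<close>, hence the absolute value.\<close>
    also have "real \<tau> * ln \<xi> \<le> real t * ln \<xi> + (real t - real \<tau>) * \<bar>ln \<xi>\<bar>"
    proof -
      have "(real t - real \<tau>) * (- ln \<xi>) \<le> (real t - real \<tau>) * \<bar>ln \<xi>\<bar>"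
        using \<tau>t by (intro mult_left_mono) auto
      then show ?thesis by (simp add: algebra_simps)
    qed
    also have "(real t - real \<tau>) * \<bar>ln \<xi>\<bar> \<le> (4 * n * sqrt (real t)) * \<bar>ln \<xi>\<bar>"
      using gap by (intro mult_right_mono) auto
    finally have "ln E \<le> real t * ln \<xi> / 2 + c1 * sqrt (real t) + c2"
      by (simp add: c1_def c2_def field_simps)
    also have "\<dots> = real t * H t"
    proof -
      have "real t * sqrt (1 / real t) = sqrt (real t)"
        using t0 by (simp add: real_sqrt_divide real_div_sqrt)
      then show ?thesis using t0 unfolding H_def by (simp add: distrib_left mult.left_commute[of _ c1])
    qed
    finally have lnE: "1 / real t * ln E \<le> H t" using t0 by (simp add: field_simps)
    have "ereal (1 / real t) * (MAX i. elog \<bar>trajectory a x0 t $ i / ?w t $ i - m\<bar>) \<le> ereal (1 / real t) * ereal (ln E)"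
      using mx by (intro ereal_mult_left_mono) auto
    then show ?thesis using lnE by (simp add: order_trans)
  qed
  have "limsup (\<lambda>t. ereal (1 / real t) * (MAX i. elog \<bar>trajectory a x0 t $ i / ?w t $ i - m\<bar>)) \<le> limsup (\<lambda>t. ereal (H t))"
    by (rule Limsup_mono) (use main in \<open>auto simp: eventually_sequentially\<close>)
  also have "\<dots> = ereal (ln \<xi> / 2)"
  proof (rule lim_imp_Limsup)
    have "(\<lambda>t. 1 / real t) \<longlonglongrightarrow> 0" by (rule lim_1_over_n)
    then have "H \<longlonglongrightarrow> ln \<xi> / 2 + c1 * sqrt 0 + c2 * 0"
      unfolding H_def by (intro tendsto_intros)
    then show "(\<lambda>t. ereal (H t)) \<longlonglongrightarrow> ereal (ln \<xi> / 2)" by simp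
  qed simp
  finally show ?thesis .
qed

section \<open>Lower bounds for the weights\<close>

lemma continuous_on_update_matrix: "continuous_on S (update_matrix :: real^'n^'n \<Rightarrow> real^'n^'n)"
proof -
  have eq: "(update_matrix :: real^'n^'n \<Rightarrow> real^'n^'n) = (\<lambda>C. \<chi> i j. (if i = j then 1 else 0) + C $ i $ j -
      (if i = j then 1 else 0) * (\<Sum>k\<in>UNIV. C $ k $ j))"
    by (auto simp: update_matrix_def col_sum_diag_def mat_def vec_eq_iff)
  show ?thesis unfolding eq by (intro continuous_on_vec_lambda continuous_intros)
qed

lemma measurable_update_matrix [measurable]: "update_matrix \<in> borel \<rightarrow>\<^sub>M borel"
  by (intro borel_measurable_continuous_onI continuous_on_update_matrix)

lemma admissible_col_stoch:
  assumes "admissible C"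
  shows "col_stoch (update_matrix C)"
proof -
  have e: "update_matrix C $ i $ j = (if i = j then 1 - (\<Sum>k\<in>UNIV. C $ k $ j) else C $ i $ j)" for i j
    using assms by (simp add: update_matrix_def col_sum_diag_def mat_def admissible_def)
  have "(\<Sum>i\<in>UNIV. update_matrix C $ i $ j) = 1" for j
  proof -
    have "(\<Sum>i\<in>UNIV. update_matrix C $ i $ j) =
       (\<Sum>i\<in>UNIV. (if i = j then 1 - (\<Sum>k\<in>UNIV. C $ k $ j) else 0) + C $ i $ j)"
      using assms by (intro sum.cong) (auto simp: e admissible_def)
    then show ?thesis by (simp add: sum.distrib)
  qed
  then show ?thesis
    using assms by (auto simp: col_stoch_def e admissible_def vec_eq_iff vector_matrix_mult_def)
qed

lemma trajectory_cong:
  "(\<And>s. s \<in> {1..t} \<Longrightarrow> a s = b s) \<Longrightarrow> trajectory a x t = trajectory b x t"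
  by (induction t) auto

lemma measurable_trajectory:
  fixes Z :: "nat \<Rightarrow> 'b \<Rightarrow> real^'n^'n"
  assumes "\<And>s. s \<in> {1..t} \<Longrightarrow> Z s \<in> borel_measurable N"
  shows "(\<lambda>\<omega>. trajectory (\<lambda>s. Z s \<omega>) x t) \<in> borel_measurable N"
  using assms
proof (induction t)
  case (Suc t)
  have "continuous_on UNIV (\<lambda>p. fst p *v snd p :: real^'n)"
    unfolding matrix_vector_mult_def by (intro continuous_on_vec_lambda continuous_intros)
  then show ?case
    using borel_measurable_continuous_Pair[of "Z (Suc t)" N "\<lambda>\<omega>. trajectory (\<lambda>s. Z s \<omega>) x t" "(*v)"] Suc by simp
qed simp

text \<open>By second countability the basic open sets of probability 0 have a null union. Off that
  union every neighbourhood of the value contains a basic set of positive probability.\<close>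

lemma (in prob_space) AE_support:
  fixes X :: "'a \<Rightarrow> 'b::second_countable_topology"
  assumes X[measurable]: "X \<in> borel_measurable M"
  shows "AE \<omega> in M. \<forall>U. open U \<and> X \<omega> \<in> U \<longrightarrow> 0 < prob (X -` U \<inter> space M)"
proof -
  obtain \<B> :: "'b set set" where B: "countable \<B>" "topological_basis \<B>"
    using ex_countable_basis by blast
  have op: "open b" if "b \<in> \<B>" for b using that B(2) by (rule topological_basis_open[rotated])
  have ms: "X -` b \<inter> space M \<in> events" if "open b" for b
    using X that by (simp add: measurable_sets)
  have "AE \<omega> in M. \<forall>b\<in>{b\<in>\<B>. prob (X -` b \<inter> space M) = 0}. X \<omega> \<notin> b"
  proof (subst AE_ball_countable)
    show "countable {b\<in>\<B>. prob (X -` b \<inter> space M) = 0}" using B(1) by auto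
    show "\<forall>b\<in>{b\<in>\<B>. prob (X -` b \<inter> space M) = 0}. AE \<omega> in M. X \<omega> \<notin> b"
    proof clarify
      fix b assume "b \<in> \<B>" "prob (X -` b \<inter> space M) = 0"
      then have "AE \<omega> in M. \<omega> \<notin> X -` b \<inter> space M"
        using ms[OF op] by (subst AE_iff_null_sets[symmetric]) (auto simp: null_sets_def emeasure_eq_measure)
      then show "AE \<omega> in M. X \<omega> \<notin> b" using AE_space by eventually_elim auto
    qed
  qed
  then show ?thesis
  proof (eventually_elim, intro allI impI)
    fix \<omega> U assume H: "\<forall>b\<in>{b\<in>\<B>. prob (X -` b \<inter> space M) = 0}. X \<omega> \<notin> b" "open U \<and> X \<omega> \<in> U"
    then obtain b where b: "b \<in> \<B>" "X \<omega> \<in> b" "b \<subseteq> U" using topological_basisE[OF B(2)] by metis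
    have "0 < prob (X -` b \<inter> space M)" using H(1) b by (auto simp: zero_less_measure_iff)
    also have "\<dots> \<le> prob (X -` U \<inter> space M)"
      using b(3) ms[of U] H(2) by (intro finite_measure_mono) auto
    finally show "0 < prob (X -` U \<inter> space M)" .
  qed
qed

section \<open>The i.i.d. communication process\<close>

locale gossip = prob_space M for M :: "'w measure" +
  fixes C :: "nat \<Rightarrow> 'w \<Rightarrow> real^'n^'n" and P :: "real^'n^'n" and q u r \<alpha> \<beta> :: real
  assumes comm: "communication_assumptions M C P q u r \<alpha> \<beta>"
    and net: "network_assumptions P q u" and stoch: "column_stochastic P"
    and q: "q \<in> {0..1}" and u: "u \<in> {0..1}"
begin

abbreviation A :: "nat \<Rightarrow> 'w \<Rightarrow> real^'n^'n" where "A t \<omega> \<equiv> update_matrix (C t \<omega>)"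

lemma sym: "transpose P = P" using net by (simp add: network_assumptions_def)

lemma indep: "indep_vars (\<lambda>_. borel) C {1..}"
  using comm unfolding communication_assumptions_def by blast

lemma C_measurable: "t \<ge> 1 \<Longrightarrow> C t \<in> borel_measurable M"
  using indep unfolding indep_vars_def2 by simp

lemma A_measurable: "t \<ge> 1 \<Longrightarrow> A t \<in> borel_measurable M"
  using measurable_compose[OF C_measurable measurable_update_matrix] by simp

lemma C_distr: "t \<ge> 1 \<Longrightarrow> distr M borel (C t) = distr M borel (C 1)"
  using comm unfolding communication_assumptions_def by blast

lemma AE_admissible: "t \<ge> 1 \<Longrightarrow> AE \<omega> in M. admissible (C t \<omega>)"
  using comm unfolding communication_assumptions_def by blast

lemma integral_C:
  fixes f :: "real^'n^'n \<Rightarrow> 'b::{banach, second_countable_topology}"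
  assumes "t \<ge> 1" "f \<in> borel_measurable borel"
  shows "(\<integral>\<omega>. f (C t \<omega>) \<partial>M) = (\<integral>\<omega>. f (C 1 \<omega>) \<partial>M)"
  by (simp only: integral_distr[OF C_measurable[OF assms(1)] assms(2), symmetric]
      integral_distr[OF C_measurable[OF order_refl] assms(2), symmetric] C_distr[OF assms(1)])

lemma prob_C:
  assumes "t \<ge> 1" "S \<in> sets borel"
  shows "prob (C t -` S \<inter> space M) = prob (C 1 -` S \<inter> space M)"
  by (simp only: measure_distr[OF C_measurable[OF assms(1)] assms(2), symmetric]
      measure_distr[OF C_measurable[OF order_refl] assms(2), symmetric] C_distr[OF assms(1)])

lemma prob_A:
  assumes "t \<ge> 1" "S \<in> sets borel"
  shows "prob (A t -` S \<inter> space M) = prob (A 1 -` S \<inter> space M)"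
proof -
  have "update_matrix -` S \<in> sets (borel :: (real^'n^'n) measure)"
    using measurable_sets[OF measurable_update_matrix assms(2)] by simp
  from prob_C[OF assms(1) this] show ?thesis by (simp add: vimage_def)
qed

lemma moments: "t \<ge> 1 \<Longrightarrow> moment_conditions M (C t) P q u r \<alpha> \<beta>"
proof -
  assume t: "t \<ge> 1"
  have "moment_conditions M (C 1) P q u r \<alpha> \<beta>" using comm unfolding communication_assumptions_def by blast
  moreover have "(\<integral>\<omega>. C t \<omega> \<partial>M) = (\<integral>\<omega>. C 1 \<omega> \<partial>M)" using integral_C[OF t, of "\<lambda>x. x"] by simp
  moreover have "(\<integral>\<omega>. C t \<omega> $ j $ i * C t \<omega> $ l $ k \<partial>M) = (\<integral>\<omega>. C 1 \<omega> $ j $ i * C 1 \<omega> $ l $ k \<partial>M)" for i j k l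
    by (rule integral_C[OF t]) measurable
  ultimately show ?thesis by (simp add: moment_conditions_def)
qed

text \<open>From a deterministic start, the trajectory up to time \<open>t\<close> is a measurable
  function of \<open>C 1\<close> to \<open>C t\<close> alone, an index set disjoint from that of the
  next matrix.\<close>

lemma indep_trajectory:
  fixes f :: "real^'n \<Rightarrow> real" and g :: "real^'n^'n \<Rightarrow> real"
  assumes [measurable]: "f \<in> borel_measurable borel" "g \<in> borel_measurable borel"
  shows "indep_var borel (\<lambda>\<omega>. f (trajectory (\<lambda>s. A s \<omega>) x t)) borel (\<lambda>\<omega>. g (C (Suc t) \<omega>))"
proof -
  define F where "F z = f (trajectory (\<lambda>s. update_matrix (z s)) x t)" for z :: "nat \<Rightarrow> real^'n^'n"
  have "indep_var (PiM {1..t} (\<lambda>_. borel)) (\<lambda>\<omega>. restrict (\<lambda>i. C i \<omega>) {1..t})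
     (PiM {Suc t} (\<lambda>_. borel)) (\<lambda>\<omega>. restrict (\<lambda>i. C i \<omega>) {Suc t})"
    by (rule indep_var_restrict[OF indep]) auto
  moreover have "F \<in> borel_measurable (PiM {1..t} (\<lambda>_. borel))"
  proof -
    have "(\<lambda>z. update_matrix (z s)) \<in> borel_measurable (PiM {1..t} (\<lambda>_. borel :: (real^'n^'n) measure))"
      if "s \<in> {1..t}" for s
      using measurable_compose[OF measurable_component_singleton[OF that, of "\<lambda>_. borel"] measurable_update_matrix] .
    then have "(\<lambda>z. trajectory (\<lambda>s. update_matrix (z s)) x t) \<in> borel_measurable (PiM {1..t} (\<lambda>_. borel))"
      by (rule measurable_trajectory)
    then show ?thesis unfolding F_def by (rule measurable_compose[OF _ assms(1)])
  qed
  moreover have "(\<lambda>z. g (z (Suc t))) \<in> borel_measurable (PiM {Suc t} (\<lambda>_. borel))"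
    using measurable_compose[OF measurable_component_singleton[of "Suc t" "{Suc t}" "\<lambda>_. borel"] assms(2)] by simp
  ultimately have "indep_var borel (F \<circ> (\<lambda>\<omega>. restrict (\<lambda>i. C i \<omega>) {1..t})) borel
      ((\<lambda>z. g (z (Suc t))) \<circ> (\<lambda>\<omega>. restrict (\<lambda>i. C i \<omega>) {Suc t}))"
    by (rule indep_var_compose)
  moreover have "F (restrict (\<lambda>i. C i \<omega>) {1..t}) = f (trajectory (\<lambda>s. A s \<omega>) x t)" for \<omega>
    unfolding F_def by (intro arg_cong[of _ _ f] trajectory_cong) auto
  ultimately show ?thesis by (simp add: o_def)
qed

text \<open>The support of the law of \<open>A 1\<close>, restricted to two almost sure properties.
  Non-zero rows do not pass to limits, so a support point need not inherit them and the condition is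
  imposed.\<close>

definition G :: "(real^'n^'n) set" where
  "G = {a. col_stoch a \<and> (\<forall>i. row i a \<noteq> 0) \<and> (\<forall>U. open U \<and> a \<in> U \<longrightarrow> 0 < prob (A 1 -` U \<inter> space M))}"

lemma AE_A_in_G: "AE \<omega> in M. \<forall>t\<ge>1. A t \<omega> \<in> G"
proof -
  have "AE \<omega> in M. t \<ge> 1 \<longrightarrow> A t \<omega> \<in> G" for t
  proof (cases "t \<ge> 1")
    case True
    have cont: "continuous_on UNIV (\<lambda>x. row i (update_matrix x) :: real^'n)" for i
    proof -
      have "row i x = x $ i" for x :: "real^'n^'n" by (simp add: row_def)
      then show ?thesis by (simp add: continuous_on_component continuous_on_update_matrix)
    qed
    \<comment> \<open>Non-zero rows are given at time 1 only and reach time \<open>t\<close> through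
      the common law, which needs the set of such matrices to be measurable; it is open.\<close>
    have "AE x in distr M borel (C 1). \<forall>i. row i (update_matrix x) \<noteq> 0"
    proof (subst AE_distr_iff)
      have "open (\<Inter>i. - ((\<lambda>x. row i (update_matrix x) :: real^'n) -` {0}))"
        using cont by (intro open_INT) (auto intro!: closed_vimage)
      then show "{x \<in> space borel. \<forall>i. row i (update_matrix x) \<noteq> 0} \<in> sets (borel :: (real^'n^'n) measure)"
        by (intro borel_open) (simp add: vimage_def Compl_eq INT_extend_simps Collect_all_eq)
      have "AE \<omega> in M. \<forall>i. row i (A 1 \<omega>) \<noteq> 0"
        using comm unfolding communication_assumptions_def by blast
      then show "AE \<omega> in M. \<forall>i. row i (A 1 \<omega>) \<noteq> 0" .
    qed (rule C_measurable, simp)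
    then have "AE x in distr M borel (C t). \<forall>i. row i (update_matrix x) \<noteq> 0" by (simp only: C_distr[OF True])
    then have "AE \<omega> in M. \<forall>i. row i (A t \<omega>) \<noteq> 0" using C_measurable[OF True] by (rule AE_distrD[rotated])
    moreover have "AE \<omega> in M. \<forall>U. open U \<and> A t \<omega> \<in> U \<longrightarrow> 0 < prob (A t -` U \<inter> space M)"
      by (rule AE_support[OF A_measurable[OF True]])
    ultimately show ?thesis
      using AE_admissible[OF True]
      by eventually_elim (auto simp: G_def admissible_col_stoch prob_A[OF True])
  qed simp
  then show ?thesis by (simp add: AE_all_countable)
qed

lemma AE_col_stoch: "AE \<omega> in M. \<forall>t\<ge>1. col_stoch (A t \<omega>)"
  using AE_A_in_G by eventually_elim (simp add: G_def)

end

section \<open>Support points of the update law and recurrence of good blocks\<close>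

context gossip
begin

lemma qu_nonneg: "0 \<le> q * sqrt u" using q u by simp

lemma EC: "(\<integral>\<omega>. C 1 \<omega> $ i $ j \<partial>M) = q * sqrt u * P $ i $ j"
  by (rule expected_entry[OF C_measurable AE_admissible moments]) simp_all

lemma int_C1: "integrable M (\<lambda>\<omega>. C 1 \<omega> $ i $ j)"
  by (rule admissible_integrable(2)[OF C_measurable AE_admissible]) simp_all

lemma P_sym: "P $ i $ j = P $ j $ i"
  using arg_cong[OF sym, of "\<lambda>A. A $ i $ j"] by (simp add: transpose_def)

text \<open>Turns an almost sure closed condition on \<open>A 1\<close> into one that holds at every
  point of \<open>G\<close>.\<close>

lemma G_support:
  assumes a: "a \<in> G" and U: "open U" "a \<in> U" and ae: "AE \<omega> in M. \<not> A 1 \<omega> \<in> U"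
  shows False
proof -
  have "0 < prob (A 1 -` U \<inter> space M)" using a U by (auto simp: G_def)
  moreover have "A 1 -` U \<inter> space M \<in> events"
    by (rule measurable_sets[OF A_measurable[OF order_refl] borel_open[OF U(1)]])
  then have "prob (A 1 -` U \<inter> space M) = 0" using ae by (subst prob_eq_0) (auto elim: eventually_mono)
  ultimately show False by simp
qed

text \<open>As \<open>P\<close> is symmetric, the mean of \<open>A 1\<close> fixes 1, so
  \<open>x \<bullet> (A 1 \<omega> *v 1)\<close> has mean \<open>m\<close>. Being at most
  \<open>m\<close> almost surely, it equals \<open>m\<close> almost surely, and the set where it is
  smaller is open, hence free of points of \<open>G\<close>.\<close>

lemma G_mean:
  assumes le: "\<And>a. a \<in> G \<Longrightarrow> x \<bullet> (a *v 1) \<le> m" and m: "x \<bullet> 1 = m" and a: "a \<in> G"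
  shows "x \<bullet> (a *v 1) = m"
proof -
  note int = int_C1
  have e: "x \<bullet> (A 1 \<omega> *v 1) = m + (\<Sum>i\<in>UNIV. \<Sum>j\<in>UNIV. C 1 \<omega> $ j $ i * (x $ j - x $ i))" for \<omega>
    unfolding inner_update_matrix m[symmetric] by (simp add: incr_def sum.distrib inner_vec_def)
  have i: "integrable M (\<lambda>\<omega>. x \<bullet> (A 1 \<omega> *v 1))"
    unfolding e using int by (intro Bochner_Integration.integrable_add Bochner_Integration.integrable_sum integrable_mult_left) auto
  have "(\<integral>\<omega>. x \<bullet> (A 1 \<omega> *v 1) \<partial>M) = m + (\<Sum>i\<in>UNIV. \<Sum>j\<in>UNIV. q * sqrt u * P $ j $ i * (x $ j - x $ i))"
    unfolding e using int EC by (simp add: prob_space)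
  also have "(\<Sum>i\<in>UNIV. \<Sum>j\<in>UNIV. q * sqrt u * P $ j $ i * (x $ j - x $ i)) = 0"
  proof -
    let ?S = "\<Sum>i\<in>UNIV. \<Sum>j\<in>UNIV. q * sqrt u * P $ j $ i * (x $ j - x $ i)"
    have "?S = (\<Sum>i\<in>UNIV. \<Sum>j\<in>UNIV. q * sqrt u * P $ i $ j * (x $ i - x $ j))" by (rule sum.swap)
    also have "\<dots> = - ?S"
      unfolding sum_negf[symmetric] by (intro sum.cong refl) (simp add: P_sym algebra_simps)
    finally show ?thesis by simp
  qed
  finally have E: "(\<integral>\<omega>. m - x \<bullet> (A 1 \<omega> *v 1) \<partial>M) = 0" using i by (simp add: prob_space)
  have "AE \<omega> in M. 0 \<le> m - x \<bullet> (A 1 \<omega> *v 1)"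
    using AE_A_in_G by eventually_elim (use le in auto)
  then have "AE \<omega> in M. m - x \<bullet> (A 1 \<omega> *v 1) = 0"
    using E i integral_nonneg_eq_0_iff_AE[of M "\<lambda>\<omega>. m - x \<bullet> (A 1 \<omega> *v 1)"] by simp
  then have ae: "AE \<omega> in M. \<not> A 1 \<omega> \<in> {a. x \<bullet> (a *v 1) < m}" by eventually_elim auto
  show ?thesis
  proof (rule ccontr)
    assume "x \<bullet> (a *v 1) \<noteq> m"
    then have lt: "a \<in> {a. x \<bullet> (a *v 1) < m}" using le[OF a] by auto
    have op: "open {a. x \<bullet> (a *v 1) < m}"
      unfolding matrix_vector_mult_def
      by (intro open_Collect_less continuous_intros continuous_on_vec_lambda)
    show False using G_support[OF a op lt ae] .
  qed
qed

lemma G_nonempty: "G \<noteq> {}"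
proof
  assume "G = {}"
  then have "AE \<omega> in M. False" using AE_A_in_G by (auto elim: eventually_mono)
  then show False by simp
qed

text \<open>If \<open>q * sqrt u = 0\<close>, then \<open>C 1\<close> vanishes almost surely and the
  identity is the only product, so irreducibility is replaced by a direct argument. Otherwise each
  off-diagonal edge of \<open>P\<close> carries a positive mean, hence some member of
  \<open>G\<close> is positive there, and paths in the graph give irreducibility.\<close>

lemma uniform_G_bound:
  obtains U c where "U \<in> monoid_gen G" "c > 0" "\<And>i W. W \<in> monoid_gen G \<Longrightarrow> (U *v (W *v 1)) $ i \<ge> c"
proof (cases "q * sqrt u = 0")
  case True
  have "AE \<omega> in M. C 1 \<omega> $ i $ j = 0" for i j
  proof -
    have "AE \<omega> in M. 0 \<le> C 1 \<omega> $ i $ j"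
      using AE_admissible[of 1] by (auto simp: admissible_def elim: eventually_mono)
    moreover have "(\<integral>\<omega>. C 1 \<omega> $ i $ j \<partial>M) = 0" using EC True by simp
    ultimately show ?thesis
      using integral_nonneg_eq_0_iff_AE[OF int_C1] by blast
  qed
  then have "AE \<omega> in M. \<forall>i j. C 1 \<omega> $ i $ j = 0" by (simp add: AE_all_countable)
  then have ae: "AE \<omega> in M. A 1 \<omega> = mat 1"
    by eventually_elim (simp add: update_matrix_def col_sum_diag_def vec_eq_iff)
  have a: "a = mat 1" if "a \<in> G" for a
    using G_support[OF that, of "- {mat 1}"] ae by auto
  have W: "W = mat 1" if "W \<in> monoid_gen G" for W
    using that by induction (auto dest: a)
  show thesis
  proof (rule that[of "mat 1" 1])
    fix i V assume "V \<in> monoid_gen G"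
    then have "V = mat 1" by (rule W)
    then show "1 \<le> (mat 1 *v (V *v 1)) $ i" by simp
  qed (auto intro: monoid_gen.one)
next
  case False
  then have qu: "q * sqrt u > 0" using qu_nonneg by linarith
  have edge: "\<exists>a\<in>G. a $ i $ j > 0" if P: "0 < P $ i $ j" and "i \<noteq> j" for i j
  proof (rule ccontr)
    assume none: "\<not> ?thesis"
    from AE_A_in_G have "AE \<omega> in M. C 1 \<omega> $ i $ j \<le> 0"
    proof eventually_elim
      case (elim \<omega>)
      then have "A 1 \<omega> \<in> G" by simp
      then have "A 1 \<omega> $ i $ j \<le> 0" using none by (meson not_le)
      then show ?case using \<open>i \<noteq> j\<close> by (simp add: update_matrix_def col_sum_diag_def mat_def)
    qed
    then have "(\<integral>\<omega>. C 1 \<omega> $ i $ j \<partial>M) \<le> (\<integral>\<omega>. 0 \<partial>M)"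
      using int_C1 by (intro integral_mono_AE) auto
    then have "(\<integral>\<omega>. C 1 \<omega> $ i $ j \<partial>M) \<le> 0" by simp
    then show False using mult_pos_pos[OF qu P] EC[of i j] by linarith
  qed
  have irr: "\<exists>V\<in>monoid_gen G. V $ i $ j > 0" for i j
  proof -
    have "(i, j) \<in> {(a, b). 0 < P $ a $ b}\<^sup>*" using net by (simp add: network_assumptions_def)
    then show ?thesis
    proof induction
      case base
      show ?case by (rule bexI[OF _ monoid_gen.one]) (simp add: mat_def)
    next
      case (step y z)
      then obtain V where V: "V \<in> monoid_gen G" "V $ i $ y > 0" by blast
      show ?case
      proof (cases "y = z")
        case False
        then obtain a where a: "a \<in> G" "a $ y $ z > 0" using edge step.hyps by auto
        have "0 < V $ i $ y * a $ y $ z" using V a by simp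
        also have "\<dots> \<le> (V ** a) $ i $ z"
        proof -
          have "0 \<le> V $ i $ k * a $ k $ z" for k
            using col_stochD(1)[OF monoid_gen_col_stoch[OF _ V(1)]] a(1) by (auto simp: G_def col_stoch_def)
          then show ?thesis
            using member_le_sum[of y UNIV "\<lambda>k. V $ i $ k * a $ k $ z"] by (simp add: matrix_matrix_mult_def)
        qed
        finally show ?thesis using monoid_gen_mult[OF V(1) monoid_gen_base[OF a(1)]] by blast
      qed (use V in blast)
    qed
  qed
  show thesis
    by (rule uniform_product_bound[OF _ _ G_mean irr]) (use that in \<open>auto simp: G_def\<close>)
qed

text \<open>Disjoint blocks of times are independent and each is good with the same positive probability, so
  by Borel-Cantelli almost surely every late window \<open>{k\<^sup>2..<(k+1)\<^sup>2}\<close> contains a good block.\<close>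

lemma good_blocks:
  obtains n \<delta> where "n > 0" "\<delta> > 0"
    "AE \<omega> in M. \<forall>\<^sub>F k in sequentially. \<exists>b\<in>{k\<^sup>2..<(Suc k)\<^sup>2}. \<forall>i. \<delta> \<le> trajectory (\<lambda>s. A s \<omega>) 1 (b * n + n) $ i"
proof -
  obtain U c where U: "U \<in> monoid_gen G" "c > 0" "\<And>i W. W \<in> monoid_gen G \<Longrightarrow> (U *v (W *v 1)) $ i \<ge> c"
    using uniform_G_bound by blast
  have csG: "a \<in> G \<Longrightarrow> col_stoch a" for a by (simp add: G_def)
  obtain n B where n: "n > 0" and Bo: "\<And>i. open (B i)" and BG: "\<And>i. i \<in> {1..n} \<Longrightarrow> B i \<inter> G \<noteq> {}"
    and B: "\<And>a s i. (\<And>k. k > 0 \<Longrightarrow> a k \<in> G) \<Longrightarrow> (\<And>k. k \<in> {1..n} \<Longrightarrow> a (s + k) \<in> B k) \<Longrightarrow>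
       trajectory a 1 (s + n) $ i \<ge> c / 2"
    using uniform_trajectory_bound[OF U csG G_nonempty] by blast
  define K where "K b = {b * n + 1..b * n + n}" for b
  define S where "S b = {z \<in> space (PiM (K b) (\<lambda>_. borel)). \<forall>k\<in>{1..n}. update_matrix (z (b * n + k)) \<in> B k}" for b
  define X where "X b \<omega> = restrict (\<lambda>i. C i \<omega>) (K b)" for b \<omega>
  have disj: "disjoint_family K"
    unfolding disjoint_family_on_def
  proof (intro ballI impI)
    fix b b' :: nat assume "b \<noteq> b'"
    show "K b \<inter> K b' = {}"
    proof (rule ccontr)
      assume "K b \<inter> K b' \<noteq> {}"
      then obtain t where t: "t \<in> K b" "t \<in> K b'" by auto
      \<comment> \<open>The shift by one is due to the matrices being numbered from 1.\<close>
      have "(t - 1) div n = b''" if "t \<in> K b''" for b''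
        using that n by (intro div_nat_eqI) (auto simp: K_def mult.commute)
      then show False using t \<open>b \<noteq> b'\<close> by blast
    qed
  qed
  have Xind: "indep_vars (\<lambda>b. PiM (K b) (\<lambda>_. borel)) X UNIV"
    unfolding X_def
  proof (rule indep_vars_restrict[OF indep])
    show "K b \<subseteq> {1..}" for b by (auto simp: K_def)
  qed (rule disj)
  have kK: "b * n + k \<in> K b" if "k \<in> {1..n}" for b k using that by (auto simp: K_def)
  have Sm: "S b \<in> sets (PiM (K b) (\<lambda>_. borel))" for b
  proof -
    have "{z \<in> space (PiM (K b) (\<lambda>_. borel)). update_matrix (z (b * n + k)) \<in> B k} \<in> sets (PiM (K b) (\<lambda>_. borel))"
      if "k \<in> {1..n}" for k
    proof -
      have "(\<lambda>z. update_matrix (z (b * n + k))) \<in> borel_measurable (PiM (K b) (\<lambda>_. borel))"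
        using measurable_compose[OF measurable_component_singleton[where M="\<lambda>_. borel", OF kK[OF that]] measurable_update_matrix] .
      then have "(\<lambda>z. update_matrix (z (b * n + k))) -` B k \<inter> space (PiM (K b) (\<lambda>_. borel)) \<in> sets (PiM (K b) (\<lambda>_. borel))"
        using Bo by (intro measurable_sets) auto
      then show ?thesis by (simp add: vimage_def Int_def conj_commute)
    qed
    then show ?thesis unfolding S_def by (intro sets.sets_Collect_finite_All) auto
  qed
  \<comment> \<open>The factors of a block are independent, so this is the probability that a block
    is good; each factor is positive because its neighbourhood meets the support.\<close>
  define p where "p = (\<Prod>k\<in>{1..n}. prob (A 1 -` B k \<inter> space M))"
  have "0 < prob (A 1 -` B k \<inter> space M)" if "k \<in> {1..n}" for k
    using BG[OF that] Bo by (auto simp: G_def)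
  then have p0: "p > 0" unfolding p_def by (intro prod_pos) auto
  have pS: "prob (X b -` S b \<inter> space M) = p" for b
  proof -
    have "X b -` S b \<inter> space M = (\<Inter>t\<in>K b. C t -` (update_matrix -` B (t - b * n)) \<inter> space M)"
    proof -
      have "X b \<omega> \<in> S b \<longleftrightarrow> (\<forall>t\<in>K b. A t \<omega> \<in> B (t - b * n))" for \<omega>
      proof -
        have "X b \<omega> \<in> S b \<longleftrightarrow> (\<forall>k\<in>{1..n}. A (b * n + k) \<omega> \<in> B k)"
          using kK by (auto simp: S_def X_def space_PiM)
        also have "\<dots> \<longleftrightarrow> (\<forall>t\<in>K b. A t \<omega> \<in> B (t - b * n))"
        proof (intro iffI ballI)
          fix t assume "\<forall>k\<in>{1..n}. A (b * n + k) \<omega> \<in> B k" "t \<in> K b"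
          then show "A t \<omega> \<in> B (t - b * n)" by (auto simp: K_def dest!: bspec[of _ _ "t - b * n"])
        next
          fix k assume "\<forall>t\<in>K b. A t \<omega> \<in> B (t - b * n)" "k \<in> {1..n}"
          then show "A (b * n + k) \<omega> \<in> B k" using kK[of k b] by fastforce
        qed
        finally show ?thesis .
      qed
      moreover have "K b \<noteq> {}" using n by (auto simp: K_def)
      ultimately show ?thesis by auto
    qed
    also have "prob \<dots> = (\<Prod>t\<in>K b. prob (C t -` (update_matrix -` B (t - b * n)) \<inter> space M))"
    proof (rule indep_varsD[OF indep])
      fix t
      show "update_matrix -` B (t - b * n) \<in> sets borel"
        using measurable_sets[OF measurable_update_matrix borel_open[OF Bo[of "t - b * n"]]] by simp
    qed (use n in \<open>auto simp: K_def\<close>)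
    also have "\<dots> = (\<Prod>t\<in>K b. prob (A 1 -` B (t - b * n) \<inter> space M))"
    proof (intro prod.cong refl)
      fix t assume "t \<in> K b"
      then have "t \<ge> 1" by (auto simp: K_def)
      from prob_A[OF this borel_open[OF Bo[of "t - b * n"]]]
      show "prob (C t -` (update_matrix -` B (t - b * n)) \<inter> space M) = prob (A 1 -` B (t - b * n) \<inter> space M)"
        by (simp add: vimage_def)
    qed
    also have "\<dots> = p"
      unfolding p_def K_def
      by (rule prod.reindex_bij_witness[of _ "\<lambda>k. b * n + k" "\<lambda>t. t - b * n"]) auto
    finally show ?thesis .
  qed
  \<comment> \<open>The event that window \<open>k\<close> has no good block; with
    \<open>2 * k + 1\<close> independent blocks its probability decays geometrically in
    \<open>k\<close>.\<close>
  define bad where "bad k = (\<Inter>b\<in>{k\<^sup>2..<(Suc k)\<^sup>2}. X b -` (space (PiM (K b) (\<lambda>_. borel)) - S b) \<inter> space M)" for k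
  have Xm: "X b \<in> M \<rightarrow>\<^sub>M PiM (K b) (\<lambda>_. borel)" for b using Xind by (auto simp: indep_vars_def2)
  have ne: "{k\<^sup>2..<(Suc k)\<^sup>2} \<noteq> {}" for k by (simp add: power2_eq_square)
  have pbad: "prob (bad k) = (1 - p) ^ (2 * k + 1)" for k
  proof -
    have "prob (bad k) = (\<Prod>b\<in>{k\<^sup>2..<(Suc k)\<^sup>2}. prob (X b -` (space (PiM (K b) (\<lambda>_. borel)) - S b) \<inter> space M))"
      unfolding bad_def by (rule indep_varsD[OF Xind ne]) (use Sm in auto)
    also have "\<dots> = (\<Prod>b\<in>{k\<^sup>2..<(Suc k)\<^sup>2}. 1 - p)"
    proof (intro prod.cong refl)
      fix b
      have "X b -` (space (PiM (K b) (\<lambda>_. borel)) - S b) \<inter> space M = space M - (X b -` S b \<inter> space M)"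
        using measurable_space[OF Xm[of b]] by auto
      then show "prob (X b -` (space (PiM (K b) (\<lambda>_. borel)) - S b) \<inter> space M) = 1 - p"
        using prob_compl[OF measurable_sets[OF Xm Sm, of b]] pS by simp
    qed
    also have "\<dots> = (1 - p) ^ card {k\<^sup>2..<(Suc k)\<^sup>2}" by (rule prod_constant)
    also have "card {k\<^sup>2..<(Suc k)\<^sup>2} = 2 * k + 1" by (simp add: power2_eq_square)
    finally show ?thesis .
  qed
  have p1: "p \<le> 1" using pS[of 0] by (metis prob_le_1)
  have bad_m: "bad k \<in> events" for k
    unfolding bad_def using ne by (intro sets.finite_INT measurable_sets[OF Xm]) (use Sm in auto)
  have "AE \<omega> in M. \<forall>\<^sub>F k in sequentially. \<omega> \<in> space M - bad k"
  proof (rule borel_cantelli_AE1[OF bad_m])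
    have "summable (\<lambda>k. (1 - p) * ((1 - p)\<^sup>2) ^ k)"
    proof (intro summable_mult summable_geometric)
      have "\<bar>1 - p\<bar> < 1" using p0 p1 by auto
      then show "norm ((1 - p)\<^sup>2) < 1" by (simp add: abs_square_less_1)
    qed
    moreover have "prob (bad k) = (1 - p) * ((1 - p)\<^sup>2) ^ k" for k
      unfolding pbad by (simp add: power_mult[symmetric] mult.commute)
    ultimately show "summable (\<lambda>k. prob (bad k))" by simp
  qed (simp add: emeasure_eq_measure)
  then have "AE \<omega> in M. \<forall>\<^sub>F k in sequentially. \<exists>b\<in>{k\<^sup>2..<(Suc k)\<^sup>2}. \<forall>i. c / 2 \<le> trajectory (\<lambda>s. A s \<omega>) 1 (b * n + n) $ i"
    using AE_A_in_G
  proof eventually_elim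
    case (elim \<omega>)
    from elim(1) show ?case
    proof eventually_elim
      case (elim k)
      then obtain b where b: "b \<in> {k\<^sup>2..<(Suc k)\<^sup>2}" "X b \<omega> \<in> S b" 
        unfolding bad_def using measurable_space[OF Xm] by blast
      have "A (b * n + j) \<omega> \<in> B j" if "j \<in> {1..n}" for j
      proof -
        have "update_matrix (X b \<omega> (b * n + j)) \<in> B j" using b(2) that by (simp add: S_def)
        then show ?thesis using kK[OF that, of b] by (simp add: X_def)
      qed
      then have "c / 2 \<le> trajectory (\<lambda>s. A s \<omega>) 1 (b * n + n) $ i" for i
        by (intro B) (use \<open>\<forall>t\<ge>1. A t \<omega> \<in> G\<close> in auto)
      then show ?case using b(1) by blast
    qed
  qed
  then show thesis using that[OF n, of "c / 2"] U(2) by simp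
qed

end

section \<open>Decay of the deviations\<close>

context gossip
begin

lemma trajectory_measurable: "(\<lambda>\<omega>. trajectory (\<lambda>s. A s \<omega>) x t) \<in> borel_measurable M"
  by (rule measurable_trajectory) (use A_measurable in auto)

lemma AE_trajectory:
  "AE \<omega> in M. norm (trajectory (\<lambda>s. A s \<omega>) x t) \<le> (\<Sum>i\<in>UNIV. \<bar>x $ i\<bar>)"
  "AE \<omega> in M. trajectory (\<lambda>s. A s \<omega>) x t \<bullet> 1 = x \<bullet> 1"
proof -
  have 1: "(\<Sum>i\<in>UNIV. \<bar>trajectory a x t $ i\<bar>) \<le> (\<Sum>i\<in>UNIV. \<bar>x $ i\<bar>) \<and> trajectory a x t \<bullet> 1 = x \<bullet> 1"
    if a: "\<forall>t\<ge>1. col_stoch (a t)" for a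
  proof (induction t)
    case (Suc t)
    have "col_stoch (a (Suc t))" using a by simp
    from col_stoch_l1_mono[OF this, of "trajectory a x t"] col_stoch_mult_inner_1[OF this, of "trajectory a x t"] Suc
    show ?case by simp
  qed simp
  show "AE \<omega> in M. norm (trajectory (\<lambda>s. A s \<omega>) x t) \<le> (\<Sum>i\<in>UNIV. \<bar>x $ i\<bar>)"
    using AE_col_stoch
  proof eventually_elim
    case (elim \<omega>)
    show ?case using norm_le_l1_cart[of "trajectory (\<lambda>s. A s \<omega>) x t"] 1[OF elim] by linarith
  qed
  show "AE \<omega> in M. trajectory (\<lambda>s. A s \<omega>) x t \<bullet> 1 = x \<bullet> 1"
    using AE_col_stoch by eventually_elim (rule 1[THEN conjunct2])
qed

text \<open>The moment conditions produce the coefficient \<open>bcoef - \<beta> c (1 - l)\<close>, that is \<open>b\<close> with \<open>2 \<beta> c\<close> in place of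
  \<open>\<beta> c\<close>. As \<open>q\<^sup>2 \<beta> c \<ge> 0\<close>, the stated \<open>b\<close> is at least as large and only weakens the bound.\<close>

lemma second_moment_nonneg:
  assumes pc: "\<And>i j. \<beta> * (P $ i $ j)\<^sup>2 = \<beta> * c * P $ i $ j"
    and ev: "P *v v = l *\<^sub>R v" and nv: "v \<bullet> v = 1" and v1: "v \<bullet> 1 = 0"
  shows "0 \<le> q\<^sup>2 * (bcoef r \<alpha> \<beta> c l - \<beta> * c * (1 - l))"
proof -
  \<comment> \<open>The second moment identity at the deterministic start 1: \<open>v\<close> is
    orthogonal to it, so the \<open>delta\<close> term drops out, and its entries 1 leave the plain
    sum of \<open>kappa\<close>.\<close>
  have "0 \<le> (\<integral>\<omega>. (v \<bullet> (A 1 \<omega> *v trajectory (\<lambda>s. A s \<omega>) 1 0))\<^sup>2 \<partial>M)" by simp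
  also have "\<dots> = delta q u \<alpha> l * (\<integral>\<omega>. (v \<bullet> trajectory (\<lambda>s. A s \<omega>) 1 0)\<^sup>2 \<partial>M) +
      (\<Sum>i\<in>UNIV. kappa P q r \<alpha> \<beta> c l v i * (\<integral>\<omega>. (trajectory (\<lambda>s. A s \<omega>) 1 0 $ i)\<^sup>2 \<partial>M))"
    by (rule second_moment_step(2)[OF C_measurable AE_admissible moments stoch sym pc ev trajectory_measurable AE_trajectory(1)])
      (use indep_trajectory[of _ _ 1 0] in simp_all)
  also have "\<dots> = (\<Sum>i\<in>UNIV. kappa P q r \<alpha> \<beta> c l v i)" by (simp add: v1 prob_space)
  finally show ?thesis by (simp add: sum_kappa[OF stoch sym ev nv])
qed

text \<open>The sign of \<open>\<beta>\<close> is forced by the model. When \<open>\<beta>\<close>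
  is not 0, \<open>c < 1\<close> and column sum 1 give two entries \<open>c\<close> in one column,
  and the mixed moment of the corresponding entries of \<open>C 1\<close>, which are non-negative,
  is \<beta> q^2 c^2.\<close>

lemma q2_beta_nonneg:
  assumes "(0 < c \<and> c < 1 \<and> (\<forall>i j. P $ i $ j \<in> {0, c})) \<or> \<beta> = 0"
  shows "0 \<le> q\<^sup>2 * (\<beta> * c)"
proof (cases "\<beta> = 0")
  case False
  then have c: "0 < c" "c < 1" and P: "\<And>i j. P $ i $ j = 0 \<or> P $ i $ j = c" using assms by auto
  fix i :: 'n
  have s: "(\<Sum>j\<in>UNIV. P $ j $ i) = 1" using stoch by (simp add: column_stochastic_def)
  have "\<exists>j. P $ j $ i \<noteq> 0"
  proof (rule ccontr)
    assume "\<not> ?thesis" then show False using s by simp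
  qed
  then obtain j where j: "P $ j $ i = c" using P by metis
  have "\<exists>l. l \<noteq> j \<and> P $ l $ i \<noteq> 0"
  proof (rule ccontr)
    assume "\<not> ?thesis"
    then have "(\<Sum>j\<in>UNIV. P $ j $ i) = (\<Sum>j\<in>{j}. P $ j $ i)" by (intro sum.mono_neutral_right) auto
    then show False using s j c by simp
  qed
  then obtain l where l: "l \<noteq> j" "P $ l $ i = c" using P by metis
  have "0 \<le> (\<integral>\<omega>. C 1 \<omega> $ j $ i * C 1 \<omega> $ l $ i \<partial>M)"
    using AE_admissible[of 1] by (intro integral_nonneg_AE) (auto simp: admissible_def elim: eventually_mono)
  also have "\<dots> = \<beta> * q\<^sup>2 * c * c"
    using moments[of 1] j l by (simp add: moment_conditions_def)
  finally have "0 \<le> (q\<^sup>2 * (\<beta> * c)) * c" by (simp add: mult_ac)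
  then show ?thesis using c(1) by (simp add: zero_le_mult_iff)
qed simp

text \<open>The Lyapunov inequality is run at a rate \<open>\<zeta>\<close> strictly between the
  root and \<open>\<xi>\<close>. Markov's inequality at level \<open>\<xi> ^ t\<close> then leaves
  probabilities of order (\<zeta> / \<xi>)^t, and Borel-Cantelli applies.\<close>

lemma decay:
  assumes Pc: "(0 < c \<and> c < 1 \<and> (\<forall>i j. P $ i $ j \<in> {0, c})) \<or> \<beta> = 0"
    and diag: "\<And>i. P $ i $ i = 0"
    and dec: "decreasing_eigenvalues P lam"
    and \<xi>: "\<xi> > 0" "\<xi> > largest_root (f_poly CARD('n) q (Delta q u \<alpha> lam) (b_coeff r \<alpha> \<beta> c lam))"
    and y: "y \<bullet> 1 = 0"
  shows "\<exists>K. AE \<omega> in M. \<forall>\<^sub>F t in sequentially. (norm (trajectory (\<lambda>s. A s \<omega>) y t))\<^sup>2 \<le> K * \<xi> ^ t"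
proof -
  define N where "N = CARD('n)"
  let ?R = "largest_root (f_poly N q (Delta q u \<alpha> lam) (b_coeff r \<alpha> \<beta> c lam))"
  \<comment> \<open>The maximum with 0 keeps \<open>\<zeta>\<close> positive when the largest root
    is not.\<close>
  obtain \<zeta> where \<zeta>: "max 0 ?R < \<zeta>" "\<zeta> < \<xi>" using dense[of "max 0 ?R" \<xi>] \<xi> by (auto simp: N_def)
  have pc: "\<beta> * (P $ i $ j)\<^sup>2 = \<beta> * c * P $ i $ j" for i j
    using Pc by (auto simp: power2_eq_square)
  \<comment> \<open>With a single node the column sum 1 would sit on the diagonal, which is
    0.\<close>
  have N2: "N \<ge> 2"
  proof (rule ccontr)
    assume "\<not> N \<ge> 2"
    moreover have "N > 0" by (simp add: N_def)
    ultimately have "N = 1" by linarith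
    then obtain i :: 'n where i: "UNIV = {i}" by (auto simp: N_def card_1_singleton_iff)
    have "(\<Sum>j\<in>UNIV. P $ j $ i) = 1" using stoch by (simp add: column_stochastic_def)
    then show False using diag by (simp add: i)
  qed
  have P1: "P *v 1 = 1"
    using stoch by (simp add: vec_eq_iff matrix_vector_mult_def column_stochastic_def P_sym)
  obtain v :: "'n \<Rightarrow> real^'n" and l k0 where
    on: "\<And>i j. v i \<bullet> v j = (if i = j then 1 else 0)" and ev: "\<And>i. P *v v i = l i *\<^sub>R v i"
    and k0: "v k0 = (1 / sqrt CARD('n)) *\<^sub>R 1" "l k0 = 1"
    using symmetric_eigenbasis[OF sym P1] by metis
  have le1: "l k \<le> 1" for k using eigenvalue_le_1[OF stoch sym ev[of k]] on[of k k] by simp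
  have v1: "v k \<bullet> 1 = 0" if "k \<noteq> k0" for k
    using on[of k k0] that by (simp add: k0)
  have ms: "image_mset l (mset_set (- {k0})) = image_mset lam (mset_set {2..N})"
    unfolding N_def by (rule remaining_eigenvalues[OF charpoly_eigenbasis[OF on ev] le1 k0(2) dec])
  have sm: "(\<Sum>k\<in>-{k0}. F (l k)) = (\<Sum>j=2..N. F (lam j))" for F :: "real \<Rightarrow> real"
    using arg_cong[OF ms, of "\<lambda>m. sum_mset (image_mset F m)"]
    by (simp add: sum_unfold_sum_mset multiset.map_comp comp_def)
  have lamk: "\<exists>k. k \<noteq> k0 \<and> lam j = l k" if "j \<in> {2..N}" for j
  proof -
    have "lam j \<in># image_mset l (mset_set (- {k0}))" unfolding ms using that by simp
    then show ?thesis by auto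
  qed
  have klam: "\<exists>j\<in>{2..N}. l k = lam j" if "k \<noteq> k0" for k
  proof -
    have "l k \<in># image_mset lam (mset_set {2..N})" unfolding ms[symmetric] using that by simp
    then show ?thesis by auto
  qed
  have De: "Delta q u \<alpha> lam = (\<lambda>j. delta q u \<alpha> (lam j))" by (auto simp: Delta_def delta_def)
  have be: "b_coeff r \<alpha> \<beta> c lam = (\<lambda>j. bcoef r \<alpha> \<beta> c (lam j))" by (auto simp: b_coeff_def bcoef_def)
  have qb: "0 \<le> q\<^sup>2 * (\<beta> * c * (1 - l k))" for k
    using mult_nonneg_nonneg[OF q2_beta_nonneg[OF Pc], of "1 - l k"] le1[of k] by (simp add: mult_ac)
  have b0: "0 \<le> q\<^sup>2 * bcoef r \<alpha> \<beta> c (l k)" if "k \<noteq> k0" for k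
    using second_moment_nonneg[OF pc ev _ v1[OF that]] on[of k k] qb[of k] by (simp add: right_diff_distrib)
  have b1: "0 \<le> q\<^sup>2 * b_coeff r \<alpha> \<beta> c lam j" if "j \<in> {2..N}" for j
    using lamk[OF that] b0 by (auto simp: be)
  have \<zeta>R: "?R < \<zeta>" using \<zeta> by simp
  note roots = above_largest_root[OF N2 b1 \<zeta>R]
  have del: "delta q u \<alpha> (l k) < \<zeta>" if "k \<noteq> k0" for k
    using klam[OF that] roots(1) by (auto simp: De)
  have g: "q\<^sup>2 / CARD('n) * (\<Sum>k\<in>-{k0}. (bcoef r \<alpha> \<beta> c (l k) - \<beta> * c * (1 - l k)) / (\<zeta> - delta q u \<alpha> (l k))) \<le> 1"
  proof -
    have "q\<^sup>2 * (\<Sum>k\<in>-{k0}. (bcoef r \<alpha> \<beta> c (l k) - \<beta> * c * (1 - l k)) / (\<zeta> - delta q u \<alpha> (l k)))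
      \<le> q\<^sup>2 * (\<Sum>k\<in>-{k0}. bcoef r \<alpha> \<beta> c (l k) / (\<zeta> - delta q u \<alpha> (l k)))"
      unfolding sum_distrib_left times_divide_eq_right
    proof (rule sum_mono)
      fix k assume "k \<in> - {k0}"
      then have "0 < \<zeta> - delta q u \<alpha> (l k)" using del[of k] by simp
      then show "q\<^sup>2 * (bcoef r \<alpha> \<beta> c (l k) - \<beta> * c * (1 - l k)) / (\<zeta> - delta q u \<alpha> (l k)) \<le>
          q\<^sup>2 * bcoef r \<alpha> \<beta> c (l k) / (\<zeta> - delta q u \<alpha> (l k))"
        using qb[of k] by (intro divide_right_mono) (auto simp: right_diff_distrib)
    qed
    then have "q\<^sup>2 / CARD('n) * (\<Sum>k\<in>-{k0}. (bcoef r \<alpha> \<beta> c (l k) - \<beta> * c * (1 - l k)) / (\<zeta> - delta q u \<alpha> (l k)))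
      \<le> q\<^sup>2 / CARD('n) * (\<Sum>k\<in>-{k0}. bcoef r \<alpha> \<beta> c (l k) / (\<zeta> - delta q u \<alpha> (l k)))"
      by (simp add: divide_right_mono)
    also have "\<dots> < 1"
      using roots(2) unfolding De be N_def[symmetric] sm[of "\<lambda>x. bcoef r \<alpha> \<beta> c x / (\<zeta> - delta q u \<alpha> x)"] .
    finally show ?thesis by simp
  qed
  let ?y = "\<lambda>t \<omega>. trajectory (\<lambda>s. A s \<omega>) y t"
  define Q where "Q y = (\<Sum>k\<in>-{k0}. (v k \<bullet> y)\<^sup>2 / (\<zeta> - delta q u \<alpha> (l k)))" for y
  have Q0: "0 \<le> Q y" for y
    unfolding Q_def using del by (intro sum_nonneg divide_nonneg_pos) auto
  have ind: "indep_var borel (\<lambda>\<omega>. f (?y t \<omega>)) borel (\<lambda>\<omega>. g (C (Suc t) \<omega>))"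
    if "f \<in> borel_measurable borel" "g \<in> borel_measurable borel" for f g :: "_ \<Rightarrow> real" and t
    using indep_trajectory[OF that] .
  have y1: "AE \<omega> in M. ?y t \<omega> \<bullet> 1 = 0" for t using AE_trajectory(2)[of y t] y by simp
  have tr: "transitive_matrix P" using net by (simp add: network_assumptions_def)
  have step: "integrable M (\<lambda>\<omega>. Q (?y (Suc t) \<omega>))"
    "(\<integral>\<omega>. Q (?y (Suc t) \<omega>) \<partial>M) \<le> \<zeta> * (\<integral>\<omega>. Q (?y t \<omega>) \<partial>M)" for t
    by (simp only: trajectory.simps, rule lyapunov_step(1)[OF C_measurable AE_admissible moments stoch sym tr pc on ev k0(1)
        trajectory_measurable AE_trajectory(1) y1 ind del g Q_def]; simp)
      (simp only: trajectory.simps, rule lyapunov_step(2)[OF C_measurable AE_admissible moments stoch sym tr pc on ev k0(1)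
        trajectory_measurable AE_trajectory(1) y1 ind del g Q_def]; simp)
  have int: "integrable M (\<lambda>\<omega>. Q (?y t \<omega>))" for t
    by (cases t) (use step(1) in auto)
  have E: "(\<integral>\<omega>. Q (?y t \<omega>) \<partial>M) \<le> \<zeta> ^ t * Q y" for t
  proof (induction t)
    case (Suc t)
    then have "\<zeta> * (\<integral>\<omega>. Q (?y t \<omega>) \<partial>M) \<le> \<zeta> * (\<zeta> ^ t * Q y)" using \<zeta>(1) by (intro mult_left_mono) auto
    then show ?case using step(2)[of t] by (simp add: mult_ac)
  qed (simp add: prob_space)
  have "AE \<omega> in M. \<forall>\<^sub>F t in sequentially. \<omega> \<in> space M - {\<omega> \<in> space M. \<xi> ^ t \<le> Q (?y t \<omega>)}"
  proof (rule borel_cantelli_AE1)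
    fix t
    show ev: "{\<omega> \<in> space M. \<xi> ^ t \<le> Q (?y t \<omega>)} \<in> events"
      using int[of t] by (intro borel_measurable_le) auto
    show "emeasure M {\<omega> \<in> space M. \<xi> ^ t \<le> Q (?y t \<omega>)} < \<infinity>" by (simp add: emeasure_eq_measure)
  next
    show "summable (\<lambda>t. prob {\<omega> \<in> space M. \<xi> ^ t \<le> Q (?y t \<omega>)})"
    proof (rule summable_comparison_test')
      show "summable (\<lambda>t. Q y * (\<zeta> / \<xi>) ^ t)"
        using \<zeta> \<xi> by (intro summable_mult summable_geometric) auto
      fix t :: nat
      have "prob {\<omega> \<in> space M. \<xi> ^ t \<le> Q (?y t \<omega>)} \<le> (\<integral>\<omega>. Q (?y t \<omega>) \<partial>M) / \<xi> ^ t"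
        using \<xi>(1) Q0 by (intro integral_Markov_inequality_measure[OF int, of "{}"]) auto
      also have "\<dots> \<le> \<zeta> ^ t * Q y / \<xi> ^ t" using E \<xi>(1) by (intro divide_right_mono) auto
      finally show "norm (prob {\<omega> \<in> space M. \<xi> ^ t \<le> Q (?y t \<omega>)}) \<le> Q y * (\<zeta> / \<xi>) ^ t"
        by (simp add: power_divide mult_ac)
    qed
  qed
  \<comment> \<open>A common upper bound for the inverse weights of \<open>Q\<close>, so that
    \<open>K * Q z\<close> dominates the squared norm on vectors of entry sum 0.\<close>
  moreover define K where "K = (\<Sum>k\<in>-{k0}. \<zeta> - delta q u \<alpha> (l k))"
  have K0: "0 \<le> K" unfolding K_def using del by (intro sum_nonneg) (auto intro: less_imp_le)
  have nQ: "(norm z)\<^sup>2 \<le> K * Q z" if z: "z \<bullet> 1 = 0" for z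
  proof -
    have "(norm z)\<^sup>2 = (\<Sum>k\<in>UNIV. (v k \<bullet> z) * (v k \<bullet> z))"
      by (simp add: orthonormal_expansion[OF on] power2_norm_eq_inner)
    also have "\<dots> = (\<Sum>k\<in>-{k0}. (v k \<bullet> z)\<^sup>2)"
      using sum.remove[of UNIV k0 "\<lambda>k. (v k \<bullet> z) * (v k \<bullet> z)"] z
      by (simp add: Compl_eq_Diff_UNIV k0 inner_commute power2_eq_square)
    also have "\<dots> \<le> (\<Sum>k\<in>-{k0}. K * ((v k \<bullet> z)\<^sup>2 / (\<zeta> - delta q u \<alpha> (l k))))"
    proof (rule sum_mono)
      fix k assume k: "k \<in> - {k0}"
      then have p: "0 < \<zeta> - delta q u \<alpha> (l k)" using del[of k] by simp
      have "\<zeta> - delta q u \<alpha> (l k) \<le> K"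
        unfolding K_def using k del by (intro member_le_sum) (auto intro: less_imp_le)
      then have "(\<zeta> - delta q u \<alpha> (l k)) * ((v k \<bullet> z)\<^sup>2 / (\<zeta> - delta q u \<alpha> (l k))) \<le> K * ((v k \<bullet> z)\<^sup>2 / (\<zeta> - delta q u \<alpha> (l k)))"
        using p by (intro mult_right_mono) auto
      then show "(v k \<bullet> z)\<^sup>2 \<le> K * ((v k \<bullet> z)\<^sup>2 / (\<zeta> - delta q u \<alpha> (l k)))" using p by simp
    qed
    also have "\<dots> = K * Q z" by (simp add: Q_def sum_distrib_left)
    finally show ?thesis .
  qed
  have "AE \<omega> in M. \<forall>t. ?y t \<omega> \<bullet> 1 = 0" using y1 by (simp add: AE_all_countable)
  ultimately have "AE \<omega> in M. \<forall>\<^sub>F t in sequentially. (norm (?y t \<omega>))\<^sup>2 \<le> K * \<xi> ^ t"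
  proof eventually_elim
    case (elim \<omega>)
    from elim(1) show ?case
    proof eventually_elim
      case (elim t)
      then have "Q (?y t \<omega>) \<le> \<xi> ^ t" by auto
      then have "K * Q (?y t \<omega>) \<le> K * \<xi> ^ t" using K0 by (intro mult_left_mono)
      then show ?case using nQ \<open>\<forall>t. ?y t \<omega> \<bullet> 1 = 0\<close> by (meson order_trans)
    qed
  qed
  then show ?thesis by blast
qed

end

text \<open>Along rates decreasing to max 0 R the bound passes to the limit: by continuity of
  \<open>ln\<close> if R > 0, and otherwise because \<open>ln\<close> tends to minus infinity, the
  value of \<open>elog R\<close>.\<close>

lemma le_half_elog:
  assumes le: "\<And>\<xi>. \<lbrakk>\<xi> \<in> range (\<lambda>j. max 0 R + 1 / real (Suc j))\<rbrakk> \<Longrightarrow> L \<le> ereal (ln \<xi> / 2)"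
  shows "L \<le> ereal (1 / 2) * elog R"
proof -
  define x where "x j = max 0 R + 1 / real (Suc j)" for j
  have Lx: "L \<le> ereal (ln (x j) / 2)" for j by (rule le) (simp add: x_def)
  have inv: "(\<lambda>j. 1 / real (Suc j)) \<longlonglongrightarrow> 0"
    using LIMSEQ_inverse_real_of_nat by (simp add: inverse_eq_divide)
  show ?thesis
  proof (cases "R > 0")
    case True
    have "x \<longlonglongrightarrow> max 0 R + 0" unfolding x_def by (intro tendsto_intros inv)
    then have "(\<lambda>j. ln (x j) / 2) \<longlonglongrightarrow> ln R / 2" using True by (intro tendsto_intros) (auto simp: max_def)
    then have "(\<lambda>j. ereal (ln (x j) / 2)) \<longlonglongrightarrow> ereal (ln R / 2)" by simp
    then have "L \<le> ereal (ln R / 2)" by (rule LIMSEQ_le_const) (use Lx in blast)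
    then show ?thesis using True by (simp add: elog_def)
  next
    case False
    have "L \<le> ereal B" for B
    proof -
      have "filterlim (\<lambda>j. 1 / real (Suc j)) (at_right 0) sequentially"
        unfolding filterlim_at using inv by (auto intro!: always_eventually)
      then have "filterlim (\<lambda>j. ln (1 / real (Suc j))) at_bot sequentially"
        by (rule filterlim_compose[OF ln_at_0])
      then have "\<forall>\<^sub>F j in sequentially. ln (1 / real (Suc j)) \<le> 2 * B"
        by (simp add: filterlim_at_bot)
      then obtain j where "ln (1 / real (Suc j)) \<le> 2 * B" by (auto simp: eventually_sequentially)
      then have "ln (x j) / 2 \<le> B" using False by (simp add: x_def max_def)
      then show ?thesis using Lx[of j] by (meson ereal_less_eq(3) order_trans)
    qed
    then have "L = - \<infinity>" by (rule ereal_bot)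
    then show ?thesis by simp
  qed
qed

theorem theorem1:
  fixes M :: "'w measure"
    and C :: "nat \<Rightarrow> 'w \<Rightarrow> real^'n^'n"
    and P :: "real^'n^'n"
    and q u r \<alpha> \<beta> c :: real
    and lam :: "nat \<Rightarrow> real"
    and x0 :: "real^'n"
  assumes "prob_space M"
    and "q \<in> {0..1}" and "u \<in> {0..1}" and "r \<in> {0..1}"
    and "column_stochastic P"
    and "communication_assumptions M C P q u r \<alpha> \<beta>"
    and "network_assumptions P q u"
    and "\<forall>i. P $ i $ i = 0"
    and "(0 < c \<and> c < 1 \<and> (\<forall>i j. P $ i $ j \<in> {0, c})) \<or> \<beta> = 0"
    and "decreasing_eigenvalues P lam"
  shows "AE \<omega> in M.
    limsup (\<lambda>t. ereal (1 / real t) *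
      (MAX i. elog \<bar>trajectory (\<lambda>s. update_matrix (C s \<omega>)) x0 t $ i /
                     trajectory (\<lambda>s. update_matrix (C s \<omega>)) 1 t $ i -
                     (\<Sum>j\<in>UNIV. x0 $ j) / real CARD('n)\<bar>))
    \<le> ereal (1 / 2) *
      elog (largest_root
        (f_poly CARD('n) q (Delta q u \<alpha> lam) (b_coeff r \<alpha> \<beta> c lam)))"
proof -
  interpret gossip M C P q u r \<alpha> \<beta>
    using assms by (intro gossip.intro) (simp_all add: gossip_axioms_def)
  define R where "R = largest_root (f_poly CARD('n) q (Delta q u \<alpha> lam) (b_coeff r \<alpha> \<beta> c lam))"
  define m where "m = (\<Sum>j\<in>UNIV. x0 $ j) / real CARD('n)"
  obtain n \<delta> where n: "n > 0" "\<delta> > 0" and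
    good: "AE \<omega> in M. \<forall>\<^sub>F k in sequentially. \<exists>b\<in>{k\<^sup>2..<(Suc k)\<^sup>2}. \<forall>i. \<delta> \<le> trajectory (\<lambda>s. A s \<omega>) 1 (b * n + n) $ i"
    using good_blocks by blast
  have y: "(x0 - m *\<^sub>R 1) \<bullet> 1 = 0"
    by (simp add: m_def inner_vec_def sum_subtractf)
  \<comment> \<open>The exceptional null set depends on the rate, so only countably many rates are
    taken.\<close>
  have "AE \<omega> in M. \<forall>\<xi>\<in>range (\<lambda>j. max 0 R + 1 / real (Suc j)).
    limsup (\<lambda>t. ereal (1 / real t) * (MAX i. elog \<bar>trajectory (\<lambda>s. A s \<omega>) x0 t $ i / trajectory (\<lambda>s. A s \<omega>) 1 t $ i - m\<bar>))
      \<le> ereal (ln \<xi> / 2)"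
  proof (subst AE_ball_countable)
    show "\<forall>\<xi>\<in>range (\<lambda>j. max 0 R + 1 / real (Suc j)). AE \<omega> in M.
      limsup (\<lambda>t. ereal (1 / real t) * (MAX i. elog \<bar>trajectory (\<lambda>s. A s \<omega>) x0 t $ i / trajectory (\<lambda>s. A s \<omega>) 1 t $ i - m\<bar>))
        \<le> ereal (ln \<xi> / 2)"
    proof
      fix \<xi> assume "\<xi> \<in> range (\<lambda>j. max 0 R + 1 / real (Suc j))"
      then obtain j where "\<xi> = max 0 R + 1 / real (Suc j)" by blast
      moreover have "1 / real (Suc j) > 0" by simp
      ultimately have \<xi>: "\<xi> > 0" "\<xi> > R" by linarith+
      obtain K where "AE \<omega> in M. \<forall>\<^sub>F t in sequentially. (norm (trajectory (\<lambda>s. A s \<omega>) (x0 - m *\<^sub>R 1) t))\<^sup>2 \<le> K * \<xi> ^ t"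
        using decay[OF assms(9) _ assms(10) \<xi>(1) _ y] \<xi>(2) assms(8) unfolding R_def by blast
      then show "AE \<omega> in M.
        limsup (\<lambda>t. ereal (1 / real t) * (MAX i. elog \<bar>trajectory (\<lambda>s. A s \<omega>) x0 t $ i / trajectory (\<lambda>s. A s \<omega>) 1 t $ i - m\<bar>))
          \<le> ereal (ln \<xi> / 2)"
        using good AE_A_in_G
      proof eventually_elim
        case (elim \<omega>)
        show ?case
          by (rule limsup_relative_error[OF _ _ n elim(2) \<xi>(1) elim(1)]) (use elim(3) in \<open>auto simp: G_def\<close>)
      qed
    qed
  qed simp
  then show ?thesis
    unfolding R_def[symmetric] m_def[symmetric]
    by eventually_elim (rule le_half_elog, blast)
qed

end
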